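(* Assume that $V\in C^1(\mathbb{R}^N)$ satisfies (V3) $V$ has a strict local minimum at $x_0:=0$ with value $V(0)=0$: there exists $r_0>0$ such that $V(x)>0$ for any $x\in\overline{B_{4r_0}(0)}\setminus\{0\}$; (V4) the set $\mathcal{C}_0:=\{x\in\mathbb{R}^N:V(x)>0\}\cup\{0\}$ is bounded, and $\nabla V(x)\ne0$ for any $x\in\partial\mathcal{C}_0$; and that $\nabla V$ is locally Lipschitz continuous in $\mathbb{R}^N$. For any sequence $(c_n)\subset(0,\nu_1)$ with $c_n\to0^+$, where $\nu_1:=\min\{V(x):|x|=r_0\}$, let $q_{c_n}$ be, for each $n$, a minimization solution (as defined in the context) of $\ddot q=\nabla V(q)$ at energy $-c_n$ relative to the decomposition $\mathcal{V}^{c_n}_-:=\mathcal{V}^{c_n}\cap B_{r_0}(0)$, $\mathcal{V}^{c_n}_+:=\mathcal{V}^{c_n}\setminus B_{r_0}(0)$. Then, up to translations and a subsequence, $q_{c_n}\to q_0$ in $C^2_{loc}(\mathbb{R},\mathbb{R}^N)$ (that is, there are a subsequence $(c_{n_k})$ and reals $\tau_k$ with $q_{c_{n_k}}(\cdot-\tau_k)\to q_0$ in $C^2_{loc}(\mathbb{R},\mathbb{R}^N)$), where $q_0$ is a solution of $\ddot q=\nabla V(q)$ on $\mathbb{R}$ of homoclinic type at $x_0=0$.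
   Context: $N\ge2$ is an integer; $\mathrm{dist}$ is Euclidean distance; $B_r(x)$ is the open ball; $\mathcal{V}^c:=\{x\in\mathbb{R}^N:V(x)\le c\}$. For $c\in[0,\nu_1)$ the two sets $\mathcal{V}^c\cap B_{r_0}(0)$ and $\mathcal{V}^c\setminus B_{r_0}(0)$ are closed and at positive distance. Homoclinic type at $0$: a solution $q_0$ of $\ddot q=\nabla V(q)$ on $\mathbb{R}$ is of homoclinic type at $0$ if $q_0(t)\to0$ and $\dot q_0(t)\to0$ as $t\to\pm\infty$, and there is $\sigma\in\mathbb{R}$ with $q_0(\sigma)\in\partial\mathcal{C}_0$, $\nabla V(q_0(\sigma))\neq0$, $\dot q_0(\sigma)=0$, $V(q_0(t))>0$ for all $t\ne\sigma$, and $q_0(\sigma+t)=q_0(\sigma-t)$ for all $t\in\mathbb{R}$. Variational setting for a decomposition $\mathcal{V}^c=\mathcal{V}^c_-\cup\mathcal{V}^c_+$ into closed sets at positive distance. $\Gamma_c$ is the set of $q\in H^1_{loc}(\mathbb{R},\mathbb{R}^N)$ such that $V(q(t))\ge c$ for all $t$ and $\liminf_{t\to-\infty}\mathrm{dist}(q(t),\mathcal{V}^c_-)=\liminf_{t\to+\infty}\mathrm{dist}(q(t),\mathcal{V}^c_+)=0$. $J_c(q):=\int_{\mathbb{R}}\tfrac12|\dot q|^2+(V(q)-c)\,dt$ and $m_c:=\inf_{\Gamma_c}J_c$. Let $R>0$ be such that $m_c=\inf\{J_c(q):q\in\Gamma_c,\|q\|_{L^\infty}\le R\}$ (such $R$ exists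 in the present setting), $4\rho_0:=\mathrm{dist}(\mathcal{V}^c_-\cap B_R(0),\mathcal{V}^c_+\cap B_R(0))>0$, and $\mathcal{M}_c:=\{q\in\Gamma_c:\mathrm{dist}(q(0),\mathcal{V}^c)=\rho_0,\ J_c(q)=m_c,\ \|q\|_{L^\infty}\le R\}$, which is nonempty. For $q\in\mathcal{M}_c$ let $\alpha_q:=\sup\{t:q(t)\in\mathcal{V}^c_-\}$ if $q(\mathbb{R})\cap\mathcal{V}^c_-\ne\emptyset$, $\alpha_q:=-\infty$ otherwise; $\omega_q:=\inf\{t>\alpha_q:q(t)\in\mathcal{V}^c_+\}$ if $q(\mathbb{R})\cap\mathcal{V}^c_+\neq\emptyset$, $\omega_q:=+\infty$ otherwise. Minimization solution. Given $q\in\mathcal{M}_c$, the minimization solution $q_c$ generated by $q$ at energy $-c$ is: $q_c=q$ if $\alpha_q=-\infty$, $\omega_q=+\infty$; if $\alpha_q=-\infty$ and $\omega_q<+\infty$, $q_c=q$ on $(-\infty,\omega_q]$ extended to $\mathbb{R}$ by reflection $q_c(2\omega_q-t)=q_c(t)$; if $\alpha_q>-\infty$ and $\omega_q=+\infty$, $q_c=q$ on $[\alpha_q,+\infty)$ extended by reflection $q_c(2\alpha_q-t)=q_c(t)$; if both are finite, $q_c=q$ on $[\alpha_q,\omega_q]$ extended by reflection about $\omega_q$ and then $2(\omega_q-\alpha_q)$-periodically to $\mathbb{R}$. Then $q_c\in C^2(\mathbb{R},\mathbb{R}^N)$ solves $\ddot q=\nabla V(q)$, has energy $\tfrac12|\dot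 q_c|^2-V(q_c)\equiv-c$, and satisfies $\inf_t\mathrm{dist}(q_c(t),\mathcal{V}^c_\pm)=0$. *)

theory Defs
  imports "HOL-Analysis.Analysis"
begin

abbreviation vderiv :: "(real \<Rightarrow> 'a::real_normed_vector) \<Rightarrow> real \<Rightarrow> 'a" where
  "vderiv q \<equiv> (\<lambda>t. vector_derivative q (at t))"

definition C2 :: "(real \<Rightarrow> 'a::real_normed_vector) \<Rightarrow> bool" where
  "C2 q \<longleftrightarrow> q C1_differentiable_on UNIV \<and> vderiv q C1_differentiable_on UNIV"

definition C2_loc_converges ::
    "(nat \<Rightarrow> real \<Rightarrow> 'a::real_normed_vector) \<Rightarrow> (real \<Rightarrow> 'a) \<Rightarrow> bool" where
  "C2_loc_converges f q \<longleftrightarrow> (\<forall>k. C2 (f k)) \<and> C2 q \<and>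
     (\<forall>K. compact K \<longrightarrow>
        uniform_limit K f q sequentially \<and>
        uniform_limit K (\<lambda>k. vderiv (f k)) (vderiv q) sequentially \<and>
        uniform_limit K (\<lambda>k. vderiv (vderiv (f k))) (vderiv (vderiv q)) sequentially)"

definition solution :: "('a::real_inner \<Rightarrow> 'a) \<Rightarrow> (real \<Rightarrow> 'a) \<Rightarrow> bool" where
  "solution gradV q \<longleftrightarrow> C2 q \<and> (\<forall>t. vderiv (vderiv q) t = gradV (q t))"


subsection \<open>The space of locally \<open>H\<^sup>1\<close> curves\<close>

definition L2_loc :: "(real \<Rightarrow> 'a::euclidean_space) \<Rightarrow> bool" where
  "L2_loc g \<longleftrightarrow> g \<in> borel_measurable lborel \<and>
     (\<forall>a b. set_integrable lborel {a..b} (\<lambda>t. (norm (g t))\<^sup>2))"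

text \<open>As in Brezis' treatment of Sobolev spaces on an interval, the test functions are the
  compactly supported \<open>C\<^sup>1\<close> functions.\<close>

definition has_weak_derivative ::
    "(real \<Rightarrow> 'a::euclidean_space) \<Rightarrow> (real \<Rightarrow> 'a) \<Rightarrow> bool" where
  "has_weak_derivative q g \<longleftrightarrow>
     (\<forall>\<phi> :: real \<Rightarrow> real. \<phi> C1_differentiable_on UNIV \<and> compact (closure {t. \<phi> t \<noteq> 0}) \<longrightarrow>
        (LINT t|lborel. vderiv \<phi> t *\<^sub>R q t) = - (LINT t|lborel. \<phi> t *\<^sub>R g t))"

text \<open>Pointwise conditions such as \<open>V (q t) \<ge> c\<close> for all \<open>t\<close> refer to the continuous
  representative of a class in \<open>H\<^sup>1\<^sub>l\<^sub>o\<^sub>c\<close>; membership is therefore formulated for continuous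
  functions, for which local square integrability is automatic.\<close>

definition H1_loc :: "(real \<Rightarrow> 'a::euclidean_space) set" where
  "H1_loc = {q. continuous_on UNIV q \<and> (\<exists>g. L2_loc g \<and> has_weak_derivative q g)}"

text \<open>For \<open>q \<in> H1_loc\<close> the function chosen here is unique up to a null set.\<close>

definition weak_derivative :: "(real \<Rightarrow> 'a::euclidean_space) \<Rightarrow> real \<Rightarrow> 'a" where
  "weak_derivative q = (SOME g. L2_loc g \<and> has_weak_derivative q g)"


subsection \<open>The variational problem\<close>

definition sublevel :: "('a \<Rightarrow> real) \<Rightarrow> real \<Rightarrow> 'a set" where
  "sublevel V c = {x. V x \<le> c}"

text \<open>\<open>Vm\<close> and \<open>Vp\<close> are the two parts of the decomposition of \<open>sublevel V c\<close>.\<close>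

definition Gamma_set ::
    "('a::euclidean_space \<Rightarrow> real) \<Rightarrow> 'a set \<Rightarrow> 'a set \<Rightarrow> real \<Rightarrow> (real \<Rightarrow> 'a) set" where
  "Gamma_set V Vm Vp c = {q \<in> H1_loc. (\<forall>t. V (q t) \<ge> c) \<and>
     Liminf at_bot (\<lambda>t. ereal (infdist (q t) Vm)) = 0 \<and>
     Liminf at_top (\<lambda>t. ereal (infdist (q t) Vp)) = 0}"

text \<open>The action takes values in \<open>[0, \<infinity>]\<close>; its integrand is nonnegative on \<open>Gamma_set\<close>, the only
  place where it is used, so that no truncation takes place in the conversion to \<^typ>\<open>ennreal\<close>.\<close>

definition J_fun :: "('a::euclidean_space \<Rightarrow> real) \<Rightarrow> real \<Rightarrow> (real \<Rightarrow> 'a) \<Rightarrow> ennreal" where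
  "J_fun V c q =
     (\<integral>\<^sup>+ t. ennreal ((norm (weak_derivative q t))\<^sup>2 / 2 + (V (q t) - c)) \<partial>lborel)"

definition m_val ::
    "('a::euclidean_space \<Rightarrow> real) \<Rightarrow> 'a set \<Rightarrow> 'a set \<Rightarrow> real \<Rightarrow> ennreal" where
  "m_val V Vm Vp c = (INF q \<in> Gamma_set V Vm Vp c. J_fun V c q)"

definition rho0 :: "'a::euclidean_space set \<Rightarrow> 'a set \<Rightarrow> real \<Rightarrow> real" where
  "rho0 Vm Vp R = setdist (Vm \<inter> ball 0 R) (Vp \<inter> ball 0 R) / 4"

text \<open>For continuous \<open>q\<close> the bound on the sup norm of \<open>q\<close> is the same as a pointwise one.\<close>

definition admissible_radius ::
    "('a::euclidean_space \<Rightarrow> real) \<Rightarrow> 'a set \<Rightarrow> 'a set \<Rightarrow> real \<Rightarrow> real \<Rightarrow> bool" where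
  "admissible_radius V Vm Vp c R \<longleftrightarrow> R > 0 \<and> rho0 Vm Vp R > 0 \<and>
     m_val V Vm Vp c =
       (INF q \<in> {q \<in> Gamma_set V Vm Vp c. \<forall>t. norm (q t) \<le> R}. J_fun V c q)"

definition M_set ::
    "('a::euclidean_space \<Rightarrow> real) \<Rightarrow> 'a set \<Rightarrow> 'a set \<Rightarrow> real \<Rightarrow> real \<Rightarrow> (real \<Rightarrow> 'a) set" where
  "M_set V Vm Vp c R = {q \<in> Gamma_set V Vm Vp c.
     infdist (q 0) (sublevel V c) = rho0 Vm Vp R \<and>
     J_fun V c q = m_val V Vm Vp c \<and> (\<forall>t. norm (q t) \<le> R)}"

text \<open>In \<^typ>\<open>ereal\<close> the supremum and infimum of the empty set are \<open>-\<infinity>\<close> and \<open>\<infinity>\<close>, which are the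
  values prescribed when \<open>q\<close> does not meet \<open>Vm\<close>, respectively \<open>Vp\<close>.\<close>

definition alpha_time :: "'a set \<Rightarrow> (real \<Rightarrow> 'a) \<Rightarrow> ereal" where
  "alpha_time Vm q = Sup (ereal ` {t. q t \<in> Vm})"

definition omega_time :: "'a set \<Rightarrow> 'a set \<Rightarrow> (real \<Rightarrow> 'a) \<Rightarrow> ereal" where
  "omega_time Vm Vp q = Inf (ereal ` {t. ereal t > alpha_time Vm q \<and> q t \<in> Vp})"

definition generates ::
    "'a set \<Rightarrow> 'a set \<Rightarrow> (real \<Rightarrow> 'a) \<Rightarrow> (real \<Rightarrow> 'a) \<Rightarrow> bool" where
  "generates Vm Vp q qc \<longleftrightarrow>
     (alpha_time Vm q = -\<infinity> \<and> omega_time Vm Vp q = \<infinity> \<and> qc = q) \<or>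
     (\<exists>b. alpha_time Vm q = -\<infinity> \<and> omega_time Vm Vp q = ereal b \<and>
        (\<forall>t\<le>b. qc t = q t \<and> qc (2 * b - t) = q t)) \<or>
     (\<exists>a. alpha_time Vm q = ereal a \<and> omega_time Vm Vp q = \<infinity> \<and>
        (\<forall>t\<ge>a. qc t = q t \<and> qc (2 * a - t) = q t)) \<or>
     (\<exists>a b. alpha_time Vm q = ereal a \<and> omega_time Vm Vp q = ereal b \<and>
        (\<forall>t\<in>{a..b}. qc t = q t \<and> qc (2 * b - t) = q t) \<and>
        (\<forall>t. qc (t + 2 * (b - a)) = qc t))"

definition minimization_solution ::
    "('a::euclidean_space \<Rightarrow> real) \<Rightarrow> 'a set \<Rightarrow> 'a set \<Rightarrow> real \<Rightarrow> (real \<Rightarrow> 'a) \<Rightarrow> bool" where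
  "minimization_solution V Vm Vp c qc \<longleftrightarrow>
     (\<exists>R. admissible_radius V Vm Vp c R \<and> (\<exists>q \<in> M_set V Vm Vp c R. generates Vm Vp q qc))"


subsection \<open>Homoclinic solutions\<close>

definition C0_set :: "('a::real_normed_vector \<Rightarrow> real) \<Rightarrow> 'a set" where
  "C0_set V = {x. V x > 0} \<union> {0}"

definition homoclinic_type ::
    "('a::real_inner \<Rightarrow> real) \<Rightarrow> ('a \<Rightarrow> 'a) \<Rightarrow> (real \<Rightarrow> 'a) \<Rightarrow> bool" where
  "homoclinic_type V gradV q \<longleftrightarrow> solution gradV q \<and>
     (q \<longlongrightarrow> 0) at_bot \<and> (q \<longlongrightarrow> 0) at_top \<and>
     (vderiv q \<longlongrightarrow> 0) at_bot \<and> (vderiv q \<longlongrightarrow> 0) at_top \<and>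
     (\<exists>\<sigma>. q \<sigma> \<in> frontier (C0_set V) \<and> gradV (q \<sigma>) \<noteq> 0 \<and> vderiv q \<sigma> = 0 \<and>
        (\<forall>t. t \<noteq> \<sigma> \<longrightarrow> V (q t) > 0) \<and> (\<forall>t. q (\<sigma> + t) = q (\<sigma> - t)))"

end

theory Submission
  imports Defs
begin

text \<open>
  A minimizer \<open>q\<close> at level \<open>c\<close> is free on \<open>(\<alpha>\<^sub>q, \<omega>\<^sub>q)\<close>, so hat-shaped variations give the Euler-Lagrange
  equation there; its energy is \<open>- c\<close> because the action is finite (unbounded interval) or by rescaling
  time (bounded interval). Hence \<open>q\<close> comes to rest at \<open>\<alpha>\<^sub>q\<close> and \<open>\<omega>\<^sub>q\<close>, and its reflections solve the
  equation on the whole line. For small \<open>c\<close> the gradient does not vanish on the outer part of \<open>{V = c}\<close>,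
  which forces \<open>\<omega>\<^sub>q < \<infinity>\<close>; translate so that \<open>\<omega>\<^sub>q = 0\<close>.

  A straight path shows that the minimal actions stay bounded as \<open>c\<close> tends to 0. Gronwall's inequality
  makes the translated solutions converge as soon as their initial positions do, and, applied to the
  equilibrium 0, it makes \<open>\<omega>\<^sub>q - \<alpha>\<^sub>q\<close> tend to \<open>\<infinity>\<close>. So the limit \<open>q\<^sub>0\<close> is even, has energy 0 and finite action
  on the line. Finite action gives \<open>V(q\<^sub>0) \<longlongrightarrow> 0\<close>, and a limit point on the frontier of \<open>\<C>\<^sub>0\<close> would be
  critical, so \<open>q\<^sub>0\<close> tends to 0. A second zero of \<open>V(q\<^sub>0)\<close> would be a second centre of symmetry, making
  \<open>q\<^sub>0\<close> periodic.
\<close>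

section \<open>Weak derivatives\<close>

text \<open>Two difficulties shape the proof. A minimizer is only known to be continuous with a weak
  derivative, and the constraint \<open>V (q t) \<ge> c\<close> forbids two-sided variations
  wherever \<open>q\<close> touches the level set. Regularity is therefore obtained only on the free
  interval, but it is stored in curves \<open>G\<close> and \<open>v\<close> defined on the whole
  line: \<open>v\<close> has derivative \<open>gradV (q t)\<close> everywhere, and
  \<open>q = G\<close> holds on the closed interval only. One-sided derivatives at contact times
  never occur, and reflections are glued from two-sided ones.

  All estimates are uniform in the level. Because \<open>c > 0\<close>, a curve with
  \<open>V (q t) \<ge> c\<close> stays where \<open>V\<close> is positive, hence in one ball of
  radius \<open>B\<close>, on which the gradient has one Lipschitz constant \<open>L\<close>. The
  translated curves are at rest at time 0, so their initial data reduce to positions in a compact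
  set outside the open ball of radius \<open>r0\<close>; no equicontinuity argument is needed, and
  the limit cannot be the equilibrium.\<close>

lemma AE_zero_if_interval_integrals_zero:
  fixes g :: "real \<Rightarrow> 'a::euclidean_space"
  assumes int: "set_integrable lborel {a..b} g"
    and zero: "\<And>x y. a \<le> x \<Longrightarrow> x \<le> y \<Longrightarrow> y \<le> b \<Longrightarrow> integral {x..y} g = 0"
  shows "AE t in lborel. t \<in> {a..b} \<longrightarrow> g t = 0"
proof -
  define f where "f t = indicator {a..b} t *\<^sub>R g t" for t
  have intf: "integrable lborel f"
    using int unfolding set_integrable_def f_def .
  have "f integrable_on cbox u v" for u v
    using integrable_mult_indicator[OF _ intf, of "{u..v}"]
    by (intro set_borel_integral_eq_integral) (simp add: set_integrable_def)
  \<comment> \<open>Lebesgue differentiation: off a negligible set the averages of \<open>f\<close>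
    over \<open>{x..x+h}\<close> tend to \<open>f x\<close>. For small \<open>h\<close> these
    averages are those of \<open>g\<close> and vanish, so \<open>f x\<close> vanishes too.\<close>
  then obtain N where N: "negligible N" and lim: "\<And>x e. \<lbrakk>x \<notin> N; 0 < e\<rbrakk> \<Longrightarrow>
      \<exists>d>0. \<forall>h. 0 < h \<and> h < d \<longrightarrow> norm(integral (cbox x (x + h *\<^sub>R One)) f /\<^sub>R h ^ DIM(real) - f x) < e"
    using integrable_ccontinuous_explicit[of f] by metis
  have "g x = 0" if x: "x \<notin> N" "a < x" "x < b" for x
  proof (rule ccontr)
    assume "g x \<noteq> 0"
    with lim[of x "norm (g x)"] x obtain d where d: "d > 0"
      "\<And>h. 0 < h \<Longrightarrow> h < d \<Longrightarrow> norm(integral {x..x+h} f /\<^sub>R h - f x) < norm (g x)"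
      by auto
    define h where "h = min (d/2) (b - x)"
    have h: "0 < h" "h < d" "x + h \<le> b" using d x by (auto simp: h_def)
    have "integral {x..x+h} f = integral {x..x+h} g"
      by (rule integral_cong) (use h x in \<open>auto simp: f_def\<close>)
    also have "\<dots> = 0" using zero h x by auto
    finally show False using d(2)[OF h(1,2)] x by (simp add: f_def)
  qed
  moreover have "AE x in lebesgue. x \<notin> N \<union> {a,b}"
    using N by (intro AE_not_in) (simp add: negligible_iff_null_sets[symmetric])
  ultimately have "AE t in lebesgue. f t = 0"
    by (elim eventually_mono) (auto simp: f_def indicator_def less_le)
  then have "AE t in lborel. f t = 0"
    by (simp add: AE_completion_iff)
  then show ?thesis by eventually_elim (auto simp: f_def)
qed

lemma set_integrable_continuous_Icc:
  fixes f :: "real \<Rightarrow> 'a::euclidean_space"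
  shows "continuous_on {a..b} f \<Longrightarrow> set_integrable lborel {a..b} f"
  by (rule borel_integrable_compact[of "{a..b}" f, unfolded set_integrable_def[symmetric]]) auto

lemma L2_loc_set_integrable:
  assumes "L2_loc g"
  shows "set_integrable lborel {a..b} g"
proof (rule set_integrable_bound)
  have m: "g \<in> borel_measurable borel" using assms by (simp add: L2_loc_def)
  show "set_integrable lborel {a..b} (\<lambda>t. 1 + (norm (g t))\<^sup>2)"
    using assms by (intro set_integral_add(1) set_integrable_continuous_Icc[of a b "\<lambda>_. 1"]) (auto simp: L2_loc_def)
  show "set_borel_measurable lborel {a..b} g"
    using m by (simp add: set_borel_measurable_def)
  have "u \<le> 1 + u\<^sup>2" for u :: real
    using zero_le_power2[of "u - 1/2"] by (simp add: power2_eq_square algebra_simps)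
  then show "AE t in lborel. t \<in> {a..b} \<longrightarrow> norm (g t) \<le> norm (1 + (norm (g t))\<^sup>2)"
    by (auto intro: order_trans[OF _ abs_ge_self])
qed

section \<open>A C1 step function, mollification, and the fundamental theorem of calculus for weak
  derivatives\<close>

definition smooth_step :: "real \<Rightarrow> real" where
  "smooth_step s = 2 * (max 0 s)\<^sup>2 - 4 * (max 0 (s - 1/2))\<^sup>2 + 2 * (max 0 (s - 1))\<^sup>2"

text \<open>The tent of height 2 over \<open>{0..1}\<close>, a probability density;
  \<open>smooth_step\<close> is its primitive rising from 0 to 1. Writing both with truncated powers
  at the corners 0, 1/2 and 1 reduces differentiation to the single function
  \<open>(max 0 s)\<^sup>2\<close>.\<close>

definition hat_step :: "real \<Rightarrow> real" where
  "hat_step s = 4 * max 0 s - 8 * max 0 (s - 1/2) + 4 * max 0 (s - 1)"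

lemma DERIV_max_0_square: "((\<lambda>s. (max 0 s)\<^sup>2) has_real_derivative 2 * max 0 s) (at s)"
proof -
  consider "s < 0" | "s = 0" | "s > 0" by linarith
  then show ?thesis
  proof cases
    case 1
    have "((\<lambda>s::real. 0) has_real_derivative 2 * max 0 s) (at s)" using 1 by simp
    then show ?thesis
      by (rule has_field_derivative_transform_within[where d="-s"]) (use 1 in \<open>auto simp: dist_real_def\<close>)
  next
    case 2
    have "((\<lambda>h::real. (max 0 h)\<^sup>2 / h) \<longlongrightarrow> 0) (at 0)"
    proof (rule Lim_null_comparison[where g="\<lambda>h. \<bar>h\<bar>"])
      show "\<forall>\<^sub>F h::real in at 0. norm ((max 0 h)\<^sup>2 / h) \<le> \<bar>h\<bar>"
        by (auto simp: eventually_at_filter max_def power2_eq_square)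
    qed (auto intro!: tendsto_eq_intros)
    then show ?thesis using 2 by (simp add: has_field_derivative_iff)
  next
    case 3
    have "((\<lambda>s::real. s\<^sup>2) has_real_derivative 2 * max 0 s) (at s)" using 3
      by (auto intro!: derivative_eq_intros)
    then show ?thesis
      by (rule has_field_derivative_transform_within[where d="s"]) (use 3 in \<open>auto simp: dist_real_def\<close>)
  qed
qed

lemma DERIV_smooth_step: "(smooth_step has_real_derivative hat_step s) (at s)"
proof -
  have *: "((\<lambda>s. (max 0 (s - a))\<^sup>2) has_real_derivative 2 * max 0 (s - a)) (at s)" for a
    using DERIV_chain2[OF DERIV_max_0_square, where g="\<lambda>s. s - a" and x=s and Db=1 and s=UNIV]
    by (simp add: DERIV_diff[where D=1 and E=0, simplified])
  show ?thesis unfolding smooth_step_def hat_step_def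
    by (rule derivative_eq_intros DERIV_max_0_square * refl)+ simp
qed

lemma smooth_step_le_0: "s \<le> 0 \<Longrightarrow> smooth_step s = 0"
  by (simp add: smooth_step_def)

lemma smooth_step_ge_1: "s \<ge> 1 \<Longrightarrow> smooth_step s = 1"
  by (simp add: smooth_step_def power2_eq_square algebra_simps)

lemma continuous_hat_step [continuous_intros]:
  "continuous_on A f \<Longrightarrow> continuous_on A (\<lambda>x. hat_step (f x))"
  unfolding hat_step_def by (intro continuous_intros)

lemma isCont_hat_step: "isCont hat_step s"
  using continuous_hat_step[OF continuous_on_id, of UNIV] by (simp add: continuous_on_eq_continuous_at)

lemma hat_step_nonneg: "hat_step s \<ge> 0"
  by (auto simp: hat_step_def max_def)

lemma hat_step_outside: "s \<notin> {0..1} \<Longrightarrow> hat_step s = 0"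
  by (auto simp: hat_step_def max_def)

lemma smooth_step_mono: "s \<le> t \<Longrightarrow> smooth_step s \<le> smooth_step t"
  by (rule DERIV_nonneg_imp_nondecreasing) (use DERIV_smooth_step hat_step_nonneg in blast)+

lemma smooth_step_range: "0 \<le> smooth_step s" "smooth_step s \<le> 1"
  using smooth_step_mono[of "min 0 s" s] smooth_step_mono[of s "max 1 s"]
    smooth_step_le_0[of "min 0 s"] smooth_step_ge_1[of "max 1 s"] by auto

lemma has_bochner_integral_hat_step: "has_bochner_integral lborel hat_step 1"
proof -
  have "has_bochner_integral lborel (\<lambda>x. hat_step x * indicator {0..1} x) (smooth_step 1 - smooth_step 0)"
    by (rule has_bochner_integral_FTC_Icc_real)
      (auto intro: DERIV_smooth_step isCont_hat_step)
  moreover have "(\<lambda>x. hat_step x * indicator {0..1} x) = hat_step"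
    using hat_step_outside by (fastforce simp: indicator_def)
  ultimately show ?thesis by (simp add: smooth_step_le_0 smooth_step_ge_1)
qed

text \<open>The substitution \<open>t = x + s / (n + 1)\<close> moves the dependence on
  \<open>n\<close> from the kernel to the argument of \<open>q\<close>. The kernel lives on
  \<open>{0..1}\<close>, so only values of \<open>q\<close> on \<open>{x..x+1}\<close> enter; a
  bound for them dominates the integrands.\<close>

lemma mollification_tendsto:
  fixes q :: "real \<Rightarrow> 'a::euclidean_space"
  assumes q: "continuous_on UNIV q"
  shows "(\<lambda>n. LINT t|lborel. (real (Suc n) * hat_step (real (Suc n) * (t - x))) *\<^sub>R q t) \<longlonglongrightarrow> q x"
proof -
  have "bounded (q ` {x..x+1})"
    by (intro compact_imp_bounded compact_continuous_image continuous_on_subset[OF q]) auto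
  then obtain B where B: "\<And>t. t \<in> {x..x+1} \<Longrightarrow> norm (q t) \<le> B"
    by (metis bounded_iff imageI)
  have qx: "isCont q y" for y using q by (simp add: continuous_on_eq_continuous_at)
  have meas [measurable]: "q \<in> borel_measurable borel" "hat_step \<in> borel_measurable borel"
    using q by (auto intro!: borel_measurable_continuous_onI continuous_at_imp_continuous_on isCont_hat_step)
  have eq: "(LINT t|lborel. (real (Suc n) * hat_step (real (Suc n) * (t - x))) *\<^sub>R q t)
    = (LINT s|lborel. hat_step s *\<^sub>R q (x + s / real (Suc n)))" for n
    by (subst lborel_integral_real_affine[where c="1 / real (Suc n)" and t=x])
      (simp_all del: of_nat_Suc integral_scaleR_right add: integral_scaleR_right[symmetric])
  have "(\<lambda>n. LINT s|lborel. hat_step s *\<^sub>R q (x + s / real (Suc n))) \<longlonglongrightarrow> (LINT s|lborel. hat_step s *\<^sub>R q x)"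
  proof (rule integral_dominated_convergence)
    show "integrable lborel (\<lambda>s. hat_step s * B)"
      using has_bochner_integral_hat_step by (auto simp: has_bochner_integral_iff)
    show "AE s in lborel. (\<lambda>n. hat_step s *\<^sub>R q (x + s / real (Suc n))) \<longlonglongrightarrow> hat_step s *\<^sub>R q x"
    proof (intro AE_I2 tendsto_scaleR tendsto_const isCont_tendsto_compose[OF qx])
      fix s :: real
      have "(\<lambda>n. x + s * (1 / real (Suc n))) \<longlonglongrightarrow> x + s * 0"
        by (intro tendsto_intros LIMSEQ_inverse_real_of_nat[unfolded inverse_eq_divide])
      then show "(\<lambda>n. x + s / real (Suc n)) \<longlonglongrightarrow> x" by simp
    qed
    show "AE s in lborel. norm (hat_step s *\<^sub>R q (x + s / real (Suc n))) \<le> hat_step s * B" for n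
    proof (intro AE_I2)
      fix s :: real
      show "norm (hat_step s *\<^sub>R q (x + s / real (Suc n))) \<le> hat_step s * B"
      proof (cases "s \<in> {0..1}")
        case True
        then have "s / real (Suc n) \<le> 1" "0 \<le> s / real (Suc n)" by (auto simp: divide_simps)
        then show ?thesis using B[of "x + s / real (Suc n)"] hat_step_nonneg[of s]
          by (auto intro!: mult_left_mono)
      qed (simp add: hat_step_outside)
    qed
  qed measurable
  then show ?thesis unfolding eq
    using has_bochner_integral_hat_step by (simp add: has_bochner_integral_iff)
qed

text \<open>The weak derivative is tested with C1 approximations of the indicator of
  \<open>{x<..y}\<close>. Their derivatives are differences of two mollifiers, concentrated just to
  the right of \<open>x\<close> and of \<open>y\<close>, so one side tends to
  \<open>q x - q y\<close>; the other tends to minus the integral of \<open>g\<close>.\<close>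

lemma weak_derivative_integral:
  fixes q :: "real \<Rightarrow> 'a::euclidean_space"
  assumes q: "continuous_on UNIV q" and g: "L2_loc g" and w: "has_weak_derivative q g" and "x \<le> y"
  shows "integral {x..y} g = q y - q x"
proof -
  \<comment> \<open>An upward ramp of width \<open>1 / (n + 1)\<close> starting at \<open>x\<close>,
    minus the same ramp starting at \<open>y\<close>. Its support lies in \<open>{x..y+1}\<close>
    for every \<open>n\<close>, which provides the common dominating function.\<close>
  define \<phi> where "\<phi> n t = smooth_step (real (Suc n) * (t - x)) - smooth_step (real (Suc n) * (t - y))" for n t
  define \<phi>' where "\<phi>' n t = real (Suc n) * hat_step (real (Suc n) * (t - x))
      - real (Suc n) * hat_step (real (Suc n) * (t - y))" for n t
  have D: "(\<phi> n has_real_derivative \<phi>' n t) (at t)" for n t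
    unfolding \<phi>_def \<phi>'_def
    by (rule derivative_eq_intros DERIV_chain2[OF DERIV_smooth_step] refl)+ (simp add: algebra_simps)
  then have vD: "vderiv (\<phi> n) = \<phi>' n" for n
    by (auto simp: has_real_derivative_iff_has_vector_derivative intro: vector_derivative_at)
  have cont': "continuous_on UNIV (\<phi>' n)" for n
    unfolding \<phi>'_def by (intro continuous_intros)
  have supp: "\<phi> n t = 0" if "t \<notin> {x..y+1}" for n t
  proof (cases "t < x")
    case True
    then show ?thesis using \<open>x \<le> y\<close> by (simp add: \<phi>_def smooth_step_le_0 mult_nonneg_nonpos)
  next
    case False
    with that \<open>x \<le> y\<close> have t: "1 \<le> t - x" "1 \<le> t - y" by auto
    have *: "1 \<le> real (Suc n) * u" if "1 \<le> u" for u using mult_mono[of 1 "real (Suc n)" 1 u] that by simp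
    show ?thesis using *[OF t(1)] *[OF t(2)] by (simp add: \<phi>_def smooth_step_ge_1)
  qed
  have test: "\<phi> n C1_differentiable_on UNIV \<and> compact (closure {t. \<phi> n t \<noteq> 0})" for n
  proof
    show "\<phi> n C1_differentiable_on UNIV"
      unfolding C1_differentiable_on_def using D cont'
      by (auto simp: has_real_derivative_iff_has_vector_derivative)
    have "{t. \<phi> n t \<noteq> 0} \<subseteq> {x..y+1}" using supp by blast
    then show "compact (closure {t. \<phi> n t \<noteq> 0})"
      by (meson bounded_closed_interval bounded_subset compact_closure)
  qed
  have eq: "(LINT t|lborel. \<phi>' n t *\<^sub>R q t) = - (LINT t|lborel. \<phi> n t *\<^sub>R g t)" for n
    using w test vD unfolding has_weak_derivative_def by metis
  have int1: "integrable lborel (\<lambda>t. (real (Suc n) * hat_step (real (Suc n) * (t - z))) *\<^sub>R q t)" for n z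
  proof -
    have "set_integrable lborel {z..z+1} (\<lambda>t. (real (Suc n) * hat_step (real (Suc n) * (t - z))) *\<^sub>R q t)"
      by (intro set_integrable_continuous_Icc continuous_intros continuous_on_subset[OF q]) auto
    moreover have "hat_step (real (Suc n) * (t - z)) = 0" if "t \<notin> {z..z+1}" for t
    proof (rule hat_step_outside)
      show "real (Suc n) * (t - z) \<notin> {0..1}"
      proof (cases "t < z")
        case True
        then have "real (Suc n) * (t - z) < 0" by (intro mult_pos_neg) auto
        then show ?thesis by simp
      next
        case False
        then have "1 < t - z" using that by auto
        moreover have "1 * (t - z) \<le> real (Suc n) * (t - z)" using False by (intro mult_right_mono) auto
        ultimately have "1 < real (Suc n) * (t - z)" by (metis less_le_trans mult_1)
        then show ?thesis by (metis atLeastAtMost_iff not_less)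
      qed
    qed
    then have "(\<lambda>t. indicator {z..z+1} t *\<^sub>R (real (Suc n) * hat_step (real (Suc n) * (t - z))) *\<^sub>R q t)
      = (\<lambda>t. (real (Suc n) * hat_step (real (Suc n) * (t - z))) *\<^sub>R q t)"
      by (force simp: indicator_def)
    ultimately show ?thesis by (simp add: set_integrable_def)
  qed
  have "(\<lambda>n. LINT t|lborel. \<phi>' n t *\<^sub>R q t) \<longlonglongrightarrow> q x - q y"
    unfolding \<phi>'_def scaleR_left_diff_distrib
    by (subst Bochner_Integration.integral_diff[OF int1 int1]) (intro tendsto_diff mollification_tendsto q)
  moreover have "(\<lambda>n. LINT t|lborel. \<phi> n t *\<^sub>R g t) \<longlonglongrightarrow> (LINT t|lborel. indicator {x<..y} t *\<^sub>R g t)"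
  proof (rule integral_dominated_convergence)
    have [measurable]: "g \<in> borel_measurable borel" using g by (simp add: L2_loc_def)
    have [measurable]: "\<phi> n \<in> borel_measurable borel" for n
      using D by (intro borel_measurable_continuous_onI) (meson DERIV_continuous continuous_at_imp_continuous_on)
    show "(\<lambda>t. indicator {x<..y} t *\<^sub>R g t) \<in> borel_measurable lborel"
      "(\<lambda>t. \<phi> n t *\<^sub>R g t) \<in> borel_measurable lborel" for n by measurable
    show "integrable lborel (\<lambda>t. norm (indicator {x..y+1} t *\<^sub>R g t))"
      using L2_loc_set_integrable[OF g, of x "y+1"] by (intro integrable_norm) (simp add: set_integrable_def)
    show "AE t in lborel. norm (\<phi> n t *\<^sub>R g t) \<le> norm (indicator {x..y + 1} t *\<^sub>R g t)" for n
    proof (rule AE_I2)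
      fix t
      have "\<bar>\<phi> n t\<bar> \<le> 1"
        using smooth_step_range[of "real (Suc n) * (t - x)"] smooth_step_range[of "real (Suc n) * (t - y)"]
        unfolding \<phi>_def by linarith
      then show "norm (\<phi> n t *\<^sub>R g t) \<le> norm (indicator {x..y + 1} t *\<^sub>R g t)"
        using supp[of t n] by (cases "t \<in> {x..y+1}") (auto simp: mult_left_le_one_le)
    qed
    have big: "\<forall>\<^sub>F n in sequentially. smooth_step (real (Suc n) * u) = 1" if "u > 0" for u
    proof -
      obtain N :: nat where N: "1 / u < real N" using reals_Archimedean2 by blast
      have "\<forall>\<^sub>F n in sequentially. n \<ge> N" by (rule eventually_ge_at_top)
      then show ?thesis
      proof eventually_elim
        case (elim n)
        then have "1 / u \<le> real (Suc n)" using N by linarith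
        then show ?case using that by (intro smooth_step_ge_1) (simp add: divide_simps)
      qed
    qed
    have small: "smooth_step (real (Suc n) * u) = 0" if "u \<le> 0" for u n
      using that by (intro smooth_step_le_0) (simp add: mult_nonneg_nonpos)
    show "AE t in lborel. (\<lambda>n. \<phi> n t *\<^sub>R g t) \<longlonglongrightarrow> indicator {x<..y} t *\<^sub>R g t"
    proof (intro AE_I2 tendsto_scaleR tendsto_const)
      fix t
      have s: "(\<lambda>n. smooth_step (real (Suc n) * (t - z))) \<longlonglongrightarrow> indicator {z<..} t" for z
        using big[of "t - z"] small[of "t - z"]
        by (cases "z < t") (auto simp: tendsto_eventually)
      \<comment> \<open>The step function is 0 at 0 and equals 1 far enough to the right, so the
        pointwise limit omits the left end point. Passing to the closed interval changes a null
        set.\<close>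
      have "indicator {x<..y} t = (indicator {x<..} t - indicator {y<..} t :: real)"
        using \<open>x \<le> y\<close> by (auto simp: indicator_def)
      then show "(\<lambda>n. \<phi> n t) \<longlonglongrightarrow> indicator {x<..y} t"
        unfolding \<phi>_def using tendsto_diff[OF s s] by simp
    qed
  qed
  ultimately have "q x - q y = - (LINT t|lborel. indicator {x<..y} t *\<^sub>R g t)"
    unfolding eq by (rule LIMSEQ_unique[OF _ tendsto_minus])
  also have "(LINT t|lborel. indicator {x<..y} t *\<^sub>R g t) = (LINT t:{x..y}|lborel. g t)"
    unfolding set_lebesgue_integral_def
  proof (rule integral_cong_AE)
    have [measurable]: "g \<in> borel_measurable borel" using g by (simp add: L2_loc_def)
    show "(\<lambda>t. indicator {x<..y} t *\<^sub>R g t) \<in> borel_measurable lborel"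
      "(\<lambda>t. indicator {x..y} t *\<^sub>R g t) \<in> borel_measurable lborel" by measurable
    show "AE t in lborel. indicator {x<..y} t *\<^sub>R g t = indicator {x..y} t *\<^sub>R g t"
      using AE_lborel_singleton[of x] by eventually_elim (auto simp: indicator_def)
  qed
  also have "\<dots> = integral {x..y} g"
    by (intro set_borel_integral_eq_integral L2_loc_set_integrable g)
  finally show ?thesis by (simp add: algebra_simps)
qed

text \<open>\<open>weak_derivative\<close> is an arbitrary choice. Two weak derivatives of a
  continuous curve have the same integral over every interval, namely the increment of the curve,
  hence they agree almost everywhere. So the action may be computed from whichever weak derivative
  is at hand.\<close>

lemma J_fun_eq:
  assumes q: "continuous_on UNIV q" and g: "L2_loc g" "has_weak_derivative q g"
  shows "J_fun V c q = (\<integral>\<^sup>+ t. ennreal ((norm (g t))\<^sup>2 / 2 + (V (q t) - c)) \<partial>lborel)"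
proof -
  have w: "L2_loc (weak_derivative q)" "has_weak_derivative q (weak_derivative q)"
    using someI[of "\<lambda>g. L2_loc g \<and> has_weak_derivative q g" g] g by (auto simp: weak_derivative_def)
  have "AE t in lborel. \<forall>n::nat. t \<in> {- real n..real n} \<longrightarrow> weak_derivative q t - g t = 0"
    unfolding AE_all_countable
  proof (intro allI AE_zero_if_interval_integrals_zero)
    fix n :: nat
    show "set_integrable lborel {- real n..real n} (\<lambda>t. weak_derivative q t - g t)"
      by (intro set_integral_diff L2_loc_set_integrable w g)
    fix x y :: real assume "x \<le> y"
    have "integral {x..y} (\<lambda>t. weak_derivative q t - g t) = integral {x..y} (weak_derivative q) - integral {x..y} g"
      by (intro integral_diff set_borel_integral_eq_integral(1) L2_loc_set_integrable w g)
    then show "integral {x..y} (\<lambda>t. weak_derivative q t - g t) = 0"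
      using weak_derivative_integral[OF q g \<open>x \<le> y\<close>] weak_derivative_integral[OF q w \<open>x \<le> y\<close>] by simp
  qed
  then have "AE t in lborel. weak_derivative q t = g t"
  proof (rule eventually_mono)
    fix t assume *: "\<forall>n::nat. t \<in> {- real n..real n} \<longrightarrow> weak_derivative q t - g t = 0"
    obtain n :: nat where "\<bar>t\<bar> \<le> real n" using real_arch_simple by blast
    then show "weak_derivative q t = g t" using *[rule_format, of n] by (simp add: abs_le_iff)
  qed
  then show ?thesis unfolding J_fun_def
    by (intro nn_integral_cong_AE) auto
qed

section \<open>Competitors: piecewise smooth curves and bounded perturbations of weak
  derivatives\<close>

lemma integrable_if_compact_support:
  assumes "set_integrable lborel {a..b} f" "\<And>t. t \<notin> {a..b} \<Longrightarrow> f t = 0"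
  shows "integrable lborel (f :: real \<Rightarrow> 'a::euclidean_space)" "integral\<^sup>L lborel f = integral {a..b} f"
proof -
  have eq: "f = (\<lambda>t. indicator {a..b} t *\<^sub>R f t)" using assms(2) by (auto simp: indicator_def)
  show "integrable lborel f" using assms(1) unfolding set_integrable_def eq[symmetric] .
  have "integral\<^sup>L lborel f = (LINT t:{a..b}|lborel. f t)"
    unfolding set_lebesgue_integral_def by (rule arg_cong[OF eq])
  then show "integral\<^sup>L lborel f = integral {a..b} f"
    by (rule trans[OF _ set_borel_integral_eq_integral(2)[OF assms(1)]])
qed

lemma compact_support_vderiv_zero:
  fixes \<phi> :: "real \<Rightarrow> real"
  assumes "t \<notin> closure {t. \<phi> t \<noteq> 0}"
  shows "\<phi> t = 0" "vderiv \<phi> t = 0"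
proof -
  have sub: "\<phi> s = 0" if "s \<notin> closure {t. \<phi> t \<noteq> 0}" for s
    using that closure_subset[of "{t. \<phi> t \<noteq> 0}"] by auto
  have "(\<phi> has_vector_derivative 0) (at t)"
  proof (rule has_vector_derivative_transform_within_open[where f="\<lambda>_. 0" and S="- closure {t. \<phi> t \<noteq> 0}"])
    show "t \<in> - closure {t. \<phi> t \<noteq> 0}" using assms by blast
    show "0 = \<phi> s" if "s \<in> - closure {t. \<phi> t \<noteq> 0}" for s
      by (rule sub[symmetric]) (use that in blast)
  qed auto
  then show "\<phi> t = 0" "vderiv \<phi> t = 0" using sub[OF assms] by (blast intro: vector_derivative_at)+
qed

lemma L2_loc_continuous:
  fixes q :: "real \<Rightarrow> 'a::euclidean_space"
  assumes "continuous_on UNIV q"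
  shows "L2_loc q"
  unfolding L2_loc_def
  by (intro conjI allI set_integrable_continuous_Icc continuous_intros continuous_on_subset[OF assms])
    (use assms in \<open>auto intro: borel_measurable_continuous_onI\<close>)

lemma set_integrable_continuous_scaleR_L2_loc:
  fixes g :: "real \<Rightarrow> 'a::euclidean_space"
  assumes c: "continuous_on UNIV \<phi>" and g: "L2_loc g"
  shows "set_integrable lborel {a..b} (\<lambda>t. \<phi> t *\<^sub>R g t)"
proof -
  have "bounded (\<phi> ` {a..b})"
    by (intro compact_imp_bounded compact_continuous_image continuous_on_subset[OF c]) auto
  then obtain B where B: "\<And>t. t \<in> {a..b} \<Longrightarrow> \<bar>\<phi> t\<bar> \<le> B"
    by (metis bounded_iff imageI real_norm_def)
  show ?thesis
  proof (rule set_integrable_bound)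
    show "set_integrable lborel {a..b} (\<lambda>t. B *\<^sub>R g t)"
      by (intro set_integrable_scaleR_right L2_loc_set_integrable g)
    have "\<phi> \<in> borel_measurable borel" "g \<in> borel_measurable borel"
      using c g by (auto simp: L2_loc_def intro: borel_measurable_continuous_onI)
    then show "set_borel_measurable lborel {a..b} (\<lambda>t. \<phi> t *\<^sub>R g t)"
      by (simp add: set_borel_measurable_def)
    show "AE t in lborel. t \<in> {a..b} \<longrightarrow> norm (\<phi> t *\<^sub>R g t) \<le> norm (B *\<^sub>R g t)"
      using B by (intro AE_I2) (force intro: mult_right_mono)
  qed
qed

text \<open>The interval \<open>{-M<..<M}\<close> is open on purpose: the test function vanishes at
  \<open>M\<close> and \<open>- M\<close> themselves, which removes the boundary terms when
  integrating by parts over \<open>{-M..M}\<close>.\<close>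

lemma test_function_cases:
  fixes \<phi> :: "real \<Rightarrow> real"
  assumes "\<phi> C1_differentiable_on UNIV" "compact (closure {t. \<phi> t \<noteq> 0})"
  obtains M where "M > 0" "\<And>t. t \<notin> {-M<..<M} \<Longrightarrow> \<phi> t = 0" "\<And>t. t \<notin> {-M<..<M} \<Longrightarrow> vderiv \<phi> t = 0"
    "continuous_on UNIV \<phi>" "continuous_on UNIV (vderiv \<phi>)"
    "\<And>t. (\<phi> has_vector_derivative vderiv \<phi> t) (at t)"
proof -
  let ?K = "closure {t. \<phi> t \<noteq> 0}"
  obtain M where M: "M > 0" "\<And>t. t \<in> ?K \<Longrightarrow> \<bar>t\<bar> < M"
    using compact_imp_bounded[of ?K] assms by (auto simp: bounded_pos_less)
  have "t \<notin> ?K" if "t \<notin> {-M<..<M}" for t using M(2)[of t] that by auto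
  from compact_support_vderiv_zero[OF this]
  have out: "t \<notin> {-M<..<M} \<Longrightarrow> \<phi> t = 0" "t \<notin> {-M<..<M} \<Longrightarrow> vderiv \<phi> t = 0" for t by blast+
  show ?thesis
    by (rule that[OF \<open>M > 0\<close> out])
      (use assms C1_differentiable_imp_continuous_on in \<open>auto simp: C1_differentiable_on_eq vector_derivative_works\<close>)
qed

text \<open>Integration by parts on an interval containing the support of the test function; the
  fundamental theorem of calculus tolerates the finite set \<open>S\<close> of corners. It serves
  both for hat-shaped variations and for paths frozen at their end points.\<close>

lemma has_weak_derivative_piecewise:
  fixes h :: "real \<Rightarrow> 'a::euclidean_space"
  assumes h: "continuous_on UNIV h" and S: "finite S" and g: "L2_loc g"
    and D: "\<And>t. t \<notin> S \<Longrightarrow> (h has_vector_derivative g t) (at t)"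
  shows "has_weak_derivative h g"
  unfolding has_weak_derivative_def
proof (intro allI impI, elim conjE)
  fix \<phi> :: "real \<Rightarrow> real"
  assume "\<phi> C1_differentiable_on UNIV" "compact (closure {t. \<phi> t \<noteq> 0})"
  then obtain M where M: "M > 0" "\<And>t. t \<notin> {-M<..<M} \<Longrightarrow> \<phi> t = 0" "\<And>t. t \<notin> {-M<..<M} \<Longrightarrow> vderiv \<phi> t = 0"
    and c: "continuous_on UNIV \<phi>" "continuous_on UNIV (vderiv \<phi>)"
    and d: "\<And>t. (\<phi> has_vector_derivative vderiv \<phi> t) (at t)" by (rule test_function_cases) metis
  have out: "\<phi> t = 0" "vderiv \<phi> t = 0" if "t \<notin> {-M..M}" for t
    using that by (auto intro!: M)
  have i1: "set_integrable lborel {-M..M} (\<lambda>t. vderiv \<phi> t *\<^sub>R h t)"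
    by (intro set_integrable_continuous_scaleR_L2_loc c L2_loc_continuous h)
  have i2: "set_integrable lborel {-M..M} (\<lambda>t. \<phi> t *\<^sub>R g t)"
    by (intro set_integrable_continuous_scaleR_L2_loc c g)
  have "((\<lambda>t. \<phi> t *\<^sub>R g t + vderiv \<phi> t *\<^sub>R h t) has_integral (\<phi> M *\<^sub>R h M - \<phi> (-M) *\<^sub>R h (-M))) {-M..M}"
    using \<open>M > 0\<close>
    by (intro fundamental_theorem_of_calculus_interior_strong[OF S] continuous_intros
        continuous_on_subset[OF h] continuous_on_subset[OF c(1)] has_vector_derivative_scaleR D)
      (use d in \<open>auto simp: has_real_derivative_iff_has_vector_derivative\<close>)
  then have "integral {-M..M} (\<lambda>t. \<phi> t *\<^sub>R g t + vderiv \<phi> t *\<^sub>R h t) = 0"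
    using M(2)[of M] M(2)[of "-M"] by (simp add: integral_unique)
  then have "integral {-M..M} (\<lambda>t. \<phi> t *\<^sub>R g t) + integral {-M..M} (\<lambda>t. vderiv \<phi> t *\<^sub>R h t) = 0"
    by (subst (asm) integral_add) (use i1 i2 set_borel_integral_eq_integral(1) in blast)+
  moreover have "(LINT t|lborel. vderiv \<phi> t *\<^sub>R h t) = integral {-M..M} (\<lambda>t. vderiv \<phi> t *\<^sub>R h t)"
    by (rule integrable_if_compact_support[OF i1]) (simp add: out)
  moreover have "(LINT t|lborel. \<phi> t *\<^sub>R g t) = integral {-M..M} (\<lambda>t. \<phi> t *\<^sub>R g t)"
    by (rule integrable_if_compact_support[OF i2]) (simp add: out)
  ultimately show "(LINT t|lborel. vderiv \<phi> t *\<^sub>R h t) = - (LINT t|lborel. \<phi> t *\<^sub>R g t)"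
    by (simp add: eq_neg_iff_add_eq_0 add.commute)
qed

text \<open>The Bochner integral of a non-integrable function is 0 by convention, so both integrals
  can be split only after each summand has been shown integrable on the support of the test
  function.\<close>

lemma has_weak_derivative_add:
  fixes p q :: "real \<Rightarrow> 'a::euclidean_space"
  assumes "continuous_on UNIV p" "L2_loc f" "has_weak_derivative p f"
    and "continuous_on UNIV q" "L2_loc g" "has_weak_derivative q g"
  shows "has_weak_derivative (\<lambda>t. p t + q t) (\<lambda>t. f t + g t)"
  unfolding has_weak_derivative_def
proof (intro allI impI)
  fix \<phi> :: "real \<Rightarrow> real"
  assume \<phi>: "\<phi> C1_differentiable_on UNIV \<and> compact (closure {t. \<phi> t \<noteq> 0})"
  then obtain M where M: "\<And>t. t \<notin> {-M<..<M} \<Longrightarrow> \<phi> t = 0" "\<And>t. t \<notin> {-M<..<M} \<Longrightarrow> vderiv \<phi> t = 0"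
    and c: "continuous_on UNIV \<phi>" "continuous_on UNIV (vderiv \<phi>)"
    using test_function_cases[of \<phi>] by metis
  have out: "\<phi> t = 0" "vderiv \<phi> t = 0" if "t \<notin> {-M..M}" for t
    using that by (auto intro!: M)
  have i1: "integrable lborel (\<lambda>t. vderiv \<phi> t *\<^sub>R h t)" if "continuous_on UNIV h" for h :: "real \<Rightarrow> 'a"
    by (rule integrable_if_compact_support[of "-M" M])
      (simp_all add: out that set_integrable_continuous_scaleR_L2_loc c L2_loc_continuous)
  have i2: "integrable lborel (\<lambda>t. \<phi> t *\<^sub>R h t)" if "L2_loc h" for h :: "real \<Rightarrow> 'a"
    by (rule integrable_if_compact_support[of "-M" M])
      (simp_all add: out that set_integrable_continuous_scaleR_L2_loc c)
  show "(LINT t|lborel. vderiv \<phi> t *\<^sub>R (p t + q t)) = - (LINT t|lborel. \<phi> t *\<^sub>R (f t + g t))"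
    unfolding scaleR_add_right
    using assms \<phi> by (simp add: i1 i2 has_weak_derivative_def)
qed

lemma L2_loc_add_bounded:
  fixes g h :: "real \<Rightarrow> 'a::euclidean_space"
  assumes g: "L2_loc g" and h: "h \<in> borel_measurable borel" "\<And>t. norm (h t) \<le> C"
  shows "L2_loc (\<lambda>t. g t + h t)"
  unfolding L2_loc_def
proof (intro conjI allI)
  have [measurable]: "g \<in> borel_measurable borel" "h \<in> borel_measurable borel"
    using g h by (auto simp: L2_loc_def)
  show "(\<lambda>t. g t + h t) \<in> borel_measurable lborel" by measurable
  fix a b
  show "set_integrable lborel {a..b} (\<lambda>t. (norm (g t + h t))\<^sup>2)"
  proof (rule set_integrable_bound)
    show "set_integrable lborel {a..b} (\<lambda>t. 2 * (norm (g t))\<^sup>2 + 2 * C\<^sup>2)"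
      using g by (intro set_integral_add(1) set_integrable_continuous_Icc[of a b "\<lambda>_. 2 * C\<^sup>2"]) (auto simp: L2_loc_def)
    show "set_borel_measurable lborel {a..b} (\<lambda>t. (norm (g t + h t))\<^sup>2)"
      unfolding set_borel_measurable_def by measurable
    have "(norm (g t + h t))\<^sup>2 \<le> 2 * (norm (g t))\<^sup>2 + 2 * C\<^sup>2" for t
    proof -
      have "(norm (g t + h t))\<^sup>2 \<le> (norm (g t) + C)\<^sup>2"
        using norm_triangle_ineq[of "g t" "h t"] h(2)[of t] by (intro power_mono) auto
      also have "\<dots> \<le> 2 * (norm (g t))\<^sup>2 + 2 * C\<^sup>2"
        using zero_le_power2[of "norm (g t) - C"] by (simp add: power2_eq_square algebra_simps)
      finally show ?thesis .
    qed
    then show "AE t in lborel. t \<in> {a..b} \<longrightarrow> norm ((norm (g t + h t))\<^sup>2) \<le> norm (2 * (norm (g t))\<^sup>2 + 2 * C\<^sup>2)"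
      by (intro AE_I2) simp
  qed
qed

lemma L2_loc_Icc:
  fixes w :: "real \<Rightarrow> 'a::euclidean_space"
  assumes "continuous_on {x..y} w"
  shows "L2_loc (\<lambda>t. indicator {x..y} t *\<^sub>R w t)"
proof -
  have m: "(\<lambda>t. indicator {x..y} t *\<^sub>R w t) \<in> borel_measurable borel"
    using borel_measurable_continuous_on_indicator[OF _ assms] by simp
  have "integrable lborel (\<lambda>t. (norm (indicator {x..y} t *\<^sub>R w t))\<^sup>2)"
  proof -
    have "set_integrable lborel {x..y} (\<lambda>t. (norm (w t))\<^sup>2)"
      by (intro set_integrable_continuous_Icc continuous_intros assms)
    moreover have "(\<lambda>t. (norm (indicator {x..y} t *\<^sub>R w t))\<^sup>2) = (\<lambda>t. indicator {x..y} t *\<^sub>R (norm (w t))\<^sup>2)"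
      by (auto simp: indicator_def)
    ultimately show ?thesis by (simp add: set_integrable_def)
  qed
  then have "set_integrable lborel {a..b} (\<lambda>t. (norm (indicator {x..y} t *\<^sub>R w t))\<^sup>2)" for a b
    unfolding set_integrable_def by (intro integrable_mult_indicator) auto
  with m show ?thesis by (simp add: L2_loc_def)
qed

lemma Liminf_eventually_const:
  "F \<noteq> bot \<Longrightarrow> \<forall>\<^sub>F t in F. f t = c \<Longrightarrow> Liminf F f = c"
  using Liminf_eq[of f "\<lambda>_. c" F] Liminf_const[of F c] by simp

lemma has_vector_derivative_continuous_on:
  "(\<And>t. t \<in> A \<Longrightarrow> (f has_vector_derivative f' t) (at t)) \<Longrightarrow> continuous_on A f"
  by (intro continuous_at_imp_continuous_on ballI) (rule has_vector_derivative_continuous)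

text \<open>Freezing the path at its end points makes it a competitor: they lie in \<open>Vm\<close>
  and \<open>Vp\<close>, so both liminf conditions hold trivially, and they lie exactly on the level
  \<open>c\<close>, so the two constant tails carry no action. This supplies the competitors for
  bounding the minimal action and for rescaling time.\<close>

lemma action_of_path:
  fixes f :: "real \<Rightarrow> 'a::euclidean_space"
  assumes V: "continuous_on UNIV V" and xy: "x < y"
    and f: "\<And>t. t \<in> {x..y} \<Longrightarrow> (f has_vector_derivative w t) (at t)" and w: "continuous_on {x..y} w"
    and ge: "\<And>t. t \<in> {x..y} \<Longrightarrow> c \<le> V (f t)"
    and ends: "f x \<in> Vm" "f y \<in> Vp" "V (f x) \<le> c" "V (f y) \<le> c"
  shows "m_val V Vm Vp c \<le> ennreal (integral {x..y} (\<lambda>t. (norm (w t))\<^sup>2 / 2 + (V (f t) - c)))"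
proof -
  define F where "F t = f (max x (min y t))" for t
  define g where "g t = indicator {x..y} t *\<^sub>R w t" for t
  have cf: "continuous_on {x..y} f"
    by (rule has_vector_derivative_continuous_on) (rule f)
  have cF: "continuous_on UNIV F"
    unfolding F_def by (rule continuous_on_compose2[OF cf]) (use xy in \<open>auto intro!: continuous_intros\<close>)
  have g: "L2_loc g" unfolding g_def by (rule L2_loc_Icc[OF w])
  have D: "(F has_vector_derivative g t) (at t)" if t: "t \<notin> {x,y}" for t
  proof -
    consider "t < x" | "x < t" "t < y" | "y < t" using t by force
    then show ?thesis
    proof cases
      case 1
      have "(F has_vector_derivative 0) (at t)"
        by (rule has_vector_derivative_transform_within_open[where f="\<lambda>_. f x" and S="{..<x}"])
          (use 1 xy in \<open>auto simp: F_def\<close>)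
      then show ?thesis using 1 by (simp add: g_def)
    next
      case 2
      have "(f has_vector_derivative g t) (at t)" using f[of t] 2 by (simp add: g_def)
      then show ?thesis
        by (rule has_vector_derivative_transform_within_open[where S="{x<..<y}"])
          (use 2 in \<open>auto simp: F_def\<close>)
    next
      case 3
      have "(F has_vector_derivative 0) (at t)"
        by (rule has_vector_derivative_transform_within_open[where f="\<lambda>_. f y" and S="{y<..}"])
          (use 3 xy in \<open>auto simp: F_def\<close>)
      then show ?thesis using 3 by (simp add: g_def)
    qed
  qed
  have wd: "has_weak_derivative F g"
    by (rule has_weak_derivative_piecewise[OF cF _ g D, of "{x,y}"]) auto
  have "F \<in> Gamma_set V Vm Vp c"
  proof -
    have "Liminf at_bot (\<lambda>t. ereal (infdist (F t) Vm)) = 0"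
    proof (rule Liminf_eventually_const)
      have "\<forall>\<^sub>F t in at_bot. t \<le> x" by (rule eventually_le_at_bot)
      then show "\<forall>\<^sub>F t in at_bot. ereal (infdist (F t) Vm) = 0"
        by eventually_elim (use ends xy in \<open>auto simp: F_def\<close>)
    qed auto
    moreover have "Liminf at_top (\<lambda>t. ereal (infdist (F t) Vp)) = 0"
    proof (rule Liminf_eventually_const)
      have "\<forall>\<^sub>F t in at_top. y \<le> t" by (rule eventually_ge_at_top)
      then show "\<forall>\<^sub>F t in at_top. ereal (infdist (F t) Vp) = 0"
        by eventually_elim (use ends xy in \<open>auto simp: F_def\<close>)
    qed auto
    ultimately show ?thesis
      using cF g wd ge xy by (auto simp: Gamma_set_def H1_loc_def F_def)
  qed
  then have "m_val V Vm Vp c \<le> J_fun V c F" unfolding m_val_def by (rule INF_lower)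
  also have "\<dots> = (\<integral>\<^sup>+ t. ennreal ((norm (g t))\<^sup>2 / 2 + (V (F t) - c)) \<partial>lborel)"
    by (rule J_fun_eq[OF cF g wd])
  also have "\<dots> = (\<integral>\<^sup>+ t\<in>{x..y}. ennreal ((norm (w t))\<^sup>2 / 2 + (V (f t) - c)) \<partial>lborel)"
  proof (intro nn_integral_cong)
    fix t
    have "V (f x) = c" "V (f y) = c" using ge[of x] ge[of y] ends xy by auto
    then show "ennreal ((norm (g t))\<^sup>2 / 2 + (V (F t) - c))
      = ennreal ((norm (w t))\<^sup>2 / 2 + (V (f t) - c)) * indicator {x..y} t"
      using xy by (auto simp: g_def F_def indicator_def max_def min_def)
  qed
  also have "\<dots> = ennreal (integral {x..y} (\<lambda>t. (norm (w t))\<^sup>2 / 2 + (V (f t) - c)))"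
  proof (rule nn_integral_has_integral_lebesgue')
    show "((\<lambda>t. (norm (w t))\<^sup>2 / 2 + (V (f t) - c)) has_integral
      integral {x..y} (\<lambda>t. (norm (w t))\<^sup>2 / 2 + (V (f t) - c))) {x..y}"
      by (intro integrable_integral integrable_continuous_interval continuous_intros w continuous_on_compose2[OF V cf]) auto
  qed (use ge in auto)
  finally show ?thesis .
qed

section \<open>The Euler-Lagrange equation\<close>

locale potential_well =
  fixes V :: "'a::euclidean_space \<Rightarrow> real" and gradV :: "'a \<Rightarrow> 'a" and r0 :: real
  assumes grad: "GDERIV V x :> gradV x"
    and cont_grad: "continuous_on UNIV gradV"
    and V_0: "V 0 = 0" and r0: "r0 > 0"
    and V_pos: "x \<in> cball 0 (4 * r0) - {0} \<Longrightarrow> V x > 0"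
    and bounded_C0: "bounded (C0_set V)"
    and grad_frontier: "x \<in> frontier (C0_set V) \<Longrightarrow> gradV x \<noteq> 0"
    and grad_locally_lipschitz: "\<exists>u>0. \<exists>L. L-lipschitz_on (cball x u) gradV"
begin

lemma V_has_derivative: "(V has_derivative (\<lambda>h. h \<bullet> gradV x)) (at x within S)"
  using grad[of x] by (auto simp: gderiv_def intro: has_derivative_at_withinI)

lemma continuous_V: "continuous_on S V"
  using V_has_derivative by (meson has_derivative_continuous_on)

lemma DERIV_V_compose:
  "(f has_vector_derivative f') (at t within S) \<Longrightarrow>
    ((\<lambda>t. V (f t)) has_real_derivative f' \<bullet> gradV (f t)) (at t within S)"
  unfolding has_vector_derivative_def has_field_derivative_def
  by (drule has_derivative_compose[OF _ V_has_derivative[where S=UNIV]]) (simp add: mult.commute[of _ "_ \<bullet> _"])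

lemma lipschitz_cball: "\<exists>L\<ge>0. \<forall>x\<in>cball 0 r. \<forall>y\<in>cball 0 r. norm (gradV x - gradV y) \<le> L * norm (x - y)"
proof -
  \<comment> \<open>\<open>local_lipschitz\<close> is formulated for fields depending on time; the
    one-point set is a dummy time domain. Compactness of the ball then gives a single
    constant.\<close>
  have "local_lipschitz {0::real} (cball 0 r) (\<lambda>_. gradV)"
  proof (rule local_lipschitzI)
    fix t :: real and x :: 'a
    obtain u L where "u > 0" "L-lipschitz_on (cball x u) gradV"
      using grad_locally_lipschitz[of x] by blast
    then show "\<exists>u>0. \<exists>L. \<forall>t\<in>cball t u \<inter> {0}. L-lipschitz_on (cball x u \<inter> cball 0 r) gradV"
      by (intro exI[of _ u] conjI exI[of _ L] ballI) (auto intro: lipschitz_on_subset)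
  qed
  from local_lipschitz_compact_implies_lipschitz[OF this]
  obtain L where "L-lipschitz_on (cball 0 r) gradV" by auto
  then show ?thesis
    by (intro exI[of _ L]) (auto simp: lipschitz_on_def dist_norm)
qed

text \<open>The mean value theorem along the segment, which stays in the ball by convexity. The
  quadratic remainder has a constant uniform on the ball, so the second-order part of a variation is
  controlled without second derivatives of \<open>V\<close>.\<close>

lemma V_upper_expansion:
  assumes L: "\<And>x y. x \<in> cball 0 r \<Longrightarrow> y \<in> cball 0 r \<Longrightarrow> norm (gradV x - gradV y) \<le> L * norm (x - y)"
    and x: "x \<in> cball 0 r" and y: "x + h \<in> cball 0 r" and L0: "L \<ge> 0"
  shows "V (x + h) \<le> V x + h \<bullet> gradV x + L * (norm h)\<^sup>2"
proof -
  have D: "((\<lambda>s. V (x + s *\<^sub>R h)) has_real_derivative (h \<bullet> gradV (x + s *\<^sub>R h))) (at s)" for s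
    by (intro DERIV_V_compose) (auto intro!: derivative_eq_intros)
  obtain s where s: "0 < s" "s < 1" "V (x + h) - V x = h \<bullet> gradV (x + s *\<^sub>R h)"
    using MVT2[of 0 1 "\<lambda>s. V (x + s *\<^sub>R h)" "\<lambda>s. h \<bullet> gradV (x + s *\<^sub>R h)"] D by auto
  have xs: "x + s *\<^sub>R h \<in> cball 0 r"
  proof -
    have "x + s *\<^sub>R h = (1 - s) *\<^sub>R x + s *\<^sub>R (x + h)" by (simp add: algebra_simps)
    then show ?thesis using convexD[OF convex_cball x y, of "1 - s" s] s by simp
  qed
  have "h \<bullet> gradV (x + s *\<^sub>R h) - h \<bullet> gradV x = h \<bullet> (gradV (x + s *\<^sub>R h) - gradV x)"
    by (simp add: inner_diff_right)
  also have "\<dots> \<le> norm h * norm (gradV (x + s *\<^sub>R h) - gradV x)"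
    by (rule norm_cauchy_schwarz)
  also have "\<dots> \<le> norm h * (L * norm (s *\<^sub>R h))"
    using L[OF xs x] by (intro mult_left_mono) auto
  also have "\<dots> = s * (L * (norm h)\<^sup>2)" using s by (simp add: power2_eq_square)
  also have "\<dots> \<le> 1 * (L * (norm h)\<^sup>2)" using s L0 by (intro mult_right_mono) auto
  finally show ?thesis using s(3) by simp
qed

text \<open>A curve with \<open>V (q t) \<ge> c > 0\<close> can never leave the ball of radius
  \<open>B\<close>. The clause \<open>r0 < B\<close> places the points beyond radius
  \<open>B\<close>, where \<open>V\<close> is not positive, in the outer part of the sublevel
  sets.\<close>

lemma level_set_bounded:
  obtains B where "B > 0" "\<And>x. V x > 0 \<Longrightarrow> norm x \<le> B" "r0 < B"
proof -
  obtain B where "B > 0" "\<And>x. V x > 0 \<Longrightarrow> norm x \<le> B"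
    using bounded_C0 by (auto simp: bounded_pos C0_set_def)
  then show ?thesis using r0 by (intro that[of "max B (r0 + 1)"]) force+
qed

text \<open>The variation is \<open>q + \<epsilon> \<phi> e\<close> with a scalar profile \<phi>
  supported in a compact interval on which \<open>V (q t) > c\<close>. By compactness the constraint
  has a margin there, so \<epsilon> of either sign is admissible. Minimality gives
  \<open>0 \<le> \<epsilon> * A + \<epsilon>\<^sup>2 * C\<close> near 0, and the linear coefficient
  \<open>A\<close> must vanish.\<close>

lemma first_variation:
  fixes q g :: "real \<Rightarrow> 'a"
  assumes qG: "q \<in> Gamma_set V Vm Vp c" and c: "c > 0"
    and min: "J_fun V c q = m_val V Vm Vp c" and fin: "J_fun V c q < \<infinity>"
    and g: "L2_loc g" "has_weak_derivative q g"
    and gt: "\<And>t. t \<in> {x..y} \<Longrightarrow> V (q t) > c" and xy: "x < y"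
    and \<phi>: "continuous_on UNIV \<phi>" "finite S" "\<And>t. t \<notin> S \<Longrightarrow> (\<phi> has_real_derivative \<psi> t) (at t)"
    and \<psi>: "\<psi> \<in> borel_measurable borel" "\<And>t. \<bar>\<psi> t\<bar> \<le> P" "\<And>t. \<bar>\<phi> t\<bar> \<le> P"
    and out: "\<And>t. t \<notin> {x..y} \<Longrightarrow> \<phi> t = 0" "\<And>t. t \<notin> {x..y} \<Longrightarrow> \<psi> t = 0"
  shows "integral {x..y} (\<lambda>t. \<psi> t * (e \<bullet> g t) + \<phi> t * (e \<bullet> gradV (q t))) = 0"
proof -
  have cq: "continuous_on UNIV q" and Vq: "\<And>t. V (q t) \<ge> c" using qG by (auto simp: Gamma_set_def H1_loc_def)
  have P0: "P \<ge> 0" using \<psi>(2)[of 0] by linarith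
  obtain B where B: "\<And>x. V x > 0 \<Longrightarrow> norm x \<le> B" by (rule level_set_bounded) blast
  have qB: "norm (q t) \<le> B" for t using B Vq[of t] c by (meson less_le_trans)
  obtain L where L: "L \<ge> 0" "\<And>x y. x \<in> cball 0 (B + 1) \<Longrightarrow> y \<in> cball 0 (B + 1) \<Longrightarrow>
      norm (gradV x - gradV y) \<le> L * norm (x - y)"
    using lipschitz_cball[of "B+1"] by blast
  have [measurable]: "g \<in> borel_measurable borel" "\<psi> \<in> borel_measurable borel" "q \<in> borel_measurable borel"
    "\<phi> \<in> borel_measurable borel" "gradV \<in> borel_measurable borel" "V \<in> borel_measurable borel"
    using g \<psi> cq \<phi> cont_grad continuous_V
    by (auto simp: L2_loc_def intro: borel_measurable_continuous_onI)
  define F where "F t = (norm (g t))\<^sup>2 / 2 + (V (q t) - c)" for t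
  define D1 where "D1 t = \<psi> t * (e \<bullet> g t) + \<phi> t * (e \<bullet> gradV (q t))" for t
  define D2 where "D2 t = (\<psi> t)\<^sup>2 * (norm e)\<^sup>2 / 2 + L * (\<phi> t)\<^sup>2 * (norm e)\<^sup>2" for t
  have F0: "F t \<ge> 0" for t using Vq[of t] by (simp add: F_def)
  have J: "J_fun V c q = (\<integral>\<^sup>+ t. ennreal (F t) \<partial>lborel)"
    unfolding F_def by (rule J_fun_eq[OF cq g])
  have [measurable]: "F \<in> borel_measurable borel" "D1 \<in> borel_measurable borel" "D2 \<in> borel_measurable borel"
    unfolding F_def D1_def D2_def by measurable
  \<comment> \<open>Finite action makes \<open>F\<close> integrable, so that it can be subtracted
    from both sides when the actions of \<open>q\<close> and of its variation are compared.\<close>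
  have iF: "integrable lborel F"
    by (rule integrableI_nonneg) (use F0 fin J in auto)
  have sD1: "set_integrable lborel {x..y} D1"
  proof -
    have 1: "set_integrable lborel {x..y} (\<lambda>t. \<psi> t * (e \<bullet> g t))"
    proof (rule set_integrable_bound)
      show "set_integrable lborel {x..y} (\<lambda>t. (P * norm e) *\<^sub>R g t)"
        by (intro set_integrable_scaleR_right L2_loc_set_integrable g)
      show "set_borel_measurable lborel {x..y} (\<lambda>t. \<psi> t * (e \<bullet> g t))"
        unfolding set_borel_measurable_def by measurable
      have "\<bar>\<psi> t * (e \<bullet> g t)\<bar> \<le> P * (norm e * norm (g t))" for t
        unfolding abs_mult by (intro mult_mono \<psi> Cauchy_Schwarz_ineq2) (use P0 in auto)
      then show "AE t in lborel. t \<in> {x..y} \<longrightarrow> norm (\<psi> t * (e \<bullet> g t)) \<le> norm ((P * norm e) *\<^sub>R g t)"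
        using P0 by (intro AE_I2) (simp add: mult.assoc)
    qed
    have "set_integrable lborel {x..y} (\<lambda>t. \<phi> t * (e \<bullet> gradV (q t)))"
      by (intro set_integrable_continuous_Icc continuous_intros continuous_on_subset[OF \<phi>(1)]
          continuous_on_compose2[OF cont_grad] continuous_on_subset[OF cq]) auto
    then show ?thesis unfolding D1_def by (intro set_integral_add 1)
  qed
  have iD1: "integrable lborel D1" "integral\<^sup>L lborel D1 = integral {x..y} D1"
    by (rule integrable_if_compact_support[OF sD1]; use out in \<open>simp add: D1_def\<close>)+
  have iD2: "integrable lborel D2"
  proof (rule integrable_if_compact_support(1))
    show "D2 t = 0" if "t \<notin> {x..y}" for t using out[OF that] by (simp add: D2_def)
    show "set_integrable lborel {x..y} D2"
    proof (rule set_integrable_bound)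
      show "set_integrable lborel {x..y} (\<lambda>t. P\<^sup>2 * (norm e)\<^sup>2 / 2 + L * P\<^sup>2 * (norm e)\<^sup>2)"
        by (intro set_integrable_continuous_Icc continuous_intros)
      show "set_borel_measurable lborel {x..y} D2" unfolding set_borel_measurable_def by measurable
      have "(\<psi> t)\<^sup>2 \<le> P\<^sup>2" "(\<phi> t)\<^sup>2 \<le> P\<^sup>2" for t using \<psi>(2)[of t] \<psi>(3)[of t] by (auto simp: abs_le_square_iff[symmetric])
      then have "D2 t \<le> P\<^sup>2 * (norm e)\<^sup>2 / 2 + L * P\<^sup>2 * (norm e)\<^sup>2" "0 \<le> D2 t" for t
        unfolding D2_def using L by (auto intro!: add_mono mult_mono divide_right_mono)
      then show "AE t in lborel. t \<in> {x..y} \<longrightarrow> norm (D2 t) \<le> norm (P\<^sup>2 * (norm e)\<^sup>2 / 2 + L * P\<^sup>2 * (norm e)\<^sup>2)"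
        by (intro AE_I2) (auto intro: order_trans[OF _ abs_ge_self])
    qed
  qed
  define A where "A = integral\<^sup>L lborel D1"
  define C where "C = integral\<^sup>L lborel D2"
  \<comment> \<open>\<open>\<epsilon>0\<close> keeps every perturbation shorter than
    \<open>min d 1\<close>. Below \<open>d\<close>, uniform continuity of \<open>V\<close> does not
    use up the margin \<open>\<eta>\<close> above \<open>c\<close>; below 1, the curve stays in the
    ball of radius \<open>B + 1\<close>, on which \<open>L\<close> is a Lipschitz constant.\<close>
  obtain \<epsilon>0 where \<epsilon>0: "\<epsilon>0 > 0" "\<And>\<epsilon> t. \<bar>\<epsilon>\<bar> < \<epsilon>0 \<Longrightarrow> c \<le> V (q t + \<epsilon> *\<^sub>R \<phi> t *\<^sub>R e)"
    "\<And>\<epsilon> t. \<bar>\<epsilon>\<bar> < \<epsilon>0 \<Longrightarrow> q t + \<epsilon> *\<^sub>R \<phi> t *\<^sub>R e \<in> cball 0 (B + 1)"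
  proof -
    have "\<exists>t\<in>{x..y}. \<forall>s\<in>{x..y}. V (q t) \<le> V (q s)"
      using xy by (intro continuous_attains_inf continuous_on_compose2[OF continuous_V] continuous_on_subset[OF cq]) auto
    then obtain \<eta> where \<eta>: "\<eta> > 0" "\<And>s. s \<in> {x..y} \<Longrightarrow> V (q s) \<ge> c + \<eta>"
      using gt by (metis add.commute diff_add_cancel diff_gt_0_iff_gt)
    have "uniformly_continuous_on (cball 0 (B + 1)) V"
      by (intro compact_uniformly_continuous continuous_V) auto
    then obtain d where d: "d > 0" "\<And>u v. u \<in> cball 0 (B+1) \<Longrightarrow> v \<in> cball 0 (B+1) \<Longrightarrow> dist v u < d \<Longrightarrow> dist (V v) (V u) < \<eta>"
      unfolding uniformly_continuous_on_def using \<eta>(1) by metis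
    define \<epsilon>0 where "\<epsilon>0 = min d 1 / (P * norm e + 1)"
    have den: "P * norm e + 1 > 0" using P0 by (auto intro: add_nonneg_pos)
    have small: "norm (\<epsilon> *\<^sub>R \<phi> t *\<^sub>R e) < min d 1" if "\<bar>\<epsilon>\<bar> < \<epsilon>0" for \<epsilon> t
    proof -
      have "norm (\<epsilon> *\<^sub>R \<phi> t *\<^sub>R e) = \<bar>\<epsilon>\<bar> * (\<bar>\<phi> t\<bar> * norm e)" by (simp add: abs_mult)
      also have "\<dots> \<le> \<bar>\<epsilon>\<bar> * (P * norm e + 1)"
        by (intro mult_left_mono order_trans[OF mult_right_mono[OF \<psi>(3)]]) auto
      also have "\<dots> < min d 1" using that den by (simp add: \<epsilon>0_def pos_less_divide_eq)
      finally show ?thesis .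
    qed
    have cb: "q t + \<epsilon> *\<^sub>R \<phi> t *\<^sub>R e \<in> cball 0 (B + 1)" if "\<bar>\<epsilon>\<bar> < \<epsilon>0" for \<epsilon> t
      using small[OF that, of t] qB[of t] norm_triangle_ineq[of "q t" "\<epsilon> *\<^sub>R \<phi> t *\<^sub>R e"] by simp
    have "c \<le> V (q t + \<epsilon> *\<^sub>R \<phi> t *\<^sub>R e)" if "\<bar>\<epsilon>\<bar> < \<epsilon>0" for \<epsilon> t
    proof (cases "t \<in> {x..y}")
      case True
      have "q t \<in> cball 0 (B+1)" using qB[of t] by simp
      then have "dist (V (q t + \<epsilon> *\<^sub>R \<phi> t *\<^sub>R e)) (V (q t)) < \<eta>"
        using small[OF that, of t] by (intro d(2) cb that) (auto simp: dist_norm)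
      then show ?thesis using \<eta>(2)[OF True] by (simp add: dist_real_def)
    qed (use out Vq in auto)
    then show ?thesis using cb den d(1) by (intro that[of \<epsilon>0]) (auto simp: \<epsilon>0_def)
  qed
  have ineq: "0 \<le> \<epsilon> * A + \<epsilon>\<^sup>2 * C" if \<epsilon>: "\<bar>\<epsilon>\<bar> < \<epsilon>0" for \<epsilon>
  proof -
    define p where "p t = q t + \<epsilon> *\<^sub>R \<phi> t *\<^sub>R e" for t
    define h where "h t = g t + \<epsilon> *\<^sub>R \<psi> t *\<^sub>R e" for t
    have cp: "continuous_on UNIV p" unfolding p_def by (intro continuous_intros cq \<phi>)
    have bnd: "norm (\<epsilon> *\<^sub>R \<psi> t *\<^sub>R e) \<le> \<bar>\<epsilon>\<bar> * (P * norm e)" for t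
      using \<psi>(2)[of t] by (auto simp: abs_mult mult.assoc intro!: mult_left_mono mult_right_mono)
    have L2: "L2_loc (\<lambda>t. \<epsilon> *\<^sub>R \<psi> t *\<^sub>R e)"
      using L2_loc_add_bounded[of "\<lambda>_. 0" "\<lambda>t. \<epsilon> *\<^sub>R \<psi> t *\<^sub>R e" "\<bar>\<epsilon>\<bar> * (P * norm e)"] bnd
        L2_loc_continuous[of "\<lambda>_. 0::'a"] by simp
    have wd: "has_weak_derivative p h"
      unfolding p_def h_def
    proof (intro has_weak_derivative_add cq g L2 has_weak_derivative_piecewise[OF _ \<phi>(2)])
      show "((\<lambda>t. \<epsilon> *\<^sub>R \<phi> t *\<^sub>R e) has_vector_derivative \<epsilon> *\<^sub>R \<psi> t *\<^sub>R e) (at t)" if "t \<notin> S" for t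
        using \<phi>(3)[OF that] by (auto intro!: derivative_eq_intros simp: has_real_derivative_iff_has_vector_derivative)
    qed (intro continuous_intros \<phi>)+
    have h: "L2_loc h" unfolding h_def by (rule L2_loc_add_bounded[OF g(1) _ bnd]) measurable
    have p_in: "p \<in> Gamma_set V Vm Vp c"
    proof -
      have "\<forall>\<^sub>F t in at_bot. p t = q t"
        by (rule eventually_mono[OF eventually_gt_at_bot[of x]]) (simp add: p_def out)
      moreover have "\<forall>\<^sub>F t in at_top. p t = q t"
        by (rule eventually_mono[OF eventually_gt_at_top[of y]]) (simp add: p_def out)
      ultimately have "Liminf at_bot (\<lambda>t. ereal (infdist (p t) Vm)) = Liminf at_bot (\<lambda>t. ereal (infdist (q t) Vm))"
        "Liminf at_top (\<lambda>t. ereal (infdist (p t) Vp)) = Liminf at_top (\<lambda>t. ereal (infdist (q t) Vp))"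
        by (auto intro!: Liminf_eq elim!: eventually_mono)
      then show ?thesis
        using qG cp h wd \<epsilon>0(2)[OF \<epsilon>] by (auto simp: Gamma_set_def H1_loc_def p_def)
    qed
    have upper: "(norm (h t))\<^sup>2 / 2 + (V (p t) - c) \<le> F t + \<epsilon> * D1 t + \<epsilon>\<^sup>2 * D2 t" for t
    proof -
      have "(norm (h t))\<^sup>2 = (norm (g t))\<^sup>2 + 2 * \<epsilon> * \<psi> t * (e \<bullet> g t) + \<epsilon>\<^sup>2 * (\<psi> t)\<^sup>2 * (norm e)\<^sup>2"
        unfolding h_def power2_norm_eq_inner
        by (simp add: inner_add_left inner_add_right inner_commute[of "g t" e] power2_eq_square algebra_simps)
      moreover have "V (p t) \<le> V (q t) + (\<epsilon> *\<^sub>R \<phi> t *\<^sub>R e) \<bullet> gradV (q t) + L * (norm (\<epsilon> *\<^sub>R \<phi> t *\<^sub>R e))\<^sup>2"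
        unfolding p_def using qB[of t] by (intro V_upper_expansion[where r="B+1"] L \<epsilon>0 \<epsilon>) auto
      moreover have "L * (norm (\<epsilon> *\<^sub>R \<phi> t *\<^sub>R e))\<^sup>2 = \<epsilon>\<^sup>2 * (L * (\<phi> t)\<^sup>2 * (norm e)\<^sup>2)"
        by (simp add: power_mult_distrib)
      ultimately show ?thesis by (simp add: F_def D1_def D2_def algebra_simps add_divide_distrib)
    qed
    have "m_val V Vm Vp c \<le> J_fun V c p" using p_in unfolding m_val_def by (rule INF_lower)
    also have "\<dots> = (\<integral>\<^sup>+ t. ennreal ((norm (h t))\<^sup>2 / 2 + (V (p t) - c)) \<partial>lborel)"
      by (rule J_fun_eq[OF cp h wd])
    also have "\<dots> \<le> (\<integral>\<^sup>+ t. ennreal (F t + \<epsilon> * D1 t + \<epsilon>\<^sup>2 * D2 t) \<partial>lborel)"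
    by (intro nn_integral_mono ennreal_leI upper)
    finally have le: "(\<integral>\<^sup>+ t. ennreal (F t) \<partial>lborel) \<le> (\<integral>\<^sup>+ t. ennreal (F t + \<epsilon> * D1 t + \<epsilon>\<^sup>2 * D2 t) \<partial>lborel)"
      using min J by simp
    have nn: "0 \<le> F t + \<epsilon> * D1 t + \<epsilon>\<^sup>2 * D2 t" for t
      using \<epsilon>0(2)[OF \<epsilon>, of t] by (intro order_trans[OF _ upper]) (simp add: p_def)
    have i: "integrable lborel (\<lambda>t. F t + \<epsilon> * D1 t + \<epsilon>\<^sup>2 * D2 t)"
      by (intro Bochner_Integration.integrable_add integrable_mult_right iF iD1 iD2)
    have "ennreal (integral\<^sup>L lborel F) \<le> ennreal (integral\<^sup>L lborel (\<lambda>t. F t + \<epsilon> * D1 t + \<epsilon>\<^sup>2 * D2 t))"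
      using le nn_integral_eq_integral[OF iF] nn_integral_eq_integral[OF i] F0 nn by simp
    then have "integral\<^sup>L lborel F \<le> integral\<^sup>L lborel (\<lambda>t. F t + \<epsilon> * D1 t + \<epsilon>\<^sup>2 * D2 t)"
      using nn by (simp add: ennreal_le_iff Bochner_Integration.integral_nonneg)
    also have "\<dots> = integral\<^sup>L lborel F + \<epsilon> * A + \<epsilon>\<^sup>2 * C"
      unfolding A_def C_def using iF iD1 iD2 by simp
    finally show ?thesis by simp
  qed
  have "A = 0"
  proof (rule ccontr)
    assume "A \<noteq> 0"
    \<comment> \<open>The test value is \<open>\<epsilon> = - \<eta> * A\<close>, for which the
      inequality reads \<open>0 \<le> (\<eta> * A\<^sup>2) * (\<eta> * C - 1)\<close>. The first
      entry of the minimum makes it admissible, the second forces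
      \<open>\<eta> * C \<le> 1/2\<close>.\<close>
    define \<eta> where "\<eta> = min (\<epsilon>0 / (2 * \<bar>A\<bar>)) (1 / (2 * (\<bar>C\<bar> + 1)))"
    have \<eta>: "\<eta> > 0" using \<epsilon>0 \<open>A \<noteq> 0\<close> by (auto simp: \<eta>_def intro!: divide_pos_pos)
    have "\<eta> * \<bar>A\<bar> \<le> \<epsilon>0 / (2 * \<bar>A\<bar>) * \<bar>A\<bar>"
      unfolding \<eta>_def by (intro mult_right_mono) auto
    also have "\<dots> = \<epsilon>0 / 2" using \<open>A \<noteq> 0\<close> by simp
    finally have "\<eta> * \<bar>A\<bar> \<le> \<epsilon>0 / 2" .
    then have "\<bar>- \<eta> * A\<bar> < \<epsilon>0" using \<epsilon>0(1) \<eta> by (simp add: abs_mult)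
    from ineq[OF this] have "0 \<le> (\<eta> * A\<^sup>2) * (\<eta> * C - 1)" by (simp add: power2_eq_square algebra_simps)
    moreover have "\<eta> * A\<^sup>2 > 0" using \<eta> \<open>A \<noteq> 0\<close> by simp
    ultimately have "1 \<le> \<eta> * C" by (simp add: zero_le_mult_iff)
    also have "\<dots> \<le> \<eta> * (\<bar>C\<bar> + 1)" using \<eta> by (intro mult_left_mono) auto
    also have "\<dots> \<le> 1 / (2 * (\<bar>C\<bar> + 1)) * (\<bar>C\<bar> + 1)" unfolding \<eta>_def by (intro mult_right_mono) auto
    also have "\<dots> = 1/2" by (simp add: field_simps)
    finally show False by simp
  qed
  moreover have "D1 = (\<lambda>t. \<psi> t * (e \<bullet> g t) + \<phi> t * (e \<bullet> gradV (q t)))" by (simp add: fun_eq_iff D1_def)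
  ultimately show ?thesis using iD1(2) by (simp add: A_def)
qed

text \<open>Du Bois-Reymond's lemma in discrete form. \<open>G\<close> is a second primitive of the
  force along \<open>q\<close>, so a weak solution should differ from it by an affine function.
  Comparing the two chords of \<open>q - G\<close> that meet at \<open>z\<close> expresses this with
  piecewise linear test functions alone and without derivatives of \<open>q\<close>.\<close>

lemma minimizer_slopes:
  fixes q :: "real \<Rightarrow> 'a"
  assumes qG: "q \<in> Gamma_set V Vm Vp c" and c: "c > 0"
    and min: "J_fun V c q = m_val V Vm Vp c" and fin: "J_fun V c q < \<infinity>"
    and gt: "\<And>t. t \<in> {x..y} \<Longrightarrow> V (q t) > c" and xz: "x < z" and zy: "z < y"
    and G: "\<And>t. (G has_vector_derivative w t) (at t)" and w: "\<And>t. (w has_vector_derivative gradV (q t)) (at t)"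
  shows "(1 / (z - x)) *\<^sub>R ((q z - G z) - (q x - G x)) = (1 / (y - z)) *\<^sub>R ((q y - G y) - (q z - G z))"
proof -
  have cq: "continuous_on UNIV q" using qG by (auto simp: Gamma_set_def H1_loc_def)
  obtain g where g: "L2_loc g" "has_weak_derivative q g" using qG by (auto simp: Gamma_set_def H1_loc_def)
  \<comment> \<open>The tent with feet \<open>x\<close> and \<open>y\<close> and height 1 at
    \<open>z\<close>; \<open>\<psi>\<close> is its slope, set to 0 at the three corners.\<close>
  define \<phi> where "\<phi> t = max 0 (min ((t - x) / (z - x)) ((y - t) / (y - z)))" for t
  define \<psi> where "\<psi> t = (1 / (z - x)) * indicator {x<..<z} t - (1 / (y - z)) * indicator {z<..<y} t" for t
  have \<phi>l: "\<phi> t = (t - x) / (z - x)" if "t \<in> {x..z}" for t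
  proof -
    have "(t - x) / (z - x) \<le> 1" "1 \<le> (y - t) / (y - z)" "0 \<le> (t - x) / (z - x)"
      using that xz zy by (auto simp: divide_simps)
    then show ?thesis by (simp add: \<phi>_def)
  qed
  have \<phi>r: "\<phi> t = (y - t) / (y - z)" if "t \<in> {z..y}" for t
  proof -
    have "1 \<le> (t - x) / (z - x)" "(y - t) / (y - z) \<le> 1" "0 \<le> (y - t) / (y - z)"
      using that xz zy by (auto simp: divide_simps)
    then show ?thesis by (simp add: \<phi>_def)
  qed
  have \<phi>o: "\<phi> t = 0" if "t \<notin> {x<..<y}" for t
  proof -
    have "(t - x) / (z - x) \<le> 0 \<or> (y - t) / (y - z) \<le> 0"
      using that xz zy by (auto simp: divide_simps)
    then show ?thesis by (auto simp: \<phi>_def)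
  qed
  have c\<phi>: "continuous_on UNIV \<phi>" unfolding \<phi>_def using xz zy by (intro continuous_intros) auto
  have D\<phi>: "(\<phi> has_real_derivative \<psi> t) (at t)" if t: "t \<notin> {x,z,y}" for t
  proof -
    consider "t < x \<or> y < t" | "x < t" "t < z" | "z < t" "t < y" using t by force
    then show ?thesis
    proof cases
      case 1
      have "((\<lambda>_. 0) has_real_derivative \<psi> t) (at t)" using 1 xz zy by (auto simp: \<psi>_def)
      then show ?thesis
        by (rule has_field_derivative_transform_within_open[where S="- {x..y}"]) (use 1 in \<open>auto simp: \<phi>o\<close>)
    next
      case 2
      have "((\<lambda>t. (t - x) / (z - x)) has_real_derivative \<psi> t) (at t)"
        using 2 xz zy by (auto simp: \<psi>_def intro!: derivative_eq_intros)
      then show ?thesis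
        by (rule has_field_derivative_transform_within_open[where S="{x<..<z}"]) (use 2 in \<open>auto simp: \<phi>l\<close>)
    next
      case 3
      have "((\<lambda>t. (y - t) / (y - z)) has_real_derivative \<psi> t) (at t)"
        using 3 xz zy by (auto simp: \<psi>_def divide_simps intro!: derivative_eq_intros)
      then show ?thesis
        by (rule has_field_derivative_transform_within_open[where S="{z<..<y}"]) (use 3 in \<open>auto simp: \<phi>r\<close>)
    qed
  qed
  define P where "P = 1 + 1 / (z - x) + 1 / (y - z)"
  have \<psi>P: "\<bar>\<psi> t\<bar> \<le> P" for t
    using xz zy by (auto simp: \<psi>_def P_def indicator_def)
  have \<phi>P: "\<bar>\<phi> t\<bar> \<le> P" for t
  proof -
    have "(t - x) / (z - x) \<le> 1 \<or> (y - t) / (y - z) \<le> 1"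
      using xz zy by (auto simp: divide_simps)
    then have "\<bar>\<phi> t\<bar> \<le> 1" by (auto simp: \<phi>_def)
    moreover have "1 \<le> P" using xz zy by (simp add: P_def)
    ultimately show ?thesis by linarith
  qed
  have spike: "integral {x..y} (\<lambda>t. \<psi> t *\<^sub>R u t) = (1 / (z - x)) *\<^sub>R (h z - h x) - (1 / (y - z)) *\<^sub>R (h y - h z)"
    "(\<lambda>t. \<psi> t *\<^sub>R u t) integrable_on {x..y}"
    if u: "(u has_integral h z - h x) {x..z}" "(u has_integral h y - h z) {z..y}" for u h :: "real \<Rightarrow> real"
  proof -
    have 1: "((\<lambda>t. \<psi> t *\<^sub>R u t) has_integral (1 / (z - x)) *\<^sub>R (h z - h x)) {x..z}"
      by (rule has_integral_spike_finite[OF _ _ has_integral_cmul[OF u(1)], of "{x,z}"])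
        (use zy in \<open>auto simp: \<psi>_def\<close>)
    have 2: "((\<lambda>t. \<psi> t *\<^sub>R u t) has_integral (- 1 / (y - z)) *\<^sub>R (h y - h z)) {z..y}"
      by (rule has_integral_spike_finite[OF _ _ has_integral_cmul[OF u(2)], of "{z,y}"])
        (use xz in \<open>auto simp: \<psi>_def\<close>)
    show "integral {x..y} (\<lambda>t. \<psi> t *\<^sub>R u t) = (1 / (z - x)) *\<^sub>R (h z - h x) - (1 / (y - z)) *\<^sub>R (h y - h z)"
      "(\<lambda>t. \<psi> t *\<^sub>R u t) integrable_on {x..y}"
      using has_integral_combine[OF _ _ 1 2] xz zy by (auto simp: integral_unique)
  qed
  txt \<open>Testing with the hat function \<^term>\<open>\<phi>\<close> and integrating \<open>\<phi> (e \<bullet> gradV q)\<close> by parts, only the slopes of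
    \<open>q - G\<close> on the two legs of the hat survive.\<close>
  have main: "(1 / (z - x)) * (e \<bullet> ((q z - G z) - (q x - G x))) = (1 / (y - z)) * (e \<bullet> ((q y - G y) - (q z - G z)))" for e
  proof -
    have var: "integral {x..y} (\<lambda>t. \<psi> t * (e \<bullet> g t) + \<phi> t * (e \<bullet> gradV (q t))) = 0"
    proof (rule first_variation[OF qG c min fin g gt _ c\<phi> _ D\<phi> _ \<psi>P \<phi>P, of x y "{x,z,y}"])
      show "\<psi> \<in> borel_measurable borel" unfolding \<psi>_def[abs_def] by measurable
      show "\<phi> t = 0" if "t \<notin> {x..y}" for t by (rule \<phi>o) (use that in auto)
      show "\<psi> t = 0" if "t \<notin> {x..y}" for t using that xz zy by (auto simp: \<psi>_def)
    qed (use xz zy in auto)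
    have gq: "((\<lambda>t. e \<bullet> g t) has_integral e \<bullet> q b - e \<bullet> q a) {a..b}" if "a \<le> b" for a b
    proof -
      have "(g has_integral (q b - q a)) {a..b}"
        using integrable_integral[OF set_borel_integral_eq_integral(1)[OF L2_loc_set_integrable[OF g(1), of a b]]]
        unfolding weak_derivative_integral[OF cq g that] .
      from has_integral_linear[OF this bounded_linear_inner_right[of e]] show ?thesis
        by (simp add: o_def inner_diff_right)
    qed
    have wG: "((\<lambda>t. e \<bullet> w t) has_integral e \<bullet> G b - e \<bullet> G a) {a..b}" if "a \<le> b" for a b
    proof -
      have "(w has_integral (G b - G a)) {a..b}"
        by (rule fundamental_theorem_of_calculus[OF that]) (use G in \<open>auto intro: has_vector_derivative_at_within\<close>)
      from has_integral_linear[OF this bounded_linear_inner_right[of e]] show ?thesis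
        by (simp add: o_def inner_diff_right)
    qed
    have ibp: "((\<lambda>t. \<phi> t * (e \<bullet> gradV (q t)) + \<psi> t * (e \<bullet> w t)) has_integral (\<phi> y * (e \<bullet> w y) - \<phi> x * (e \<bullet> w x))) {x..y}"
    proof (rule fundamental_theorem_of_calculus_interior_strong[of "{x,z,y}"])
      have w': "((\<lambda>t. e \<bullet> w t) has_real_derivative e \<bullet> gradV (q t)) (at t)" for t
        using w[of t] unfolding has_real_derivative_iff_has_vector_derivative has_vector_derivative_def
        by (auto intro!: derivative_eq_intros)
      show "((\<lambda>t. \<phi> t * (e \<bullet> w t)) has_vector_derivative \<phi> t * (e \<bullet> gradV (q t)) + \<psi> t * (e \<bullet> w t)) (at t)"
        if "t \<in> {x<..<y} - {x,z,y}" for t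
        using DERIV_mult[OF D\<phi>[of t] w'[of t]] that
        by (simp add: has_real_derivative_iff_has_vector_derivative[symmetric] algebra_simps)
      have "continuous_on {x..y} w"
        by (rule has_vector_derivative_continuous_on) (rule w)
      then show "continuous_on {x..y} (\<lambda>t. \<phi> t * (e \<bullet> w t))"
        by (intro continuous_intros continuous_on_subset[OF c\<phi>]) simp_all
    qed (use xz zy in auto)
    note s1 = spike[OF gq[of x z] gq[of z y]] and s2 = spike[OF wG[of x z] wG[of z y]]
    have i\<phi>: "(\<lambda>t. \<phi> t * (e \<bullet> gradV (q t))) integrable_on {x..y}"
      by (intro integrable_continuous_interval continuous_intros continuous_on_subset[OF c\<phi>]
          continuous_on_compose2[OF cont_grad] continuous_on_subset[OF cq]) auto
    have "integral {x..y} (\<lambda>t. \<psi> t * (e \<bullet> g t)) + integral {x..y} (\<lambda>t. \<phi> t * (e \<bullet> gradV (q t))) = 0"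
      using var s1(2) xz zy i\<phi> by (subst (asm) integral_add) auto
    moreover have "integral {x..y} (\<lambda>t. \<phi> t * (e \<bullet> gradV (q t))) + integral {x..y} (\<lambda>t. \<psi> t * (e \<bullet> w t)) = 0"
      using integral_unique[OF ibp] s2(2) xz zy i\<phi> \<phi>o[of x] \<phi>o[of y] by (subst (asm) integral_add) auto
    ultimately have "integral {x..y} (\<lambda>t. \<psi> t * (e \<bullet> g t)) = integral {x..y} (\<lambda>t. \<psi> t * (e \<bullet> w t))"
      by simp
    then show ?thesis using s1(1) s2(1) xz zy by (simp add: inner_diff_right algebra_simps)
  qed
  show ?thesis
    by (rule vector_eq_rdot[THEN iffD1]) (use main in \<open>simp add: inner_commute\<close>)
qed

end

lemma affine_if_slopes_equal:
  fixes h :: "real \<Rightarrow> 'a::real_vector"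
  assumes I: "x0 \<in> I" "y0 \<in> I" "x0 < y0"
    and slopes: "\<And>x z y. x \<in> I \<Longrightarrow> z \<in> I \<Longrightarrow> y \<in> I \<Longrightarrow> x < z \<Longrightarrow> z < y \<Longrightarrow>
      (1 / (z - x)) *\<^sub>R (h z - h x) = (1 / (y - z)) *\<^sub>R (h y - h z)"
  obtains A B where "\<And>t. t \<in> I \<Longrightarrow> h t = A + t *\<^sub>R B"
proof -
  define B where "B = (1 / (y0 - x0)) *\<^sub>R (h y0 - h x0)"
  have hy: "h y0 = h x0 + (y0 - x0) *\<^sub>R B" using I by (simp add: B_def)
  have "h t = h x0 + (t - x0) *\<^sub>R B" if t: "t \<in> I" for t
  proof -
    consider "t < x0" | "t = x0" | "x0 < t" "t < y0" | "t = y0" | "y0 < t" by linarith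
    then show ?thesis
    proof cases
      case 1
      have "(1 / (x0 - t)) *\<^sub>R (h x0 - h t) = B" using slopes[OF t I(1,2) 1 I(3)] by (simp add: B_def)
      then have "h x0 - h t = (x0 - t) *\<^sub>R B" using 1 by auto
      then show ?thesis by (simp add: algebra_simps)
    next
      case 3
      \<comment> \<open>Both subchords have the slope \<open>s\<close>; adding their increments
        shows that \<open>s\<close> is also the slope \<open>B\<close> of the whole chord.\<close>
      define s where "s = (1 / (t - x0)) *\<^sub>R (h t - h x0)"
      have s: "s = (1 / (y0 - t)) *\<^sub>R (h y0 - h t)" using slopes[OF I(1) t I(2) 3] by (simp add: s_def)
      have 1: "h t - h x0 = (t - x0) *\<^sub>R s" using 3 by (simp add: s_def)
      have 2: "h y0 - h t = (y0 - t) *\<^sub>R s" using 3 unfolding s by simp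
      have "(y0 - x0) *\<^sub>R B = h y0 - h x0" using hy by simp
      also have "\<dots> = (h y0 - h t) + (h t - h x0)" by simp
      also have "\<dots> = (y0 - x0) *\<^sub>R s" unfolding 1 2 by (simp add: algebra_simps)
      finally have "B = s" using I by simp
      then show ?thesis using 1 by (simp add: algebra_simps)
    next
      case 5
      have "(1 / (t - y0)) *\<^sub>R (h t - h y0) = B" using slopes[OF I(1,2) t I(3) 5] by (simp add: B_def)
      then have "h t - h y0 = (t - y0) *\<^sub>R B" using 5 by auto
      then show ?thesis using hy by (simp add: algebra_simps)
    qed (use hy in auto)
  qed
  then show ?thesis by (intro that[of "h x0 - x0 *\<^sub>R B" B]) (simp add: algebra_simps)
qed

lemma antiderivative_UNIV:
  fixes f :: "real \<Rightarrow> 'a::euclidean_space"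
  assumes "continuous_on UNIV f"
  obtains F where "\<And>t. (F has_vector_derivative f t) (at t)"
  using einterval_antiderivative[of "-\<infinity>" \<infinity> f] assms by (auto simp: continuous_on_eq_continuous_at)

section \<open>Regularity, energy and action bounds for minimizers on free intervals\<close>

context potential_well
begin

text \<open>A second primitive \<open>H\<close> of the force differs from \<open>q\<close> by an
  affine function on \<open>I\<close>; adding that function to \<open>H\<close> gives
  \<open>G\<close>, and continuity carries \<open>q = G\<close> to the end points. The last clause
  turns the action of a rough curve into a bound for a classical integral, since \<open>v\<close>
  agrees there almost everywhere with any weak derivative of \<open>q\<close>.\<close>

lemma minimizer_regularity:
  fixes q :: "real \<Rightarrow> 'a"
  assumes qG: "q \<in> Gamma_set V Vm Vp c" and c: "c > 0"
    and min: "J_fun V c q = m_val V Vm Vp c" and fin: "J_fun V c q < \<infinity>"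
    and I: "open I" "is_interval I" "I \<noteq> {}" and gt: "\<And>t. t \<in> I \<Longrightarrow> V (q t) > c"
  obtains G v where "\<And>t. (G has_vector_derivative v t) (at t)"
    "\<And>t. (v has_vector_derivative gradV (q t)) (at t)" "\<And>t. t \<in> closure I \<Longrightarrow> q t = G t"
    "\<And>x y. x \<le> y \<Longrightarrow> {x..y} \<subseteq> closure I \<Longrightarrow>
      ennreal (integral {x..y} (\<lambda>t. (norm (v t))\<^sup>2 / 2 + (V (q t) - c))) \<le> J_fun V c q"
proof -
  have cq: "continuous_on UNIV q" and Vq: "\<And>t. V (q t) \<ge> c" using qG by (auto simp: Gamma_set_def H1_loc_def)
  obtain g where g: "L2_loc g" "has_weak_derivative q g" using qG by (auto simp: Gamma_set_def H1_loc_def)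
  have "continuous_on UNIV (\<lambda>t. gradV (q t))"
    by (rule continuous_on_compose2[OF cont_grad cq]) auto
  then obtain w where w: "\<And>t. (w has_vector_derivative gradV (q t)) (at t)"
    by (rule antiderivative_UNIV) blast
  have "continuous_on UNIV w"
    by (rule has_vector_derivative_continuous_on) (rule w)
  then obtain H where H: "\<And>t. (H has_vector_derivative w t) (at t)"
    by (rule antiderivative_UNIV) blast
  obtain x0 where x0: "x0 \<in> I" using I by blast
  obtain e where e: "e > 0" "ball x0 e \<subseteq> I" using I(1) x0 openE by blast
  have y0: "x0 + e / 2 \<in> I" using e by (auto simp: subset_iff dist_real_def)
  have sub: "{x..y} \<subseteq> I" if "x \<in> I" "y \<in> I" for x y
    using that I(2) unfolding is_interval_1 by (meson atLeastAtMost_iff subsetI)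
  obtain A B where AB: "\<And>t. t \<in> I \<Longrightarrow> q t - H t = A + t *\<^sub>R B"
  proof (rule affine_if_slopes_equal[OF x0 y0, where h="\<lambda>t. q t - H t"])
    show "(1 / (z - x)) *\<^sub>R ((q z - H z) - (q x - H x)) = (1 / (y - z)) *\<^sub>R ((q y - H y) - (q z - H z))"
      if "x \<in> I" "z \<in> I" "y \<in> I" "x < z" "z < y" for x z y
      by (rule minimizer_slopes[OF qG c min fin gt that(4,5) H w]) (use sub[OF that(1,3)] in auto)
  qed (use e in auto)
  define G where "G t = H t + (A + t *\<^sub>R B)" for t
  define v where "v t = w t + B" for t
  have G: "(G has_vector_derivative v t) (at t)" for t
    unfolding G_def[abs_def] v_def by (auto intro!: derivative_eq_intros H)
  have v: "(v has_vector_derivative gradV (q t)) (at t)" for t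
    unfolding v_def[abs_def] by (auto intro!: derivative_eq_intros w)
  have cv: "continuous_on UNIV v"
    by (rule has_vector_derivative_continuous_on) (rule v)
  have cG: "continuous_on UNIV G"
    by (rule has_vector_derivative_continuous_on) (rule G)
  have qG': "q t = G t" if "t \<in> closure I" for t
  proof -
    have "q t - G t = 0"
    proof (rule continuous_constant_on_closure[of I "\<lambda>t. q t - G t"])
      show "continuous_on (closure I) (\<lambda>t. q t - G t)"
        by (intro continuous_intros continuous_on_subset[OF cq] continuous_on_subset[OF cG]) auto
      show "q x - G x = 0" if "x \<in> I" for x
        using AB[OF that] by (simp add: G_def algebra_simps)
    qed (rule that)
    then show ?thesis by simp
  qed
  have "ennreal (integral {x..y} (\<lambda>t. (norm (v t))\<^sup>2 / 2 + (V (q t) - c))) \<le> J_fun V c q"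
    if xy: "x \<le> y" "{x..y} \<subseteq> closure I" for x y
  proof -
    have ae: "AE t in lborel. t \<in> {x..y} \<longrightarrow> g t - v t = 0"
    proof (rule AE_zero_if_interval_integrals_zero)
      show "set_integrable lborel {x..y} (\<lambda>t. g t - v t)"
        by (intro set_integral_diff L2_loc_set_integrable g set_integrable_continuous_Icc continuous_on_subset[OF cv]) auto
      fix a b assume ab: "x \<le> a" "a \<le> b" "b \<le> y"
      have "(v has_integral (G b - G a)) {a..b}"
        by (rule fundamental_theorem_of_calculus[OF ab(2)]) (use G in \<open>auto intro: has_vector_derivative_at_within\<close>)
      then have "integral {a..b} v = q b - q a" "v integrable_on {a..b}"
        using qG' xy ab by (auto simp: subset_iff)
      then show "integral {a..b} (\<lambda>t. g t - v t) = 0"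
        using weak_derivative_integral[OF cq g ab(2)] set_borel_integral_eq_integral(1)[OF L2_loc_set_integrable[OF g(1)]]
        by (subst integral_diff) auto
    qed
    have "ennreal (integral {x..y} (\<lambda>t. (norm (v t))\<^sup>2 / 2 + (V (q t) - c)))
      = (\<integral>\<^sup>+ t\<in>{x..y}. ennreal ((norm (v t))\<^sup>2 / 2 + (V (q t) - c)) \<partial>lborel)"
    proof (rule nn_integral_has_integral_lebesgue'[symmetric])
      show "((\<lambda>t. (norm (v t))\<^sup>2 / 2 + (V (q t) - c)) has_integral
        integral {x..y} (\<lambda>t. (norm (v t))\<^sup>2 / 2 + (V (q t) - c))) {x..y}"
        by (intro integrable_integral integrable_continuous_interval continuous_intros continuous_on_subset[OF cv]
            continuous_on_compose2[OF continuous_V] continuous_on_subset[OF cq]) auto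
    qed (use Vq in auto)
    also have "\<dots> \<le> (\<integral>\<^sup>+ t. ennreal ((norm (g t))\<^sup>2 / 2 + (V (q t) - c)) \<partial>lborel)"
    proof (rule nn_integral_mono_AE)
      show "AE t in lborel. ennreal ((norm (v t))\<^sup>2 / 2 + (V (q t) - c)) * indicator {x..y} t
          \<le> ennreal ((norm (g t))\<^sup>2 / 2 + (V (q t) - c))"
        using ae by eventually_elim (auto simp: indicator_def)
    qed
    also have "\<dots> = J_fun V c q" by (rule J_fun_eq[OF cq g, symmetric])
    finally show ?thesis .
  qed
  with G v qG' show ?thesis by (rule that)
qed

lemma energy_constant:
  assumes G: "\<And>t. (G has_vector_derivative v t) (at t)" and v: "\<And>t. (v has_vector_derivative gradV (q t)) (at t)"
    and S: "is_interval S" "\<And>t. t \<in> S \<Longrightarrow> q t = G t"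
  obtains E where "\<And>t. t \<in> S \<Longrightarrow> (norm (v t))\<^sup>2 / 2 - V (q t) = E"
proof -
  have "\<exists>E. \<forall>t\<in>S. (v t \<bullet> v t) / 2 - V (G t) = E"
  proof (rule has_field_derivative_zero_constant)
    show "convex S" using S(1) by (rule is_interval_convex)
    fix t assume "t \<in> S"
    then have "q t = G t" by (rule S)
    then have "((\<lambda>t. v t \<bullet> v t) has_vector_derivative (v t \<bullet> gradV (G t) + gradV (G t) \<bullet> v t)) (at t)"
      using bounded_bilinear.has_vector_derivative[OF bounded_bilinear_inner v v, of t] by simp
    then have 1: "((\<lambda>t. v t \<bullet> v t) has_real_derivative 2 * (v t \<bullet> gradV (G t))) (at t)"
      by (simp add: has_real_derivative_iff_has_vector_derivative inner_commute)
    have "((\<lambda>t. (v t \<bullet> v t) / 2 - V (G t)) has_real_derivative 0) (at t)"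
      using DERIV_diff[OF DERIV_cdivide[OF 1, of 2] DERIV_V_compose[OF G[of t]]] by simp
    then show "((\<lambda>t. (v t \<bullet> v t) / 2 - V (G t)) has_real_derivative 0) (at t within S)"
      by (rule DERIV_subset) simp
  qed
  then show ?thesis using that S(2) by (auto simp: power2_norm_eq_inner)
qed

text \<open>The kinetic term and \<open>V (q t) - c\<close> are nonnegative and their difference is
  \<open>E + c\<close>, so their sum, the action density, is at least
  \<open>\<bar>E + c\<bar>\<close>. Were this positive, a long enough interval would carry more
  action than \<open>M\<close>.\<close>

lemma energy_value_unbounded:
  fixes v q :: "real \<Rightarrow> 'a"
  assumes v: "continuous_on UNIV v" and q: "continuous_on UNIV q" and ge: "\<And>t. V (q t) \<ge> c"
    and E: "\<And>t. t \<in> I \<Longrightarrow> (norm (v t))\<^sup>2 / 2 - V (q t) = E"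
    and bd: "\<And>x y. x \<le> y \<Longrightarrow> {x..y} \<subseteq> I \<Longrightarrow> integral {x..y} (\<lambda>t. (norm (v t))\<^sup>2 / 2 + (V (q t) - c)) \<le> M"
    and unb: "\<And>T. T > 0 \<Longrightarrow> \<exists>x. {x..x+T} \<subseteq> I"
  shows "E = - c"
proof (rule ccontr)
  assume "E \<noteq> - c"
  define d where "d = \<bar>E + c\<bar>"
  have d: "d > 0" using \<open>E \<noteq> - c\<close> by (simp add: d_def)
  define T where "T = (\<bar>M\<bar> + 1) / d"
  have T: "T > 0" using d by (simp add: T_def)
  then obtain x where x: "{x..x+T} \<subseteq> I" using unb by blast
  have "\<bar>M\<bar> + 1 = integral {x..x+T} (\<lambda>_. d)" using d T by (simp add: T_def)
  also have "\<dots> \<le> integral {x..x+T} (\<lambda>t. (norm (v t))\<^sup>2 / 2 + (V (q t) - c))"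
  proof (rule integral_le)
    show "(\<lambda>t. (norm (v t))\<^sup>2 / 2 + (V (q t) - c)) integrable_on {x..x+T}"
      by (intro integrable_continuous_interval continuous_intros continuous_on_subset[OF v]
          continuous_on_compose2[OF continuous_V] continuous_on_subset[OF q]) auto
    fix t assume "t \<in> {x..x+T}"
    then have "(norm (v t))\<^sup>2 / 2 - V (q t) = E" using x E by blast
    moreover have "(norm (v t))\<^sup>2 / 2 \<ge> 0" "V (q t) \<ge> c" using ge by auto
    ultimately show "d \<le> (norm (v t))\<^sup>2 / 2 + (V (q t) - c)" unfolding d_def by linarith
  qed auto
  also have "\<dots> \<le> M" using x T by (intro bd) auto
  finally show False by simp
qed

text \<open>Running the arc at speed \<open>s\<close> changes its action from \<open>K + P\<close>
  to \<open>s * K + P / s\<close>, and minimality puts the least value at \<open>s = 1\<close>;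
  hence the kinetic part \<open>K\<close> equals the potential part \<open>P\<close>. Integrating
  the constant energy gives \<open>K - P = (b - a) * (E + c)\<close>.\<close>

lemma energy_value_bounded:
  fixes G v :: "real \<Rightarrow> 'a"
  assumes ab: "a < b"
    and G: "\<And>t. (G has_vector_derivative v t) (at t)" and v: "continuous_on UNIV v"
    and ge: "\<And>t. t \<in> {a..b} \<Longrightarrow> V (G t) \<ge> c"
    and E: "\<And>t. t \<in> {a..b} \<Longrightarrow> (norm (v t))\<^sup>2 / 2 - V (G t) = E"
    and ends: "G a \<in> Vm" "G b \<in> Vp" "V (G a) \<le> c" "V (G b) \<le> c"
    and min: "ennreal (integral {a..b} (\<lambda>t. (norm (v t))\<^sup>2 / 2 + (V (G t) - c))) \<le> m_val V Vm Vp c"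
  shows "E = - c"
proof -
  have cG: "continuous_on A G" for A
    by (rule has_vector_derivative_continuous_on) (rule G)
  define K where "K = integral {a..b} (\<lambda>t. (norm (v t))\<^sup>2 / 2)"
  define P where "P = integral {a..b} (\<lambda>t. V (G t) - c)"
  have iK: "((\<lambda>t. (norm (v t))\<^sup>2 / 2) has_integral K) {a..b}"
    unfolding K_def by (intro integrable_integral integrable_continuous_interval continuous_intros continuous_on_subset[OF v]) auto
  have iP: "((\<lambda>t. V (G t) - c) has_integral P) {a..b}"
    unfolding P_def by (intro integrable_integral integrable_continuous_interval continuous_intros
        continuous_on_compose2[OF continuous_V] cG) auto
  have K0: "K \<ge> 0" by (rule has_integral_nonneg[OF iK]) auto
  have P0: "P \<ge> 0" by (rule has_integral_nonneg[OF iP]) (use ge in auto)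
  have KP: "integral {a..b} (\<lambda>t. (norm (v t))\<^sup>2 / 2 + (V (G t) - c)) = K + P"
    by (rule integral_unique[OF has_integral_add[OF iK iP]])
  have scale: "K + P \<le> s * K + P / s" if s: "s > 0" for s
  proof -
    have D: "((\<lambda>t. G (s * t)) has_vector_derivative s *\<^sub>R v (s * t)) (at t)" for t
    proof -
      have "((\<lambda>t. s * t) has_vector_derivative s) (at t)"
        unfolding has_real_derivative_iff_has_vector_derivative[symmetric]
        by (auto intro!: derivative_eq_intros)
      from vector_diff_chain_at[OF this G] show ?thesis by (simp add: o_def)
    qed
    have rng: "s * t \<in> {a..b} \<longleftrightarrow> t \<in> {a / s..b / s}" for t
      using s by (auto simp: field_simps)
    have "m_val V Vm Vp c \<le> ennreal (integral {a/s..b/s} (\<lambda>t. (norm (s *\<^sub>R v (s * t)))\<^sup>2 / 2 + (V (G (s * t)) - c)))"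
    proof (rule action_of_path[OF continuous_V _ D])
      show "continuous_on {a / s..b / s} (\<lambda>t. s *\<^sub>R v (s * t))"
        by (intro continuous_intros continuous_on_compose2[OF v]) auto
      show "c \<le> V (G (s * t))" if "t \<in> {a / s..b / s}" for t
        using ge[of "s * t"] rng that by blast
    qed (use s ab ends in \<open>auto simp: divide_strict_right_mono\<close>)
    also have "((\<lambda>t. (norm (s *\<^sub>R v (s * t)))\<^sup>2 / 2 + (V (G (s * t)) - c)) has_integral (s * K + P / s)) {a/s..b/s}"
    proof -
      have img: "(\<lambda>x. (1 / s) *\<^sub>R x + - ((1 / s) *\<^sub>R 0)) ` cbox a b = {a/s..b/s}"
        using s ab image_affinity_atLeastAtMost[of "1/s" 0 a b] by (simp add: divide_inverse mult.commute)
      have "((\<lambda>t. (norm (v (s * t)))\<^sup>2 / 2) has_integral K / s) {a/s..b/s}"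
        using has_integral_affinity[of "\<lambda>t. (norm (v t))\<^sup>2 / 2" K a b s 0] iK s unfolding img by simp
      then have "((\<lambda>t. s\<^sup>2 * ((norm (v (s * t)))\<^sup>2 / 2)) has_integral s\<^sup>2 * (K / s)) {a/s..b/s}"
        by (rule has_integral_mult_right)
      moreover have "((\<lambda>t. V (G (s * t)) - c) has_integral P / s) {a/s..b/s}"
        using has_integral_affinity[of "\<lambda>t. V (G t) - c" P a b s 0] iP s unfolding img by simp
      ultimately have "((\<lambda>t. s\<^sup>2 * ((norm (v (s * t)))\<^sup>2 / 2) + (V (G (s * t)) - c)) has_integral s\<^sup>2 * (K / s) + P / s) {a/s..b/s}"
        by (rule has_integral_add)
      then show ?thesis using s by (simp add: power_mult_distrib power2_eq_square mult_ac)
    qed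
    then have "integral {a/s..b/s} (\<lambda>t. (norm (s *\<^sub>R v (s * t)))\<^sup>2 / 2 + (V (G (s * t)) - c)) = s * K + P / s"
      by (rule integral_unique)
    finally have "ennreal (K + P) \<le> ennreal (s * K + P / s)"
      using min unfolding KP by (rule order_trans[rotated])
    then show ?thesis using K0 P0 s by (subst (asm) ennreal_le_iff) auto
  qed
  have "K = P"
  proof (rule ccontr)
    assume "K \<noteq> P"
    then have KP0: "K + P > 0" using K0 P0 by linarith
    \<comment> \<open>The speed \<open>1 + d\<close> beats speed 1: with this \<open>d\<close>, the
      term \<open>K - P\<close> equals \<open>- 2 * d * (K + P)\<close>, and the gain in action,
      multiplied by the speed, becomes \<open>d\<^sup>2 * (K + 2 * P)\<close>. The bound
      \<open>\<bar>d\<bar> \<le> 1/2\<close> keeps the speed positive.\<close>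
    define d where "d = (P - K) / (2 * (K + P))"
    have d: "d \<noteq> 0" "\<bar>d\<bar> \<le> 1/2" using \<open>K \<noteq> P\<close> KP0 K0 P0 by (auto simp: d_def divide_simps abs_if)
    define s where "s = 1 + d"
    have s: "s > 0" using d by (auto simp: s_def)
    have "0 \<le> s * (s * K + P / s - (K + P))" using scale[OF s] s by (intro mult_nonneg_nonneg) auto
    also have "\<dots> = (s - 1) * (s * K - P)" using s by (simp add: algebra_simps)
    also have "\<dots> = d * (d * K + (K - P))" by (simp add: s_def algebra_simps)
    also have "K - P = - 2 * d * (K + P)"
    proof -
      have "2 * (K + P) \<noteq> 0" using KP0 by simp
      then have "d * (2 * (K + P)) = P - K" using nonzero_eq_divide_eq d_def by blast
      then show ?thesis by (simp add: algebra_simps)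
    qed
    also have "d * (d * K + - 2 * d * (K + P)) = - (d\<^sup>2 * (K + 2 * P))" by (simp add: power2_eq_square algebra_simps)
    finally have "d\<^sup>2 * (K + 2 * P) \<le> 0" by simp
    moreover have "K + 2 * P > 0" using KP0 K0 P0 by linarith
    ultimately show False using d by (simp add: mult_le_0_iff)
  qed
  have "((\<lambda>t. (norm (v t))\<^sup>2 / 2 - (V (G t) - c)) has_integral K - P) {a..b}"
    by (rule has_integral_diff[OF iK iP])
  then have "((\<lambda>t. E + c) has_integral K - P) {a..b}"
    by (rule has_integral_eq[rotated]) (use E in force)
  moreover have "((\<lambda>t. E + c) has_integral (b - a) *\<^sub>R (E + c)) {a..b}"
    using has_integral_const_real[of "E + c" a b] ab by simp
  ultimately have "K - P = (b - a) *\<^sub>R (E + c)" by (rule has_integral_unique)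
  then show ?thesis using \<open>K = P\<close> ab by simp
qed

text \<open>Follow a ray from the origin at unit speed, from the last time before \<open>r0\<close>
  with \<open>V \<le> c\<close> to the first time after \<open>r0\<close> with
  \<open>V \<le> c\<close>. Such times exist because \<open>V 0 = 0 < c\<close>, because
  \<open>V > c\<close> on the sphere, and because \<open>V \<le> 0\<close> at radius
  \<open>B + 1\<close>. The path takes time at most \<open>B + 1\<close> and \<open>V\<close> is at
  most \<open>W\<close> along it, so the bound is independent of \<open>c\<close>.\<close>

lemma m_val_bounded:
  obtains M where "M > 0" "\<And>c. 0 < c \<Longrightarrow> (\<And>x. x \<in> sphere 0 r0 \<Longrightarrow> c < V x) \<Longrightarrow>
    m_val V (sublevel V c \<inter> ball 0 r0) (sublevel V c - ball 0 r0) c \<le> ennreal M"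
proof -
  obtain B where B: "B > 0" "\<And>x. V x > 0 \<Longrightarrow> norm x \<le> B" "r0 < B" by (rule level_set_bounded) blast
  have "compact (V ` cball 0 B)" by (intro compact_continuous_image continuous_V) auto
  then obtain W where "\<forall>y\<in>V ` cball 0 B. norm y \<le> W"
    using compact_imp_bounded[of "V ` cball 0 B"] by (metis bounded_iff)
  then have W: "V x \<le> W" if "norm x \<le> B" for x
    using that by (auto simp: abs_le_iff)
  have W0: "W \<ge> 0" using W[of 0] V_0 B by simp
  obtain e :: 'a where e: "norm e = 1" using norm_Basis nonempty_Basis by blast
  define M where "M = (B + 1) * (1/2 + W)"
  have "m_val V (sublevel V c \<inter> ball 0 r0) (sublevel V c - ball 0 r0) c \<le> ennreal M"
    if c: "0 < c" "\<And>x. x \<in> sphere 0 r0 \<Longrightarrow> c < V x" for c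
  proof -
    define u where "u t = V (t *\<^sub>R e)" for t
    have cu: "continuous_on A u" for A
      unfolding u_def by (intro continuous_on_compose2[OF continuous_V[of UNIV]] continuous_intros) auto
    have ur: "u r0 > c" using c(2)[of "r0 *\<^sub>R e"] e r0 by (simp add: u_def)
    have comp: "compact ({a..b} \<inter> u -` {..c})" for a b
      by (intro compact_Int_closed compact_Icc) (use cu[of UNIV] closed_vimage[OF closed_atMost] in auto)
    have "0 \<in> {0..r0} \<inter> u -` {..c}" using r0 c V_0 by (simp add: u_def)
    then obtain x where x: "x \<in> {0..r0} \<inter> u -` {..c}" "\<And>t. t \<in> {0..r0} \<inter> u -` {..c} \<Longrightarrow> t \<le> x"
      using compact_attains_sup[OF comp[of 0 r0]] by (metis empty_iff)
    have "V ((B + 1) *\<^sub>R e) \<le> 0" using B(2)[of "(B + 1) *\<^sub>R e"] e B(1) by (auto simp: not_le[symmetric])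
    then have "B + 1 \<in> {r0..B+1} \<inter> u -` {..c}" using B c by (simp add: u_def)
    then obtain y where y: "y \<in> {r0..B+1} \<inter> u -` {..c}" "\<And>t. t \<in> {r0..B+1} \<inter> u -` {..c} \<Longrightarrow> y \<le> t"
      using compact_attains_inf[OF comp[of r0 "B+1"]] by (metis empty_iff)
    have xy: "x < r0" "r0 < y" using x(1) y(1) ur by (auto simp: less_le)
    have gt: "u t > c" if "t \<in> {x<..<y}" for t
    proof (rule ccontr)
      assume "\<not> u t > c"
      then have "t \<in> u -` {..c}" by simp
      then have "t \<in> {0..r0} \<inter> u -` {..c} \<or> t \<in> {r0..B+1} \<inter> u -` {..c}"
        using that x(1) y(1) by auto
      then show False using x(2)[of t] y(2)[of t] that by auto
    qed
    have ge: "u t \<ge> c" if "t \<in> {x..y}" for t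
    proof (rule continuous_ge_on_closure[of "{x<..<y}" u t c])
      show "t \<in> closure {x<..<y}" using that xy by simp
    qed (use gt cu less_imp_le in auto)
    have "m_val V (sublevel V c \<inter> ball 0 r0) (sublevel V c - ball 0 r0) c
      \<le> ennreal (integral {x..y} (\<lambda>t. (norm e)\<^sup>2 / 2 + (V (t *\<^sub>R e) - c)))"
      by (rule action_of_path[OF continuous_V])
        (use x y xy ge e r0 in \<open>auto simp: u_def sublevel_def intro!: derivative_eq_intros\<close>)
    also have "\<dots> \<le> ennreal M"
    proof (intro ennreal_leI)
      have "integral {x..y} (\<lambda>t. (norm e)\<^sup>2 / 2 + (V (t *\<^sub>R e) - c)) \<le> integral {x..y} (\<lambda>_. 1/2 + W)"
      proof (rule integral_le)
        show "(\<lambda>t. (norm e)\<^sup>2 / 2 + (V (t *\<^sub>R e) - c)) integrable_on {x..y}"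
          using cu unfolding u_def by (intro integrable_continuous_interval continuous_intros)
        fix t assume "t \<in> {x..y}"
        then have "V (t *\<^sub>R e) > 0" using ge[of t] c by (simp add: u_def)
        then have "V (t *\<^sub>R e) \<le> W" using W B by blast
        then show "(norm e)\<^sup>2 / 2 + (V (t *\<^sub>R e) - c) \<le> 1/2 + W" using c e by simp
      qed auto
      also have "\<dots> = (y - x) * (1/2 + W)" using xy by simp
      also have "\<dots> \<le> M" unfolding M_def using x y W0 by (intro mult_right_mono) auto
      finally show "integral {x..y} (\<lambda>t. (norm e)\<^sup>2 / 2 + (V (t *\<^sub>R e) - c)) \<le> M" .
    qed
    finally show ?thesis .
  qed
  moreover have "M > 0" unfolding M_def using B W0 by (intro mult_pos_pos) auto
  ultimately show ?thesis by (intro that) auto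
qed

end

section \<open>Asymptotic behaviour\<close>

lemma vector_derivative_bound:
  fixes f :: "real \<Rightarrow> 'a::real_normed_vector"
  assumes S: "convex S" and f: "\<And>t. t \<in> S \<Longrightarrow> (f has_vector_derivative f' t) (at t)"
    and K: "\<And>t. t \<in> S \<Longrightarrow> norm (f' t) \<le> K" and x: "x \<in> S" and y: "y \<in> S"
  shows "norm (f x - f y) \<le> K * \<bar>x - y\<bar>"
proof -
  have "norm (f x - f y) \<le> K * norm (x - y)"
  proof (rule differentiable_bound[OF S _ _ x y, where f'="\<lambda>t h. h *\<^sub>R f' t"])
    show "(f has_derivative (\<lambda>h. h *\<^sub>R f' t)) (at t within S)" if "t \<in> S" for t
      using f[OF that] by (simp add: has_vector_derivative_def has_derivative_at_withinI)
    have K0: "K \<ge> 0" using K[OF x] norm_ge_zero order_trans by blast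
    show "onorm (\<lambda>h. h *\<^sub>R f' t) \<le> K" if "t \<in> S" for t
      by (rule onorm_bound[OF K0]) (simp add: mult.commute[of K] mult_left_mono K that)
  qed
  then show ?thesis by simp
qed

text \<open>Barbalat's lemma: a Lipschitz function that reaches \<open>e\<close> stays above
  \<open>e / 2\<close> for the time \<open>\<delta> = e / (2 * K)\<close>, and a nonnegative
  function with bounded integrals cannot afford this at arbitrarily late times.\<close>

lemma tendsto_0_if_lipschitz_integrals_bounded:
  fixes f :: "real \<Rightarrow> real"
  assumes nonneg: "\<And>t. t \<ge> t0 \<Longrightarrow> f t \<ge> 0" and K: "K > 0"
    and lip: "\<And>s t. s \<ge> t0 \<Longrightarrow> t \<ge> t0 \<Longrightarrow> \<bar>f s - f t\<bar> \<le> K * \<bar>s - t\<bar>"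
    and cont: "continuous_on {t0..} f"
    and bd: "\<And>y. y \<ge> t0 \<Longrightarrow> integral {t0..y} f \<le> M"
  shows "(f \<longlongrightarrow> 0) at_top"
proof (rule ccontr)
  assume "\<not> (f \<longlongrightarrow> 0) at_top"
  then obtain e where e: "e > 0" "\<not> (\<forall>\<^sub>F t in at_top. \<bar>f t\<bar> < e)"
    by (auto simp: tendsto_iff dist_real_def)
  have int: "f integrable_on {x..y}" if "t0 \<le> x" for x y
    by (intro integrable_continuous_interval continuous_on_subset[OF cont]) (use that in auto)
  define F where "F = (\<lambda>y. integral {t0..y} f) ` {t0..}"
  have F: "bdd_above F" "F \<noteq> {}" unfolding F_def using bd by (auto intro!: bdd_aboveI[of _ M])
  define \<delta> where "\<delta> = e / (2 * K)"
  have \<delta>: "\<delta> > 0" using e K by (simp add: \<delta>_def)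
  \<comment> \<open>\<open>T\<close> is chosen so late that less than
    \<open>\<delta> * (e / 2)\<close> of the supremum of the integrals is left; one later time with
    \<open>f t \<ge> e\<close> already consumes that much.\<close>
  have "Sup F - \<delta> * (e / 2) < Sup F" using \<delta> e by simp
  then obtain T where T: "T \<ge> t0" "integral {t0..T} f > Sup F - \<delta> * (e / 2)"
    using less_cSupE[OF _ F(2)] unfolding F_def by (metis (no_types, lifting) imageE atLeast_iff)
  obtain t where t: "t \<ge> T" "\<bar>f t\<bar> \<ge> e"
    using e(2) unfolding eventually_at_top_linorder by (meson not_less)
  have ft: "f t \<ge> e" using t nonneg[of t] T by auto
  have "\<delta> * (e / 2) = integral {t..t+\<delta>} (\<lambda>_. e / 2)" using \<delta> by simp
  also have "\<dots> \<le> integral {t..t+\<delta>} f"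
  proof (rule integral_le)
    show "f integrable_on {t..t+\<delta>}" by (rule int) (use t T in auto)
    fix s assume s: "s \<in> {t..t+\<delta>}"
    have "\<bar>f s - f t\<bar> \<le> K * \<bar>s - t\<bar>" using s t T by (intro lip) auto
    also have "\<dots> \<le> K * \<delta>" using s K by (intro mult_left_mono) auto
    also have "\<dots> = e / 2" using K by (simp add: \<delta>_def)
    finally show "e / 2 \<le> f s" using ft by linarith
  qed auto
  finally have 1: "\<delta> * (e / 2) \<le> integral {t..t+\<delta>} f" .
  have 2: "integral {t0..t} f = integral {t0..T} f + integral {T..t} f"
    using Henstock_Kurzweil_Integration.integral_combine[OF T(1) t(1) int[of t0 t]] by simp
  have 3: "integral {t0..t+\<delta>} f = integral {t0..t} f + integral {t..t+\<delta>} f"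
    using Henstock_Kurzweil_Integration.integral_combine[of t0 t "t+\<delta>", OF _ _ int] T t \<delta> by simp
  have "integral {T..t} f \<ge> 0"
    by (rule integral_nonneg[OF int[OF T(1)]]) (use nonneg T in auto)
  then have "integral {t0..t+\<delta>} f > Sup F" using 1 2 3 T(2) by linarith
  moreover have "integral {t0..t+\<delta>} f \<in> F" unfolding F_def using T t \<delta> by auto
  ultimately show False using cSup_upper[OF _ F(1)] by (meson not_less)
qed

section \<open>Decay of solutions with finite action\<close>

context potential_well
begin

text \<open>Near a limit point with nonzero gradient the velocity would change by a definite amount
  in unit time, yet it tends to 0. The mean value theorem is applied to the component along
  \<open>e = gradV x\<close>, and the intermediate point also tends to \<open>x\<close> because the
  curve moves less and less.\<close>

lemma limit_point_critical:
  fixes p :: "real \<Rightarrow> 'a"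
  assumes p: "\<And>t. t \<ge> t0 \<Longrightarrow> (p has_vector_derivative v t) (at t)"
    and v: "\<And>t. t \<ge> t0 \<Longrightarrow> (v has_vector_derivative gradV (p t)) (at t)"
    and lim: "(v \<longlongrightarrow> 0) at_top" and X: "filterlim X at_top sequentially"
    and x: "(\<lambda>n. p (X n)) \<longlonglongrightarrow> x"
  shows "gradV x = 0"
proof -
  define e where "e = gradV x"
  have "\<exists>s. 0 < s \<and> s < 1 \<and> e \<bullet> v (t + 1) - e \<bullet> v t = e \<bullet> gradV (p (t + s))" if "t \<ge> t0" for t
  proof -
    have "((\<lambda>t. e \<bullet> v t) has_real_derivative e \<bullet> gradV (p s)) (at s)" if "s \<ge> t0" for s
      using v[OF that] unfolding has_real_derivative_iff_has_vector_derivative has_vector_derivative_def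
      by (auto intro!: derivative_eq_intros)
    then obtain z where "t < z" "z < t + 1" "e \<bullet> v (t + 1) - e \<bullet> v t = (t + 1 - t) * (e \<bullet> gradV (p z))"
      using MVT2[of t "t + 1" "\<lambda>t. e \<bullet> v t" "\<lambda>s. e \<bullet> gradV (p s)"] \<open>t \<ge> t0\<close> by auto
    then show ?thesis by (intro exI[of _ "z - t"]) auto
  qed
  then obtain s where s: "\<And>t. t \<ge> t0 \<Longrightarrow> 0 < s t \<and> s t < 1 \<and> e \<bullet> v (t + 1) - e \<bullet> v t = e \<bullet> gradV (p (t + s t))"
    by metis
  have ev0: "\<forall>\<^sub>F n in sequentially. X n \<ge> t0" using X by (simp add: filterlim_at_top)
  have X1: "filterlim (\<lambda>n. X n + 1) at_top sequentially"
    using filterlim_tendsto_add_at_top[OF tendsto_const[of 1] X] by (simp add: add.commute)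
  have "(\<lambda>n. e \<bullet> v (X n + 1) - e \<bullet> v (X n)) \<longlonglongrightarrow> e \<bullet> 0 - e \<bullet> 0"
    by (intro tendsto_intros filterlim_compose[OF lim X] filterlim_compose[OF lim X1])
  then have "(\<lambda>n. e \<bullet> v (X n + 1) - e \<bullet> v (X n)) \<longlonglongrightarrow> 0" by simp
  moreover have "\<forall>\<^sub>F n in sequentially. e \<bullet> v (X n + 1) - e \<bullet> v (X n) = e \<bullet> gradV (p (X n + s (X n)))"
    using ev0 by eventually_elim (use s in blast)
  ultimately have "(\<lambda>n. e \<bullet> gradV (p (X n + s (X n)))) \<longlonglongrightarrow> 0"
    by (rule Lim_transform_eventually)
  moreover have "(\<lambda>n. p (X n + s (X n)) - p (X n)) \<longlonglongrightarrow> 0"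
  proof (rule tendstoI)
    fix \<eta> :: real assume \<eta>: "\<eta> > 0"
    then have "\<forall>\<^sub>F t in at_top. norm (v t) < \<eta> / 2" using lim by (auto simp: tendsto_iff dest: spec[of _ "\<eta>/2"])
    then obtain T where T: "\<And>t. t \<ge> T \<Longrightarrow> norm (v t) < \<eta> / 2" by (auto simp: eventually_at_top_linorder)
    have "\<forall>\<^sub>F n in sequentially. X n \<ge> T" using X by (simp add: filterlim_at_top)
    with ev0 show "\<forall>\<^sub>F n in sequentially. dist (p (X n + s (X n)) - p (X n)) 0 < \<eta>"
    proof eventually_elim
      case (elim n)
      note sn = s[OF elim(1)]
      have "norm (p (X n + s (X n)) - p (X n)) \<le> \<eta> / 2 * \<bar>X n + s (X n) - X n\<bar>"
        by (rule vector_derivative_bound[of "{X n..X n + 1}", OF _ p]) (use elim sn T in \<open>auto intro: less_imp_le\<close>)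
      also have "\<dots> \<le> \<eta> / 2 * 1" using sn \<eta> by (intro mult_left_mono) auto
      finally show ?case using \<eta> by simp
    qed
  qed
  then have "(\<lambda>n. (p (X n + s (X n)) - p (X n)) + p (X n)) \<longlonglongrightarrow> 0 + x" by (rule tendsto_add[OF _ x])
  then have "(\<lambda>n. p (X n + s (X n))) \<longlonglongrightarrow> x" by simp
  then have "(\<lambda>n. e \<bullet> gradV (p (X n + s (X n)))) \<longlonglongrightarrow> e \<bullet> gradV x"
    using cont_grad by (intro tendsto_intros isCont_tendsto_compose[of x gradV]) (simp_all add: continuous_on_eq_continuous_at)
  ultimately have "e \<bullet> gradV x = 0" using LIMSEQ_unique by blast
  then show ?thesis by (simp add: e_def)
qed

text \<open>On a bounded orbit the energy identity bounds the velocity, so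
  \<open>V (p t) - c\<close> is nonnegative and Lipschitz in time with bounded integrals. It
  therefore tends to 0, and the energy identity passes this on to the velocity.\<close>

lemma decay_at_top:
  fixes p :: "real \<Rightarrow> 'a"
  assumes p: "\<And>t. t \<ge> t0 \<Longrightarrow> (p has_vector_derivative v t) (at t)"
    and v: "\<And>t. t \<ge> t0 \<Longrightarrow> (v has_vector_derivative gradV (p t)) (at t)"
    and B: "\<And>t. t \<ge> t0 \<Longrightarrow> norm (p t) \<le> B"
    and E: "\<And>t. t \<ge> t0 \<Longrightarrow> (norm (v t))\<^sup>2 / 2 = V (p t) - c"
    and M: "\<And>y. y \<ge> t0 \<Longrightarrow> integral {t0..y} (\<lambda>t. V (p t) - c) \<le> M"
  shows "(v \<longlongrightarrow> 0) at_top" "((\<lambda>t. V (p t) - c) \<longlongrightarrow> 0) at_top"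
proof -
  have bounded_on: "\<exists>W. \<forall>x\<in>cball 0 B. norm (f x) \<le> W" if "continuous_on UNIV f" for f :: "'a \<Rightarrow> 'b::real_normed_vector"
  proof -
    have "bounded (f ` cball 0 B)"
      by (intro compact_imp_bounded compact_continuous_image continuous_on_subset[OF that]) auto
    then show ?thesis by (auto simp: bounded_iff)
  qed
  obtain W1 where W1: "\<And>x. norm x \<le> B \<Longrightarrow> \<bar>V x\<bar> \<le> W1"
    using bounded_on[OF continuous_V] by (metis mem_cball_0 real_norm_def)
  obtain W2 where W2: "\<And>x. norm x \<le> B \<Longrightarrow> norm (gradV x) \<le> W2"
    using bounded_on[OF cont_grad] by (metis mem_cball_0)
  \<comment> \<open>The energy identity gives \<open>(norm (v t))\<^sup>2 \<le> k\<close>; the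
    summand 1 ensures \<open>k \<le> k\<^sup>2\<close>, so \<open>k\<close> itself bounds the
    speed.\<close>
  define k where "k = 2 * (W1 + \<bar>c\<bar>) + 1"
  have vk: "norm (v t) \<le> k" if "t \<ge> t0" for t
  proof -
    have "\<bar>V (p t)\<bar> \<le> W1" using W1[OF B[OF that]] .
    then have "V (p t) - c \<le> W1 + \<bar>c\<bar>" by linarith
    then have "(norm (v t))\<^sup>2 \<le> k" unfolding E[OF that, symmetric] k_def by simp
    moreover have "1 \<le> k" using order_trans[OF abs_ge_zero \<open>\<bar>V (p t)\<bar> \<le> W1\<close>] by (simp add: k_def)
    moreover have "k \<le> k\<^sup>2" using \<open>1 \<le> k\<close> by (simp add: power2_eq_square)
    ultimately have "(norm (v t))\<^sup>2 \<le> k\<^sup>2" "0 \<le> k" by linarith+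
    then show ?thesis by (rule power2_le_imp_le)
  qed
  have D: "((\<lambda>t. V (p t) - c) has_real_derivative v t \<bullet> gradV (p t)) (at t)" if "t \<ge> t0" for t
    using DERIV_diff[OF DERIV_V_compose[OF p[OF that]] DERIV_const[of c]] by (simp del: DERIV_const)
  have W20: "W2 \<ge> 0" using order_trans[OF norm_ge_zero W2[OF B[of t0]]] by simp
  have k0: "k \<ge> 0" using order_trans[OF norm_ge_zero vk[of t0]] by simp
  have Vlim: "((\<lambda>t. V (p t) - c) \<longlongrightarrow> 0) at_top"
  proof (rule tendsto_0_if_lipschitz_integrals_bounded[where K="k * W2 + 1" and M=M, OF _ _ _ _ M])
    show "0 \<le> V (p t) - c" if "t \<ge> t0" for t using E[OF that] by (metis divide_nonneg_pos zero_le_power2 zero_less_numeral)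
    show "0 < k * W2 + 1" using k0 W20 by (simp add: add_nonneg_pos)
    show "\<bar>(V (p s) - c) - (V (p t) - c)\<bar> \<le> (k * W2 + 1) * \<bar>s - t\<bar>" if "s \<ge> t0" "t \<ge> t0" for s t
    proof -
      have "norm ((V (p s) - c) - (V (p t) - c)) \<le> (k * W2 + 1) * \<bar>s - t\<bar>"
      proof (rule vector_derivative_bound[of "{t0..}"])
        fix u assume "u \<in> {t0..}"
        then have u: "u \<ge> t0" by simp
        show "((\<lambda>t. V (p t) - c) has_vector_derivative v u \<bullet> gradV (p u)) (at u)"
          using D[OF u] by (simp add: has_real_derivative_iff_has_vector_derivative)
        have "\<bar>v u \<bullet> gradV (p u)\<bar> \<le> norm (v u) * norm (gradV (p u))" by (rule Cauchy_Schwarz_ineq2)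
        also have "\<dots> \<le> k * W2" by (intro mult_mono vk W2 B u k0) auto
        finally show "norm (v u \<bullet> gradV (p u)) \<le> k * W2 + 1" by simp
      qed (use that in auto)
      then show ?thesis by simp
    qed
    show "continuous_on {t0..} (\<lambda>t. V (p t) - c)"
      using D by (intro continuous_at_imp_continuous_on ballI DERIV_isCont) auto
  qed
  then show "((\<lambda>t. V (p t) - c) \<longlongrightarrow> 0) at_top" .
  have "((\<lambda>t. sqrt (2 * (V (p t) - c))) \<longlongrightarrow> sqrt (2 * 0)) at_top"
    by (intro tendsto_intros Vlim)
  then have "((\<lambda>t. sqrt (2 * (V (p t) - c))) \<longlongrightarrow> 0) at_top" by simp
  moreover have "\<forall>\<^sub>F t in at_top. sqrt (2 * (V (p t) - c)) = norm (v t)"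
    using eventually_ge_at_top[of t0]
  proof eventually_elim
    case (elim t)
    have "2 * (V (p t) - c) = (norm (v t))\<^sup>2" using E[OF elim] by simp
    then show ?case by (simp only: real_sqrt_abs) simp
  qed
  ultimately have "((\<lambda>t. norm (v t)) \<longlongrightarrow> 0) at_top" by (rule Lim_transform_eventually)
  then show "(v \<longlongrightarrow> 0) at_top" by (rule tendsto_norm_zero_cancel)
qed

text \<open>Excludes \<^term>\<open>omega_time Vm Vp q = \<infinity>\<close> for a minimizer.\<close>

lemma escape_impossible:
  fixes p q :: "real \<Rightarrow> 'a"
  assumes p: "\<And>t. t \<ge> t0 \<Longrightarrow> (p has_vector_derivative v t) (at t)"
    and v: "\<And>t. t \<ge> t0 \<Longrightarrow> (v has_vector_derivative gradV (p t)) (at t)"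
    and eq: "\<And>t. t \<ge> t0 \<Longrightarrow> q t = p t"
    and c: "c > 0" and ge: "\<And>t. V (q t) \<ge> c"
    and E: "\<And>t. t \<ge> t0 \<Longrightarrow> (norm (v t))\<^sup>2 / 2 = V (p t) - c"
    and M: "\<And>y. y \<ge> t0 \<Longrightarrow> integral {t0..y} (\<lambda>t. V (p t) - c) \<le> M"
    and lim: "Liminf at_top (\<lambda>t. ereal (infdist (q t) Vp)) = 0"
    and Vp: "closed Vp" "Vp \<noteq> {}" "\<And>x. x \<in> Vp \<Longrightarrow> V x \<le> c"
    and ns: "\<And>x. x \<in> Vp \<Longrightarrow> V x = c \<Longrightarrow> gradV x \<noteq> 0"
  shows False
proof -
  obtain B where B: "\<And>x. V x > 0 \<Longrightarrow> norm x \<le> B" by (rule level_set_bounded) blast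
  have qB: "norm (q t) \<le> B" for t using B ge[of t] c by (meson less_le_trans)
  have v0: "(v \<longlongrightarrow> 0) at_top"
    by (rule decay_at_top(1)[OF p v _ E M]) (use qB eq in \<open>auto simp flip: eq\<close>)
  \<comment> \<open>The liminf condition provides times \<open>X n\<close> tending to infinity along
    which \<open>q\<close> approaches \<open>Vp\<close>. A limit point lies in \<open>Vp\<close> on
    the level \<open>c\<close>, where the gradient does not vanish, whereas the vanishing velocity
    makes it critical.\<close>
  have "\<exists>t\<ge>real n. infdist (q t) Vp < 1 / real (Suc n)" for n
  proof (rule ccontr)
    assume "\<not> (\<exists>t\<ge>real n. infdist (q t) Vp < 1 / real (Suc n))"
    then have "\<forall>\<^sub>F t in at_top. ereal (1 / real (Suc n)) \<le> ereal (infdist (q t) Vp)"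
      by (intro eventually_at_top_linorderI[of "real n"]) (auto simp: not_less)
    then have "ereal (1 / real (Suc n)) \<le> 0" using Liminf_bounded lim by metis
    then show False by (simp del: of_nat_Suc)
  qed
  then obtain X where X: "\<And>n. X n \<ge> real n" "\<And>n. infdist (q (X n)) Vp < 1 / real (Suc n)" by metis
  have "bounded (range (\<lambda>n. q (X n)))" using qB by (auto simp: bounded_iff)
  then obtain x r where r: "strict_mono r" "((\<lambda>n. q (X n)) \<circ> r) \<longlonglongrightarrow> x"
    using bounded_imp_convergent_subsequence by blast
  then have qx: "(\<lambda>n. q (X (r n))) \<longlonglongrightarrow> x" by (simp add: o_def)
  have Xr: "filterlim (\<lambda>n. X (r n)) at_top sequentially"
  proof (rule filterlim_at_top_mono[OF filterlim_real_sequentially])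
    show "\<forall>\<^sub>F n in sequentially. real n \<le> X (r n)"
      using X(1) seq_suble[OF r(1)] by (intro always_eventually allI) (meson of_nat_mono order_trans)
  qed
  have "(\<lambda>n. infdist (q (X (r n))) Vp) \<longlonglongrightarrow> infdist x Vp" by (intro tendsto_infdist qx)
  moreover have "(\<lambda>n. infdist (q (X (r n))) Vp) \<longlonglongrightarrow> 0"
  proof (rule Lim_null_comparison)
    have "(\<lambda>n. 1 / real (Suc n)) \<longlonglongrightarrow> 0" using LIMSEQ_inverse_real_of_nat by (simp add: inverse_eq_divide)
    from LIMSEQ_subseq_LIMSEQ[OF this r(1)] show "(\<lambda>n. 1 / real (Suc (r n))) \<longlonglongrightarrow> 0" by (simp add: o_def)
    show "\<forall>\<^sub>F n in sequentially. norm (infdist (q (X (r n))) Vp) \<le> 1 / real (Suc (r n))"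
      using X(2) by (intro always_eventually allI) (auto simp: infdist_nonneg less_imp_le)
  qed
  ultimately have "infdist x Vp = 0" using LIMSEQ_unique by blast
  then have xVp: "x \<in> Vp" using in_closed_iff_infdist_zero[OF Vp(1,2)] by blast
  have "(\<lambda>n. V (q (X (r n)))) \<longlonglongrightarrow> V x"
    using continuous_V[of UNIV] by (intro isCont_tendsto_compose[OF _ qx]) (simp add: continuous_on_eq_continuous_at)
  then have "V x \<ge> c" using ge by (intro LIMSEQ_le_const) auto
  with Vp(3)[OF xVp] have "V x = c" by simp
  have px: "(\<lambda>n. p (X (r n))) \<longlonglongrightarrow> x"
  proof (rule Lim_transform_eventually[OF qx])
    have "\<forall>\<^sub>F n in sequentially. X (r n) \<ge> t0" using Xr by (simp add: filterlim_at_top)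
    then show "\<forall>\<^sub>F n in sequentially. q (X (r n)) = p (X (r n))" by eventually_elim (rule eq)
  qed
  have "gradV x = 0" by (rule limit_point_critical[OF p v v0 Xr px])
  with ns[OF xVp \<open>V x = c\<close>] show False by simp
qed

end

section \<open>Extension by reflection\<close>

context potential_well
begin

text \<open>Equation and energy identity near one time, with a local velocity \<open>u\<close>
  instead of \<open>vderiv p\<close>. In this form the property passes through reflections and
  shifts, and a curve given piecewise can be checked near each time separately.\<close>

definition locally_solves :: "real \<Rightarrow> (real \<Rightarrow> 'a) \<Rightarrow> real \<Rightarrow> bool" where
  "locally_solves c p t \<longleftrightarrow> (\<exists>e>0. \<exists>u. \<forall>s\<in>ball t e. (p has_vector_derivative u s) (at s) \<and>
     (u has_vector_derivative gradV (p s)) (at s) \<and> (norm (u s))\<^sup>2 / 2 = V (p s) - c)"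

lemma locally_solves_reflect:
  assumes "locally_solves c p t"
  shows "locally_solves c (\<lambda>s. p (k - s)) (k - t)"
proof -
  obtain e u where e: "e > 0" and u: "\<And>s. s \<in> ball t e \<Longrightarrow> (p has_vector_derivative u s) (at s)"
    "\<And>s. s \<in> ball t e \<Longrightarrow> (u has_vector_derivative gradV (p s)) (at s)"
    "\<And>s. s \<in> ball t e \<Longrightarrow> (norm (u s))\<^sup>2 / 2 = V (p s) - c"
    using assms unfolding locally_solves_def by blast
  have r: "((\<lambda>s. k - s) has_vector_derivative -1) (at s)" for s
    by (auto intro!: derivative_eq_intros)
  have "((\<lambda>s. p (k - s)) has_vector_derivative - u (k - s)) (at s) \<and>
     ((\<lambda>s. - u (k - s)) has_vector_derivative gradV (p (k - s))) (at s) \<and>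
     (norm (- u (k - s)))\<^sup>2 / 2 = V (p (k - s)) - c" if "s \<in> ball (k - t) e" for s
  proof -
    have s: "k - s \<in> ball t e" using that by (auto simp: dist_real_def)
    show ?thesis
      using vector_diff_chain_at[OF r u(1)[OF s]] u(3)[OF s]
        has_vector_derivative_minus[OF vector_diff_chain_at[OF r u(2)[OF s]]] by (simp add: o_def)
  qed
  then show ?thesis unfolding locally_solves_def using e
    by (intro exI[of _ e] conjI exI[of _ "\<lambda>s. - u (k - s)"]) auto
qed

text \<open>A translation of time is the composition of two reflections.\<close>

lemma locally_solves_shift:
  assumes "locally_solves c p t"
  shows "locally_solves c (\<lambda>s. p (s + k)) (t - k)"
  using locally_solves_reflect[OF locally_solves_reflect[OF assms, of 0], of "- k"]
  by (simp add: algebra_simps)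

text \<open>The local velocities are restrictions of \<open>vderiv p\<close>, so the local solutions
  patch together without any choice.\<close>

lemma locally_solves_everywhere:
  assumes "\<And>t. locally_solves c p t"
  shows "(p has_vector_derivative vderiv p t) (at t)"
    "(vderiv p has_vector_derivative gradV (p t)) (at t)"
    "(norm (vderiv p t))\<^sup>2 / 2 = V (p t) - c"
proof -
  obtain e u where e: "e > 0" and u: "\<And>s. s \<in> ball t e \<Longrightarrow> (p has_vector_derivative u s) (at s)"
    "\<And>s. s \<in> ball t e \<Longrightarrow> (u has_vector_derivative gradV (p s)) (at s)"
    "\<And>s. s \<in> ball t e \<Longrightarrow> (norm (u s))\<^sup>2 / 2 = V (p s) - c"
    using assms[of t] unfolding locally_solves_def by blast
  have eq: "vderiv p s = u s" if "s \<in> ball t e" for s using u(1)[OF that] by (rule vector_derivative_at)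
  have t: "t \<in> ball t e" using e by simp
  show "(p has_vector_derivative vderiv p t) (at t)" using u(1)[OF t] eq[OF t] by simp
  show "(norm (vderiv p t))\<^sup>2 / 2 = V (p t) - c" using u(3)[OF t] eq[OF t] by simp
  show "(vderiv p has_vector_derivative gradV (p t)) (at t)"
    by (rule has_vector_derivative_transform_within_open[OF u(2)[OF t] open_ball t]) (simp only: eq)
qed

text \<open>The reflected branch has velocity \<open>- v (2 * b - s)\<close>. The two branches have
  the same position at \<open>b\<close>, their velocities match because \<open>v b = 0\<close>, and
  their accelerations match because both equal \<open>gradV (q b)\<close>. As \<open>G\<close> and
  \<open>v\<close> are differentiable on both sides of \<open>b\<close>, each branch is smooth up to
  the junction.\<close>

lemma locally_solves_glue:
  assumes G: "\<And>t. (G has_vector_derivative v t) (at t)" and v: "\<And>t. (v has_vector_derivative gradV (q t)) (at t)"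
    and pG: "\<And>s. s \<in> {b - e..b} \<Longrightarrow> p s = G s" "\<And>s. s \<in> {b - e..b} \<Longrightarrow> q s = G s"
    and refl: "\<And>s. s \<in> {b - e..b} \<Longrightarrow> p (2 * b - s) = p s"
    and E: "\<And>s. s \<in> {b - e..b} \<Longrightarrow> (norm (v s))\<^sup>2 / 2 = V (G s) - c"
    and vb: "v b = 0" and t: "t \<in> {b - e<..<b + e}"
  shows "locally_solves c p t"
proof -
  define H where "H s = (if s \<in> {..b} then G s else G (2 * b - s))" for s
  define u where "u s = (if s \<in> {..b} then v s else - v (2 * b - s))" for s
  have r: "((\<lambda>s. 2 * b - s) has_vector_derivative -1) (at s)" for s
    by (auto intro!: derivative_eq_intros)
  have G': "((\<lambda>s. G (2 * b - s)) has_vector_derivative - v (2 * b - s)) (at s)" for s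
    using vector_diff_chain_at[OF r G] by (simp add: o_def)
  have v': "((\<lambda>s. - v (2 * b - s)) has_vector_derivative gradV (q (2 * b - s))) (at s)" for s
    using has_vector_derivative_minus[OF vector_diff_chain_at[OF r v]] by (simp add: o_def)
  have H: "(H has_vector_derivative u s) (at s)" for s
    unfolding H_def[abs_def] u_def
    by (rule has_vector_derivative_If_within_closures[where T="{b..}" and u=UNIV])
      (use vb in \<open>auto intro: has_vector_derivative_at_within G G'\<close>)
  have u: "(u has_vector_derivative (if s \<in> {..b} then gradV (q s) else gradV (q (2 * b - s)))) (at s)" for s
    unfolding u_def[abs_def]
    by (rule has_vector_derivative_If_within_closures[where T="{b..}" and u=UNIV])
      (use vb in \<open>auto intro: has_vector_derivative_at_within v v'\<close>)
  have pH: "p s = H s" if "s \<in> {b - e<..<b + e}" for s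
  proof (cases "s \<le> b")
    case False
    then have *: "2 * b - s \<in> {b - e..b}" using that by auto
    have "p s = p (2 * b - (2 * b - s))" by simp
    also have "\<dots> = G (2 * b - s)" using refl[OF *] pG(1)[OF *] by simp
    finally show ?thesis using False by (simp add: H_def)
  qed (use that pG in \<open>auto simp: H_def\<close>)
  have main: "(p has_vector_derivative u s) (at s) \<and> (u has_vector_derivative gradV (p s)) (at s) \<and>
      (norm (u s))\<^sup>2 / 2 = V (p s) - c" if s: "s \<in> {b - e<..<b + e}" for s
  proof (intro conjI)
    show "(p has_vector_derivative u s) (at s)"
      by (rule has_vector_derivative_transform_within_open[OF H _ s]) (use pH in auto)
    show "(u has_vector_derivative gradV (p s)) (at s)"
    proof (cases "s \<le> b")
      case True
      then have "s \<in> {b - e..b}" using s by auto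
      then show ?thesis using u[of s] pG True by simp
    next
      case False
      then have "2 * b - s \<in> {b - e..b}" using s by auto
      then show ?thesis using u[of s] pG(2) pH[OF s] False by (simp add: H_def)
    qed
    show "(norm (u s))\<^sup>2 / 2 = V (p s) - c"
    proof (cases "s \<le> b")
      case True
      then have "s \<in> {b - e..b}" using s by auto
      then show ?thesis using E pG True by (simp add: u_def)
    next
      case False
      then have "2 * b - s \<in> {b - e..b}" using s by auto
      then show ?thesis using E pH[OF s] False by (simp add: H_def u_def)
    qed
  qed
  have "ball t (e - \<bar>t - b\<bar>) \<subseteq> {b - e<..<b + e}" by (auto simp: dist_real_def abs_if split: if_splits)
  moreover have "e - \<bar>t - b\<bar> > 0" using t by (auto simp: abs_if)
  ultimately show ?thesis unfolding locally_solves_def using main by blast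
qed

lemma periodic_of_int:
  fixes p :: "real \<Rightarrow> 'b"
  assumes "\<And>t. p (t + T) = p t"
  shows "p (t + of_int n * T) = p t"
proof (induction n arbitrary: t rule: int_induct[where k=0])
  case (step1 i)
  then show ?case using assms[of "t + of_int i * T"] by (simp add: algebra_simps)
next
  case (step2 i)
  then show ?case using assms[of "t + of_int (i - 1) * T"] by (simp add: algebra_simps)
qed simp

lemma reflected_solution:
  assumes G: "\<And>t. (G has_vector_derivative v t) (at t)" and v: "\<And>t. (v has_vector_derivative gradV (q t)) (at t)"
    and pG: "\<And>s. s \<le> b \<Longrightarrow> p s = G s" "\<And>s. s \<le> b \<Longrightarrow> q s = G s"
    and refl: "\<And>s. s \<le> b \<Longrightarrow> p (2 * b - s) = p s"
    and E: "\<And>s. s \<le> b \<Longrightarrow> (norm (v s))\<^sup>2 / 2 = V (G s) - c"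
    and vb: "v b = 0"
  shows "locally_solves c p t" "p (b + t) = p (b - t)"
proof -
  show "locally_solves c p t"
    by (rule locally_solves_glue[OF G v _ _ _ _ vb, where e="\<bar>t - b\<bar> + 1"]) (use pG refl E in auto)
  show "p (b + t) = p (b - t)"
    using refl[of "b - t"] refl[of "b + t"] by (cases "t \<ge> 0") (auto simp: algebra_simps)
qed

text \<open>Gluing at \<open>b\<close> covers the open interval from \<open>a\<close> to
  \<open>2 * b - a\<close>, one full period without its ends; gluing at \<open>a\<close>, after
  reversing time, supplies the missing point. Periodicity transports both to all times.\<close>

lemma periodic_solution:
  assumes ab: "a < b"
    and G: "\<And>t. (G has_vector_derivative v t) (at t)" and v: "\<And>t. (v has_vector_derivative gradV (q t)) (at t)"
    and pG: "\<And>s. s \<in> {a..b} \<Longrightarrow> p s = G s" "\<And>s. s \<in> {a..b} \<Longrightarrow> q s = G s"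
    and refl: "\<And>s. s \<in> {a..b} \<Longrightarrow> p (2 * b - s) = p s"
    and per: "\<And>t. p (t + 2 * (b - a)) = p t"
    and E: "\<And>s. s \<in> {a..b} \<Longrightarrow> (norm (v s))\<^sup>2 / 2 = V (G s) - c"
    and va: "v a = 0" and vb: "v b = 0"
  shows "locally_solves c p t" "p (b + t) = p (b - t)"
proof -
  define T where "T = 2 * (b - a)"
  have T: "T > 0" using ab by (simp add: T_def)
  have perT: "p (t + of_int n * T) = p t" for t n
    by (rule periodic_of_int) (use per in \<open>simp add: T_def\<close>)
  have mid: "locally_solves c p t" if "t \<in> {a<..<2 * b - a}" for t
    by (rule locally_solves_glue[OF G v _ _ _ _ vb, where e="b - a"]) (use pG refl E that in auto)
  have left: "locally_solves c p a"
  proof -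
    have r: "((\<lambda>s::real. - s) has_vector_derivative -1) (at s)" for s
      by (auto intro!: derivative_eq_intros)
    have "locally_solves c (\<lambda>s. p (- s)) (- a)"
    proof (rule locally_solves_glue[where G="\<lambda>s. G (- s)" and v="\<lambda>s. - v (- s)" and q="\<lambda>s. q (- s)"
          and b="- a" and e="b - a"])
      show "((\<lambda>s. G (- s)) has_vector_derivative - v (- t)) (at t)" for t
        using vector_diff_chain_at[OF r G] by (simp add: o_def)
      show "((\<lambda>s. - v (- s)) has_vector_derivative gradV (q (- t))) (at t)" for t
        using has_vector_derivative_minus[OF vector_diff_chain_at[OF r v]] by (simp add: o_def)
      show "p (- (2 * - a - s)) = p (- s)" if "s \<in> {- a - (b - a)..- a}" for s
      proof -
        have s: "- s \<in> {a..b}" using that by auto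
        \<comment> \<open>Reflection about \<open>a\<close> is reflection about \<open>b\<close>
          followed by a shift by one period.\<close>
        have "p (- (2 * - a - s)) = p (2 * a + s + T)" using per[of "2 * a + s"] by (simp add: T_def add_ac)
        also have "2 * a + s + T = 2 * b - (- s)" by (simp add: T_def)
        also have "p \<dots> = p (- s)" by (rule refl[OF s])
        finally show ?thesis .
      qed
    qed (use ab pG E va in auto)
    from locally_solves_reflect[OF this, of 0] show ?thesis by simp
  qed
  show "locally_solves c p t"
  proof -
    \<comment> \<open>Reduces \<open>t\<close> to a time \<open>s\<close> in
      \<open>{a..<a + T}\<close>. Since \<open>a + T = 2 * b - a\<close>, this is either the point
      \<open>a\<close> or a time covered by \<open>mid\<close>.\<close>
    define n where "n = \<lfloor>(t - a) / T\<rfloor>"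
    define s where "s = t - of_int n * T"
    have "of_int n \<le> (t - a) / T" "(t - a) / T < of_int n + 1" unfolding n_def by linarith+
    then have "of_int n * T \<le> t - a" "t - a < (of_int n + 1) * T" using T by (auto simp: field_simps)
    then have "s = a \<or> s \<in> {a<..<2 * b - a}" by (auto simp: s_def T_def algebra_simps)
    then have "locally_solves c p s" using mid left by blast
    from locally_solves_shift[OF this, of "- of_int n * T"]
    have "locally_solves c (\<lambda>s. p (s + of_int (- n) * T)) t" by (simp add: s_def)
    then show ?thesis unfolding perT .
  qed
  have small: "p (b + t) = p (b - t)" if "\<bar>t\<bar> \<le> b - a" for t
    using refl[of "b - t"] refl[of "b + t"] that by (cases "t \<ge> 0") (auto simp: algebra_simps)
  show "p (b + t) = p (b - t)"
  proof -
    \<comment> \<open>Reduces \<open>t\<close> to one period centred at 0, on which the symmetry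
      about \<open>b\<close> is the prescribed reflection.\<close>
    define n where "n = \<lfloor>(t + (b - a)) / T\<rfloor>"
    define s where "s = t - of_int n * T"
    have "of_int n \<le> (t + (b - a)) / T" "(t + (b - a)) / T < of_int n + 1" unfolding n_def by linarith+
    then have "of_int n * T \<le> t + (b - a)" "t + (b - a) < (of_int n + 1) * T" using T by (auto simp: field_simps)
    then have "\<bar>s\<bar> \<le> b - a" by (auto simp: s_def T_def algebra_simps abs_if)
    then have "p (b + s) = p (b - s)" by (rule small)
    moreover have "p (b + s) = p (b + t)" using perT[of "b + s" n] by (simp add: s_def)
    moreover have "p (b - s) = p (b - t)" using perT[of "b - s" "- n"] by (simp add: s_def)
    ultimately show ?thesis by simp
  qed
qed

end

section \<open>Contact times and the structure of a minimization solution\<close>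

lemma Inf_ereal_in_closed:
  assumes T: "closed T" and S: "S \<subseteq> T" and Inf: "Inf (ereal ` S) = ereal b"
  shows "b \<in> T"
proof (rule ccontr)
  assume "b \<notin> T"
  then obtain e where e: "e > 0" "ball b e \<subseteq> - T"
    using openE[of "- T" b] T by (auto simp: open_Compl)
  have "ereal (b + e) \<le> Inf (ereal ` S)"
  proof (rule Inf_greatest, elim imageE, simp)
    fix t assume t: "t \<in> S"
    have "ereal b \<le> ereal t" unfolding Inf[symmetric] using t by (intro Inf_lower) auto
    moreover have "t \<notin> ball b e" using e t S by blast
    ultimately show "b + e \<le> t" by (auto simp: dist_real_def)
  qed
  then show False using Inf e by simp
qed

lemma Sup_ereal_in_closed:
  assumes T: "closed T" and S: "S \<subseteq> T" and Sup: "Sup (ereal ` S) = ereal b"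
  shows "b \<in> T"
proof (rule ccontr)
  assume "b \<notin> T"
  then obtain e where e: "e > 0" "ball b e \<subseteq> - T"
    using openE[of "- T" b] T by (auto simp: open_Compl)
  have "Sup (ereal ` S) \<le> ereal (b - e)"
  proof (rule Sup_least, elim imageE, simp)
    fix t assume t: "t \<in> S"
    have "ereal t \<le> ereal b" unfolding Sup[symmetric] using t by (intro Sup_upper) auto
    moreover have "t \<notin> ball b e" using e t S by blast
    ultimately show "t \<le> b - e" by (auto simp: dist_real_def)
  qed
  then show False using Sup e by simp
qed

context potential_well
begin

text \<open>The action bound appears in two strengths: by the constant \<open>M\<close>, for
  estimates over long intervals, and by \<open>m_val\<close> itself, because the rescaling argument
  compares with the exact minimum.\<close>

lemma minimizer_on_interval:
  fixes q :: "real \<Rightarrow> 'a"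
  assumes qG: "q \<in> Gamma_set V Vm Vp c" and c: "c > 0"
    and min: "J_fun V c q = m_val V Vm Vp c" and M: "J_fun V c q \<le> ennreal M" "M > 0"
    and I: "open I" "is_interval I" "I \<noteq> {}" and gt: "\<And>t. t \<in> I \<Longrightarrow> V (q t) > c"
  obtains G v E where "\<And>t. (G has_vector_derivative v t) (at t)"
    "\<And>t. (v has_vector_derivative gradV (q t)) (at t)" "\<And>t. t \<in> closure I \<Longrightarrow> q t = G t"
    "\<And>t. t \<in> closure I \<Longrightarrow> (norm (v t))\<^sup>2 / 2 - V (q t) = E"
    "\<And>x y. x \<le> y \<Longrightarrow> {x..y} \<subseteq> closure I \<Longrightarrow>
      integral {x..y} (\<lambda>t. (norm (v t))\<^sup>2 / 2 + (V (q t) - c)) \<le> M"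
    "\<And>x y. x \<le> y \<Longrightarrow> {x..y} \<subseteq> closure I \<Longrightarrow>
      ennreal (integral {x..y} (\<lambda>t. (norm (v t))\<^sup>2 / 2 + (V (q t) - c))) \<le> m_val V Vm Vp c"
    "\<And>x y. x \<le> y \<Longrightarrow> {x..y} \<subseteq> closure I \<Longrightarrow> integral {x..y} (\<lambda>t. V (q t) - c) \<le> M"
proof -
  have cq: "continuous_on UNIV q" and Vq: "\<And>t. V (q t) \<ge> c" using qG by (auto simp: Gamma_set_def H1_loc_def)
  have fin: "J_fun V c q < \<infinity>" using M(1) by (simp add: order_le_less_trans)
  obtain G v where Gv: "\<And>t. (G has_vector_derivative v t) (at t)"
    "\<And>t. (v has_vector_derivative gradV (q t)) (at t)" "\<And>t. t \<in> closure I \<Longrightarrow> q t = G t"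
    "\<And>x y. x \<le> y \<Longrightarrow> {x..y} \<subseteq> closure I \<Longrightarrow>
      ennreal (integral {x..y} (\<lambda>t. (norm (v t))\<^sup>2 / 2 + (V (q t) - c))) \<le> J_fun V c q"
    using minimizer_regularity[OF qG c min fin I gt] by blast
  have "is_interval (closure I)"
    using I(2) by (simp add: is_interval_convex_1 convex_closure)
  then obtain E where E: "\<And>t. t \<in> closure I \<Longrightarrow> (norm (v t))\<^sup>2 / 2 - V (q t) = E"
    using energy_constant[OF Gv(1,2) _ Gv(3)] by blast
  have cv: "continuous_on UNIV v" by (rule has_vector_derivative_continuous_on) (rule Gv)
  have cVq: "continuous_on A (\<lambda>t. V (q t))" for A
    by (rule continuous_on_compose2[OF continuous_V continuous_on_subset[OF cq]]) auto
  have i: "(\<lambda>t. (norm (v t))\<^sup>2 / 2 + (V (q t) - c)) integrable_on {x..y}"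
    "(\<lambda>t. V (q t) - c) integrable_on {x..y}" for x y
    using cVq by (auto intro!: integrable_continuous_interval continuous_intros continuous_on_subset[OF cv])
  have bd: "integral {x..y} (\<lambda>t. (norm (v t))\<^sup>2 / 2 + (V (q t) - c)) \<le> M" if "x \<le> y" "{x..y} \<subseteq> closure I" for x y
    using order_trans[OF Gv(4)[OF that] M(1)] M(2) by (simp add: ennreal_le_iff)
  moreover have "integral {x..y} (\<lambda>t. V (q t) - c) \<le> M" if "x \<le> y" "{x..y} \<subseteq> closure I" for x y
    by (rule order_trans[OF integral_le[OF i(2,1)] bd[OF that]]) simp
  ultimately show ?thesis using that[OF Gv(1,2,3) E] Gv(4) unfolding min by blast
qed

text \<open>Here \<open>b\<close> is the contact time with the outer set. The final alternative
  treats a finite and an infinite inner contact time alike: either the window of length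
  \<open>S\<close> before \<open>b\<close> stays within the minimizing arc, so that its potential
  part is at most \<open>M\<close>, or it reaches back beyond the inner contact time, which is then
  \<open>b - d\<close>.\<close>

lemma minimization_solution_structure:
  fixes c :: real and p :: "real \<Rightarrow> 'a"
  defines "Vm \<equiv> sublevel V c \<inter> ball 0 r0" and "Vp \<equiv> sublevel V c - ball 0 r0"
  assumes c: "0 < c" "\<And>x. x \<in> sphere 0 r0 \<Longrightarrow> c < V x"
    and ns: "\<And>x. V x = c \<Longrightarrow> x \<notin> ball 0 r0 \<Longrightarrow> gradV x \<noteq> 0"
    and M: "m_val V Vm Vp c \<le> ennreal M" "M > 0"
    and ms: "minimization_solution V Vm Vp c p"
  obtains b where "\<And>t. locally_solves c p t" "\<And>t. p (b + t) = p (b - t)"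
    "V (p b) = c" "r0 \<le> norm (p b)"
    "\<And>S. S > 0 \<Longrightarrow> integral {b - S..b} (\<lambda>t. V (p t) - c) \<le> M \<or>
      (\<exists>d. 0 < d \<and> d < S \<and> V (p (b - d)) \<le> c \<and> norm (p (b - d)) < r0)"
proof -
  obtain q where qG: "q \<in> Gamma_set V Vm Vp c" and min: "J_fun V c q = m_val V Vm Vp c"
    and gen: "generates Vm Vp q p"
    using ms by (auto simp: minimization_solution_def M_set_def)
  have cq: "continuous_on UNIV q" and Vq: "\<And>t. V (q t) \<ge> c"
    and lim: "Liminf at_top (\<lambda>t. ereal (infdist (q t) Vp)) = 0"
    using qG by (auto simp: Gamma_set_def H1_loc_def)
  have JM: "J_fun V c q \<le> ennreal M" using M min by simp
  have csub: "closed (sublevel V c)"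
    using closed_vimage[OF closed_atMost continuous_V, of c] by (simp add: sublevel_def vimage_def)
  have closedVp: "closed Vp" unfolding Vp_def by (intro closed_Diff csub) auto
  \<comment> \<open>The sphere contains no point of the sublevel set, so the open ball may be
    replaced by the closed one.\<close>
  have "Vm = sublevel V c \<inter> cball 0 r0"
    using c(2) unfolding Vm_def sublevel_def by (force simp: less_le)
  then have closedVm: "closed Vm" using csub by (simp add: closed_Int)
  have Vple: "V x \<le> c" "r0 \<le> norm x" if "x \<in> Vp" for x using that by (auto simp: Vp_def sublevel_def)
  have Vmle: "V x \<le> c" "norm x < r0" if "x \<in> Vm" for x using that by (auto simp: Vm_def sublevel_def)
  have "Vp \<noteq> {}"
  proof -
    obtain B where B: "B > 0" "\<And>x. V x > 0 \<Longrightarrow> norm x \<le> B" "r0 < B" by (rule level_set_bounded) blast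
    obtain e :: 'a where e: "norm e = 1" using norm_Basis nonempty_Basis by blast
    have "\<not> V ((B + 1) *\<^sub>R e) > 0" using B(2)[of "(B + 1) *\<^sub>R e"] e B(1) by auto
    then have "(B + 1) *\<^sub>R e \<in> Vp" using c(1) e B by (simp add: Vp_def sublevel_def)
    then show ?thesis by blast
  qed
  have nsVp: "gradV x \<noteq> 0" if "x \<in> Vp" "V x = c" for x
    using ns that by (auto simp: Vp_def)
  define I where "I = einterval (alpha_time Vm q) (omega_time Vm Vp q)"
  have "is_interval I"
    unfolding is_interval_1
  proof (intro ballI allI impI)
    fix x y z assume *: "x \<in> I" "y \<in> I" "x \<le> z \<and> z \<le> y"
    then have "ereal x \<le> ereal z" "ereal z \<le> ereal y" by auto
    then show "z \<in> I"
      using * less_le_trans le_less_trans unfolding I_def einterval_iff by blast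
  qed
  then have I: "open I" "is_interval I" by (auto simp: I_def)
  \<comment> \<open>A time with \<open>V (q t) \<le> c\<close> is a visit to one of the two sets. A
    visit to \<open>Vm\<close> happens no later than \<open>alpha_time\<close>, and a visit to
    \<open>Vp\<close> after \<open>alpha_time\<close> no earlier than
    \<open>omega_time\<close>.\<close>
  have gt: "V (q t) > c" if t: "t \<in> I" for t
  proof (rule ccontr)
    assume "\<not> V (q t) > c"
    then have "q t \<in> Vm \<or> q t \<in> Vp" by (auto simp: Vm_def Vp_def sublevel_def)
    then show False
    proof
      assume "q t \<in> Vm"
      then have "ereal t \<le> alpha_time Vm q" unfolding alpha_time_def by (intro Sup_upper) auto
      then show False using t by (auto simp: I_def einterval_iff not_less[symmetric])
    next
      assume "q t \<in> Vp"
      then have "omega_time Vm Vp q \<le> ereal t"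
        unfolding omega_time_def using t by (intro Inf_lower) (auto simp: I_def einterval_iff)
      then show False using t by (auto simp: I_def einterval_iff not_less[symmetric])
    qed
  qed
  \<comment> \<open>A half-line inside \<open>I\<close> means that \<open>omega_time\<close> is
    infinite; this disposes of two of the four cases of \<open>generates\<close>.\<close>
  have no_escape: False if sub: "{t0..} \<subseteq> I" for t0
  proof -
    have Ine: "I \<noteq> {}" using sub by auto
    show False
    proof (rule minimizer_on_interval[OF qG c(1) min JM M(2) I Ine gt])
      fix G v E assume G: "\<And>t. (G has_vector_derivative v t) (at t)"
        "\<And>t. (v has_vector_derivative gradV (q t)) (at t)" "\<And>t. t \<in> closure I \<Longrightarrow> q t = G t"
        and E: "\<And>t. t \<in> closure I \<Longrightarrow> (norm (v t))\<^sup>2 / 2 - V (q t) = E"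
        and bd: "\<And>x y. x \<le> y \<Longrightarrow> {x..y} \<subseteq> closure I \<Longrightarrow>
          integral {x..y} (\<lambda>t. (norm (v t))\<^sup>2 / 2 + (V (q t) - c)) \<le> M"
        and bd2: "\<And>x y. x \<le> y \<Longrightarrow> {x..y} \<subseteq> closure I \<Longrightarrow> integral {x..y} (\<lambda>t. V (q t) - c) \<le> M"
      have sub': "{t0..} \<subseteq> closure I" using sub closure_subset by blast
      have cv: "continuous_on UNIV v" by (rule has_vector_derivative_continuous_on) (rule G)
      have "E = - c"
      proof (rule energy_value_unbounded[OF cv cq Vq E bd])
        show "\<exists>x. {x..x + T} \<subseteq> closure I" for T
          by (rule exI[of _ t0]) (use sub' in auto)
      qed
      have qG': "q t = G t" if "t \<ge> t0" for t using G(3) sub' that by auto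
      show False
      proof (rule escape_impossible[of t0 G v q c M Vp])
        show "(v has_vector_derivative gradV (G t)) (at t)" if "t \<ge> t0" for t
          using G(2)[of t] qG'[OF that] by simp
        show "(norm (v t))\<^sup>2 / 2 = V (G t) - c" if "t \<ge> t0" for t
          using E[of t] \<open>E = - c\<close> sub' that qG'[OF that] by auto
        show "integral {t0..y} (\<lambda>t. V (G t) - c) \<le> M" if "y \<ge> t0" for y
        proof -
          have "integral {t0..y} (\<lambda>t. V (G t) - c) = integral {t0..y} (\<lambda>t. V (q t) - c)"
            by (rule integral_cong) (use qG' in auto)
          then show ?thesis using bd2[OF that] sub' by force
        qed
      qed (use G(1) qG' c(1) Vq lim closedVp \<open>Vp \<noteq> {}\<close> Vple nsVp in auto)
    qed
  qed
  \<comment> \<open>The set whose infimum is \<open>omega_time\<close> carries the strict condition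
    of lying after \<open>alpha_time\<close> and need not be closed. It is contained in the closed
    preimage of \<open>Vp\<close>, and this is enough to place the infimum there.\<close>
  have om: "q b \<in> Vp" if "omega_time Vm Vp q = ereal b" for b
  proof -
    have "b \<in> q -` Vp"
      by (rule Inf_ereal_in_closed[OF _ _ that[unfolded omega_time_def]])
        (use closed_vimage[OF closedVp cq] in auto)
    then show ?thesis by simp
  qed
  have al: "q a \<in> Vm" if "alpha_time Vm q = ereal a" for a
  proof -
    have "a \<in> q -` Vm"
      by (rule Sup_ereal_in_closed[OF _ _ that[unfolded alpha_time_def]])
        (use closed_vimage[OF closedVm cq] in auto)
    then show ?thesis by simp
  qed
  from gen consider "alpha_time Vm q = -\<infinity>" "omega_time Vm Vp q = \<infinity>"
    | b where "alpha_time Vm q = -\<infinity>" "omega_time Vm Vp q = ereal b" "\<forall>t\<le>b. p t = q t \<and> p (2 * b - t) = q t"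
    | a where "alpha_time Vm q = ereal a" "omega_time Vm Vp q = \<infinity>"
    | a b where "alpha_time Vm q = ereal a" "omega_time Vm Vp q = ereal b"
      "\<forall>t\<in>{a..b}. p t = q t \<and> p (2 * b - t) = q t" "\<forall>t. p (t + 2 * (b - a)) = p t"
    unfolding generates_def by blast
  then show ?thesis
  proof cases
    case 1
    then show ?thesis using no_escape[of 0] by (simp add: I_def)
  next
    case 3
    then have "{a + 1..} \<subseteq> I" by (auto simp: I_def)
    then have False by (rule no_escape)
    then show ?thesis ..
  next
    case (2 b)
    then have Ib: "I = {..<b}" "closure I = {..b}" by (auto simp: I_def)
    then have Ine: "I \<noteq> {}" by auto
    show ?thesis
    proof (rule minimizer_on_interval[OF qG c(1) min JM M(2) I Ine gt])
      fix G v E assume G: "\<And>t. (G has_vector_derivative v t) (at t)"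
        "\<And>t. (v has_vector_derivative gradV (q t)) (at t)" "\<And>t. t \<in> closure I \<Longrightarrow> q t = G t"
        and E: "\<And>t. t \<in> closure I \<Longrightarrow> (norm (v t))\<^sup>2 / 2 - V (q t) = E"
        and bd: "\<And>x y. x \<le> y \<Longrightarrow> {x..y} \<subseteq> closure I \<Longrightarrow>
          integral {x..y} (\<lambda>t. (norm (v t))\<^sup>2 / 2 + (V (q t) - c)) \<le> M"
        and bd2: "\<And>x y. x \<le> y \<Longrightarrow> {x..y} \<subseteq> closure I \<Longrightarrow> integral {x..y} (\<lambda>t. V (q t) - c) \<le> M"
      have cv: "continuous_on UNIV v" by (rule has_vector_derivative_continuous_on) (rule G)
      have "E = - c"
      proof (rule energy_value_unbounded[OF cv cq Vq E bd])
        show "\<exists>x. {x..x + T} \<subseteq> closure I" for T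
          by (rule exI[of _ "b - T"]) (auto simp: Ib)
      qed
      then have En: "(norm (v s))\<^sup>2 / 2 = V (q s) - c" if "s \<le> b" for s using E[of s] that Ib by auto
      have qb: "q b \<in> Vp" "V (q b) = c" using om[OF 2(2)] Vple(1)[OF om[OF 2(2)]] Vq[of b] by auto
      have vb: "v b = 0" using En[of b] qb by simp
      have pq: "p s = q s" "p (2 * b - s) = p s" "q s = G s" if "s \<le> b" for s using 2(3) that G(3) Ib by auto
      have sol: "locally_solves c p t" "p (b + t) = p (b - t)" for t
        by (rule reflected_solution[OF G(1,2) _ _ _ _ vb]; use pq En in simp)+
      show ?thesis
      proof (rule that[OF sol])
        show "V (p b) = c" "r0 \<le> norm (p b)" using pq(1)[of b] qb Vple(2) by auto
        fix S :: real assume "S > 0"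
        have "integral {b - S..b} (\<lambda>t. V (p t) - c) = integral {b - S..b} (\<lambda>t. V (q t) - c)"
          by (rule integral_cong) (use pq in auto)
        also have "\<dots> \<le> M" using \<open>S > 0\<close> by (intro bd2) (auto simp: Ib)
        finally show "integral {b - S..b} (\<lambda>t. V (p t) - c) \<le> M \<or>
          (\<exists>d. 0 < d \<and> d < S \<and> V (p (b - d)) \<le> c \<and> norm (p (b - d)) < r0)" by blast
      qed
    qed
  next
    case (4 a b)
    have qa: "q a \<in> Vm" "V (q a) = c" using al[OF 4(1)] Vmle(1)[OF al[OF 4(1)]] Vq[of a] by auto
    have qb: "q b \<in> Vp" "V (q b) = c" using om[OF 4(2)] Vple(1)[OF om[OF 4(2)]] Vq[of b] by auto
    have "ereal a \<le> Inf (ereal ` {t. ereal a < ereal t \<and> q t \<in> Vp})"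
      by (rule Inf_greatest) auto
    then have "a \<le> b" using 4(1,2) by (simp add: omega_time_def)
    moreover have "a \<noteq> b" using qa qb Vmle(2)[of "q a"] Vple(2)[of "q b"] by auto
    ultimately have ab: "a < b" by simp
    have Ib: "I = {a<..<b}" "closure I = {a..b}" using 4(1,2) ab by (auto simp: I_def)
    then have Ine: "I \<noteq> {}" using ab by simp
    show ?thesis
    proof (rule minimizer_on_interval[OF qG c(1) min JM M(2) I Ine gt])
      fix G v E assume G: "\<And>t. (G has_vector_derivative v t) (at t)"
        "\<And>t. (v has_vector_derivative gradV (q t)) (at t)" "\<And>t. t \<in> closure I \<Longrightarrow> q t = G t"
        and E: "\<And>t. t \<in> closure I \<Longrightarrow> (norm (v t))\<^sup>2 / 2 - V (q t) = E"
        and bd: "\<And>x y. x \<le> y \<Longrightarrow> {x..y} \<subseteq> closure I \<Longrightarrow>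
          ennreal (integral {x..y} (\<lambda>t. (norm (v t))\<^sup>2 / 2 + (V (q t) - c))) \<le> m_val V Vm Vp c"
        and bd2: "\<And>x y. x \<le> y \<Longrightarrow> {x..y} \<subseteq> closure I \<Longrightarrow> integral {x..y} (\<lambda>t. V (q t) - c) \<le> M"
      have cv: "continuous_on UNIV v" by (rule has_vector_derivative_continuous_on) (rule G)
      have qG': "q t = G t" if "t \<in> {a..b}" for t using G(3) that Ib by auto
      have "E = - c"
      proof (rule energy_value_bounded[OF ab G(1) cv])
        have "integral {a..b} (\<lambda>t. (norm (v t))\<^sup>2 / 2 + (V (G t) - c)) = integral {a..b} (\<lambda>t. (norm (v t))\<^sup>2 / 2 + (V (q t) - c))"
          by (rule integral_cong) (use qG' in auto)
        then show "ennreal (integral {a..b} (\<lambda>t. (norm (v t))\<^sup>2 / 2 + (V (G t) - c))) \<le> m_val V Vm Vp c"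
          using bd[of a b] ab Ib by simp
        show "c \<le> V (G t)" if "t \<in> {a..b}" for t using Vq[of t] qG'[OF that] by simp
        show "(norm (v t))\<^sup>2 / 2 - V (G t) = E" if "t \<in> {a..b}" for t using E[of t] qG'[OF that] that Ib by simp
      qed (use qa qb qG'[of a] qG'[of b] ab in auto)
      then have En: "(norm (v s))\<^sup>2 / 2 = V (q s) - c" if "s \<in> {a..b}" for s using E[of s] that Ib by auto
      have v0: "v a = 0" "v b = 0" using En[of a] En[of b] qa qb ab by auto
      have pq: "p s = q s" "p (2 * b - s) = p s" "q s = G s" if "s \<in> {a..b}" for s using 4(3) that qG' by auto
      have sol: "locally_solves c p t" "p (b + t) = p (b - t)" for t
        by (rule periodic_solution[OF ab G(1,2) _ _ _ _ _ v0]; use pq En 4(4) in simp)+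
      show ?thesis
      proof (rule that[OF sol])
        show "V (p b) = c" "r0 \<le> norm (p b)" using pq(1)[of b] qb Vple(2) ab by auto
        fix S :: real assume "S > 0"
        show "integral {b - S..b} (\<lambda>t. V (p t) - c) \<le> M \<or>
          (\<exists>d. 0 < d \<and> d < S \<and> V (p (b - d)) \<le> c \<and> norm (p (b - d)) < r0)"
        proof (cases "b - S \<ge> a")
          case True
          have "integral {b - S..b} (\<lambda>t. V (p t) - c) = integral {b - S..b} (\<lambda>t. V (q t) - c)"
            by (rule integral_cong) (use pq True in auto)
          also have "\<dots> \<le> M" using \<open>S > 0\<close> True by (intro bd2) (auto simp: Ib)
          finally show ?thesis by blast
        next
          case False
          then have "0 < b - a \<and> b - a < S \<and> V (p (b - (b - a))) \<le> c \<and> norm (p (b - (b - a))) < r0"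
            using ab pq(1)[of a] Vmle qa by auto
          then show ?thesis by blast
        qed
      qed
    qed
  qed
qed

end

section \<open>Passage to the limit\<close>

lemma DERIV_norm_square:
  assumes "(f has_vector_derivative f') (at t)"
  shows "((\<lambda>t. (norm (f t))\<^sup>2) has_real_derivative 2 * (f t \<bullet> f')) (at t)"
  using bounded_bilinear.has_vector_derivative[OF bounded_bilinear_inner assms assms]
  by (simp add: has_real_derivative_iff_has_vector_derivative power2_norm_eq_inner inner_commute)

text \<open>Gronwall's inequality in both time directions: \<open>u t * exp (- K * t)\<close> is
  nonincreasing and \<open>u t * exp (K * t)\<close> is nondecreasing.\<close>

lemma exponential_growth_bound:
  fixes u :: "real \<Rightarrow> real"
  assumes u: "\<And>t. (u has_real_derivative u' t) (at t)" and K: "\<And>t. \<bar>u' t\<bar> \<le> K * u t"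
  shows "u t \<le> u s * exp (K * \<bar>t - s\<bar>)"
proof (cases "s \<le> t")
  case True
  have "u t * exp (- K * t) \<le> u s * exp (- K * s)"
  proof (rule DERIV_nonpos_imp_nonincreasing[OF True])
    fix x
    have "((\<lambda>t. u t * exp (- K * t)) has_real_derivative (u' x - K * u x) * exp (- K * x)) (at x)"
      by (auto intro!: derivative_eq_intros u simp: algebra_simps)
    moreover have "(u' x - K * u x) * exp (- K * x) \<le> 0"
      using K[of x] by (intro mult_nonpos_nonneg) auto
    ultimately show "\<exists>y. ((\<lambda>t. u t * exp (- K * t)) has_real_derivative y) (at x) \<and> y \<le> 0" by blast
  qed
  then have "u t * exp (- K * t) * exp (K * t) \<le> u s * exp (- K * s) * exp (K * t)"
    by (intro mult_right_mono) auto
  then show ?thesis using True by (simp add: mult.assoc exp_add[symmetric] algebra_simps)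
next
  case False
  have "u t * exp (K * t) \<le> u s * exp (K * s)"
  proof (rule DERIV_nonneg_imp_nondecreasing[of t s])
    fix x
    have "((\<lambda>t. u t * exp (K * t)) has_real_derivative (u' x + K * u x) * exp (K * x)) (at x)"
      by (auto intro!: derivative_eq_intros u simp: algebra_simps)
    moreover have "(u' x + K * u x) * exp (K * x) \<ge> 0"
      using K[of x] by (intro mult_nonneg_nonneg) auto
    ultimately show "\<exists>y. ((\<lambda>t. u t * exp (K * t)) has_real_derivative y) (at x) \<and> y \<ge> 0" by blast
  qed (use False in auto)
  then have "u t * exp (K * t) * exp (- K * t) \<le> u s * exp (K * s) * exp (- K * t)"
    by (intro mult_right_mono) auto
  then show ?thesis using False by (simp add: mult.assoc exp_add[symmetric] algebra_simps)
qed

lemma has_vector_derivative_limit: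
  fixes f :: "nat \<Rightarrow> real \<Rightarrow> 'a::banach"
  assumes f: "\<And>n t. (f n has_vector_derivative f' n t) (at t)"
    and lim: "\<And>t. (\<lambda>n. f n t) \<longlonglongrightarrow> g t"
    and unif: "\<And>R. uniform_limit {-R..R} f' g' sequentially"
  shows "(g has_vector_derivative g' t) (at t)"
proof -
  define R where "R = \<bar>t\<bar> + 1"
  have "\<exists>h. \<forall>x\<in>{-R<..<R}. (\<lambda>n. f n x) \<longlonglongrightarrow> h x \<and> (h has_derivative (\<lambda>s. s *\<^sub>R g' x)) (at x within {-R<..<R})"
  proof (rule has_derivative_sequence[where f'="\<lambda>n x s. s *\<^sub>R f' n x" and ?x0.0=0])
    show "(f n has_derivative (\<lambda>s. s *\<^sub>R f' n x)) (at x within {-R<..<R})" for n x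
      using f[of n x] by (simp add: has_vector_derivative_def has_derivative_at_withinI)
    fix e :: real assume "e > 0"
    with unif[of R] have "\<forall>\<^sub>F n in sequentially. \<forall>x\<in>{-R..R}. dist (f' n x) (g' x) < e"
      by (auto simp: uniform_limit_iff)
    then show "\<forall>\<^sub>F n in sequentially. \<forall>x\<in>{-R<..<R}. \<forall>h. norm (h *\<^sub>R f' n x - h *\<^sub>R g' x) \<le> e * norm h"
    proof eventually_elim
      case (elim n)
      show ?case
      proof (intro ballI allI)
        fix x h :: real assume "x \<in> {-R<..<R}"
        then have "x \<in> {-R..R}" by auto
        with elim have "dist (f' n x) (g' x) < e" by blast
        then have "norm (f' n x - g' x) \<le> e" by (simp add: dist_norm)
        then show "norm (h *\<^sub>R f' n x - h *\<^sub>R g' x) \<le> e * norm h"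
          by (simp add: scaleR_diff_right[symmetric] mult.commute[of e] mult_left_mono)
      qed
    qed
  qed (use lim in \<open>auto simp: R_def\<close>)
  then obtain h where "\<forall>x\<in>{-R<..<R}. (\<lambda>n. f n x) \<longlonglongrightarrow> h x \<and> (h has_derivative (\<lambda>s. s *\<^sub>R g' x)) (at x within {-R<..<R})"
    by (elim exE)
  then have h: "(\<lambda>n. f n x) \<longlonglongrightarrow> h x" "(h has_derivative (\<lambda>s. s *\<^sub>R g' x)) (at x within {-R<..<R})"
    if "x \<in> {-R<..<R}" for x using that by simp_all
  have t: "t \<in> {-R<..<R}" by (auto simp: R_def)
  have "(h has_vector_derivative g' t) (at t within {-R<..<R})"
    unfolding has_vector_derivative_def by (rule h(2)[OF t])
  then have "(h has_vector_derivative g' t) (at t)"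
    unfolding at_within_open[OF t open_greaterThanLessThan] .
  then show ?thesis
  proof (rule has_vector_derivative_transform_within_open[OF _ _ t])
    show "h x = g x" if "x \<in> {-R<..<R}" for x using LIMSEQ_unique[OF h(1)[OF that] lim] .
  qed simp
qed

lemma C2_if_derivatives:
  assumes "\<And>t. (p has_vector_derivative v t) (at t)" "\<And>t. (v has_vector_derivative a t) (at t)" "continuous_on UNIV a"
  shows "C2 p" "vderiv p = v" "vderiv v = a"
proof -
  show vd: "vderiv p = v" "vderiv v = a" using assms by (auto intro: vector_derivative_at)
  have "continuous_on UNIV v" by (rule has_vector_derivative_continuous_on) (rule assms)
  then show "C2 p" unfolding C2_def vd C1_differentiable_on_def using assms by blast
qed

section \<open>Comparison of solutions, level sets near zero, and the limiting orbit\<close>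

context potential_well
begin

text \<open>0 is a local minimum, so the constant curve 0 is a solution with which others can be
  compared.\<close>

lemma gradV_0: "gradV 0 = 0"
proof -
  have "(\<lambda>h. h \<bullet> gradV 0) = (\<lambda>h. 0)"
  proof (rule differential_zero_maxmin[where x=0 and S="ball 0 r0" and f=V])
    show "(V has_derivative (\<lambda>h. h \<bullet> gradV 0)) (at 0)" by (rule V_has_derivative)
    have "V 0 \<le> V y" if "y \<in> ball 0 r0" for y
      using V_pos[of y] that V_0 r0 by (cases "y = 0") (auto intro: less_imp_le)
    then show "(\<forall>y\<in>ball 0 r0. V y \<le> V 0) \<or> (\<forall>y\<in>ball 0 r0. V 0 \<le> V y)" by blast
  qed (use r0 in auto)
  then show ?thesis by (metis inner_eq_zero_iff)
qed

text \<open>The squared distance in phase space has derivative at most \<open>1 + L\<close> times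
  itself. This single estimate yields convergence of the translated solutions, the comparison with
  the equilibrium, and the uniqueness behind the reflection symmetry at a rest point.\<close>

lemma gronwall:
  assumes L: "L \<ge> 0" "\<And>x y. x \<in> cball 0 B \<Longrightarrow> y \<in> cball 0 B \<Longrightarrow> norm (gradV x - gradV y) \<le> L * norm (x - y)"
    and p: "\<And>t. (p has_vector_derivative v t) (at t)" "\<And>t. (v has_vector_derivative gradV (p t)) (at t)"
      "\<And>t. norm (p t) \<le> B"
    and q: "\<And>t. (q has_vector_derivative w t) (at t)" "\<And>t. (w has_vector_derivative gradV (q t)) (at t)"
      "\<And>t. norm (q t) \<le> B"
  shows "(norm (p t - q t))\<^sup>2 + (norm (v t - w t))\<^sup>2
    \<le> ((norm (p s - q s))\<^sup>2 + (norm (v s - w s))\<^sup>2) * exp ((1 + L) * \<bar>t - s\<bar>)"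
proof (rule exponential_growth_bound)
  fix t
  define d e g where "d = p t - q t" and "e = v t - w t" and "g = gradV (p t) - gradV (q t)"
  have "((\<lambda>t. p t - q t) has_vector_derivative e) (at t)" "((\<lambda>t. v t - w t) has_vector_derivative g) (at t)"
    unfolding e_def g_def by (intro has_vector_derivative_diff p q)+
  from DERIV_add[OF this[THEN DERIV_norm_square]]
  show "((\<lambda>t. (norm (p t - q t))\<^sup>2 + (norm (v t - w t))\<^sup>2) has_real_derivative
      2 * ((p t - q t) \<bullet> (v t - w t)) + 2 * ((v t - w t) \<bullet> (gradV (p t) - gradV (q t)))) (at t)"
    by (simp add: e_def g_def)
  have g: "norm g \<le> L * norm d" unfolding g_def d_def using p q by (intro L) auto
  have "\<bar>d \<bullet> e\<bar> \<le> norm d * norm e" by (rule Cauchy_Schwarz_ineq2)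
  moreover have "\<bar>e \<bullet> g\<bar> \<le> norm e * (L * norm d)"
    by (rule order_trans[OF Cauchy_Schwarz_ineq2 mult_left_mono[OF g norm_ge_zero]])
  ultimately have "\<bar>2 * (d \<bullet> e) + 2 * (e \<bullet> g)\<bar> \<le> (1 + L) * (2 * (norm d * norm e))"
    by (simp add: algebra_simps)
  also have "\<dots> \<le> (1 + L) * ((norm d)\<^sup>2 + (norm e)\<^sup>2)"
    using sum_squares_bound[of "norm d" "norm e"] L(1) by (intro mult_left_mono) auto
  finally show "\<bar>2 * ((p t - q t) \<bullet> (v t - w t)) + 2 * ((v t - w t) \<bullet> (gradV (p t) - gradV (q t)))\<bar>
    \<le> (1 + L) * ((norm (p t - q t))\<^sup>2 + (norm (v t - w t))\<^sup>2)"
    by (simp add: d_def e_def g_def)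
qed

lemma frontier_C0I:
  assumes "x \<in> closure (C0_set V)" "V x = 0" "x \<noteq> 0"
  shows "x \<in> frontier (C0_set V)"
  using assms interior_subset[of "C0_set V"] by (auto simp: frontier_def C0_set_def)

lemma tendsto_V: "(f \<longlongrightarrow> x) F \<Longrightarrow> ((\<lambda>t. V (f t)) \<longlongrightarrow> V x) F"
  using continuous_V[of UNIV] by (intro isCont_tendsto_compose[of x V]) (auto simp: continuous_on_eq_continuous_at)

lemma tendsto_gradV: "(f \<longlongrightarrow> x) F \<Longrightarrow> ((\<lambda>t. gradV (f t)) \<longlongrightarrow> gradV x) F"
  using cont_grad by (intro isCont_tendsto_compose[of x gradV]) (auto simp: continuous_on_eq_continuous_at)

text \<open>Otherwise critical points outside the ball, with values tending to 0 from above, would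
  accumulate. The limit would be critical with value 0 and different from 0, hence a frontier point
  of \<open>C0_set V\<close> where the gradient vanishes.\<close>

lemma outer_level_sets_regular:
  obtains c0 where "c0 > 0" "\<And>c x. 0 < c \<Longrightarrow> c < c0 \<Longrightarrow> V x = c \<Longrightarrow> x \<notin> ball 0 r0 \<Longrightarrow> gradV x \<noteq> 0"
proof -
  have "\<exists>c0>0. \<forall>c x. 0 < c \<longrightarrow> c < c0 \<longrightarrow> V x = c \<longrightarrow> x \<notin> ball 0 r0 \<longrightarrow> gradV x \<noteq> 0"
  proof (rule ccontr)
    assume neg: "\<not> ?thesis"
    obtain B where B: "\<And>x. V x > 0 \<Longrightarrow> norm x \<le> B" by (rule level_set_bounded) blast
    have "\<exists>x. 0 < V x \<and> V x < 1 / real (Suc n) \<and> r0 \<le> norm x \<and> gradV x = 0" for n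
    proof -
      have "1 / real (Suc n) > 0" by simp
      with neg show ?thesis by (force simp: not_less)
    qed
    then obtain x where x: "\<And>n. 0 < V (x n)" "\<And>n. V (x n) < 1 / real (Suc n)" "\<And>n. r0 \<le> norm (x n)"
      "\<And>n. gradV (x n) = 0" by metis
    have "bounded (range x)" using B x(1) by (auto simp: bounded_iff)
    then obtain y r where r: "strict_mono r" "(x \<circ> r) \<longlonglongrightarrow> y"
      using bounded_imp_convergent_subsequence by blast
    have "(\<lambda>n. V ((x \<circ> r) n)) \<longlonglongrightarrow> V y" by (rule tendsto_V[OF r(2)])
    moreover have "(\<lambda>n. V ((x \<circ> r) n)) \<longlonglongrightarrow> 0"
    proof (rule Lim_null_comparison)
      have "(\<lambda>n. 1 / real (Suc n)) \<longlonglongrightarrow> 0" using LIMSEQ_inverse_real_of_nat by (simp add: inverse_eq_divide)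
      from LIMSEQ_subseq_LIMSEQ[OF this r(1)] show "(\<lambda>n. 1 / real (Suc (r n))) \<longlonglongrightarrow> 0" by (simp add: o_def)
      show "\<forall>\<^sub>F n in sequentially. norm (V ((x \<circ> r) n)) \<le> 1 / real (Suc (r n))"
        using x(1,2) by (intro always_eventually allI) (simp add: less_imp_le del: of_nat_Suc)
    qed
    ultimately have "V y = 0" using LIMSEQ_unique by blast
    moreover have "(\<lambda>n. gradV ((x \<circ> r) n)) \<longlonglongrightarrow> gradV y" by (rule tendsto_gradV[OF r(2)])
    then have "gradV y = 0" using x(4) by (simp add: LIMSEQ_const_iff)
    moreover have "r0 \<le> norm y"
      using x(3) by (intro LIMSEQ_le_const[OF tendsto_norm[OF r(2)]]) auto
    moreover have "y \<in> closure (C0_set V)"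
      unfolding closure_sequential using r(2) x(1) by (intro exI[of _ "x \<circ> r"]) (auto simp: C0_set_def)
    ultimately show False using grad_frontier[OF frontier_C0I] r0 by force
  qed
  then show ?thesis using that by blast
qed

text \<open>On the compact shell between the radii \<open>\<eta>\<close> and \<open>r0\<close> the
  minimum of \<open>V\<close> is positive, and half of it serves as \<open>c0\<close>. The separate
  case is an empty shell.\<close>

lemma inner_sublevel_small:
  assumes "\<eta> > 0"
  obtains c0 where "c0 > 0" "\<And>y. V y \<le> c0 \<Longrightarrow> norm y < r0 \<Longrightarrow> norm y < \<eta>"
proof (cases "cball 0 r0 - ball 0 \<eta> = ({} :: 'a set)")
  case True
  have "norm y < \<eta>" if "norm y < r0" for y :: 'a
  proof -
    have "y \<in> cball 0 r0" using that by simp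
    with True have "y \<in> ball 0 \<eta>" by blast
    then show ?thesis by simp
  qed
  then show ?thesis by (intro that[of 1]) auto
next
  case False
  have "compact (cball 0 r0 - ball 0 \<eta> :: 'a set)" by (intro compact_diff) auto
  then obtain x where x: "x \<in> cball 0 r0 - ball 0 \<eta>" "\<And>y. y \<in> cball 0 r0 - ball 0 \<eta> \<Longrightarrow> V x \<le> V y"
    using continuous_attains_inf[OF _ False continuous_V] by blast
  have "V x > 0" using x(1) r0 assms by (intro V_pos) auto
  show ?thesis
  proof (rule that[of "V x / 2"])
    fix y assume y: "V y \<le> V x / 2" "norm y < r0"
    show "norm y < \<eta>"
    proof (rule ccontr)
      assume "\<not> norm y < \<eta>"
      then have "V x \<le> V y" using y by (intro x(2)) auto
      then show False using y \<open>V x > 0\<close> by linarith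
    qed
  qed (use \<open>V x > 0\<close> in auto)
qed

text \<open>Time 0 is the turning point, so \<sigma> is 0. Membership of the orbit in the closure of
  \<open>C0_set V\<close> is what makes a nonzero limit point with \<open>V\<close> equal to 0 a
  frontier point, and evenness transfers everything proved at \<open>at_top\<close> to
  \<open>at_bot\<close>.\<close>

lemma homoclinic_limit:
  assumes L: "L \<ge> 0" "\<And>x y. x \<in> cball 0 B \<Longrightarrow> y \<in> cball 0 B \<Longrightarrow> norm (gradV x - gradV y) \<le> L * norm (x - y)"
    and p: "\<And>t. (p has_vector_derivative v t) (at t)" "\<And>t. (v has_vector_derivative gradV (p t)) (at t)"
      "\<And>t. norm (p t) \<le> B" "\<And>t. p t \<in> closure (C0_set V)"
    and E: "\<And>t. (norm (v t))\<^sup>2 / 2 = V (p t)"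
    and sym: "\<And>t. p (- t) = p t"
    and init: "V (p 0) = 0" "p 0 \<noteq> 0"
    and M: "\<And>S. S > 0 \<Longrightarrow> integral {-S..0} (\<lambda>t. V (p t)) \<le> M"
  shows "homoclinic_type V gradV p"
proof -
  have cp: "continuous_on UNIV p" by (rule has_vector_derivative_continuous_on) (rule p)
  have c2: "C2 p" "vderiv p = v" "vderiv v = (\<lambda>t. gradV (p t))"
    by (rule C2_if_derivatives[OF p(1,2)]; rule continuous_on_compose2[OF cont_grad cp]; simp)+
  have V0: "V (p t) \<ge> 0" for t using E[of t] by (metis divide_nonneg_pos zero_le_power2 zero_less_numeral)
  \<comment> \<open>The hypothesis bounds integrals before time 0 and for \<open>S > 0\<close> only;
    evenness carries it to later times, and \<open>max M 0\<close> covers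
    \<open>y = 0\<close>.\<close>
  have M': "integral {0..y} (\<lambda>t. V (p t) - 0) \<le> max M 0" if "y \<ge> 0" for y
  proof (cases "y = 0")
    case False
    have "integral {0..y} (\<lambda>t. V (p t)) = integral {-y..-0} (\<lambda>t. V (p (- t)))"
      by (rule Henstock_Kurzweil_Integration.integral_reflect_real[symmetric])
    then show ?thesis using M[of y] that False by (simp add: sym)
  qed auto
  have v0: "(v \<longlongrightarrow> 0) at_top" and Vlim: "((\<lambda>t. V (p t)) \<longlongrightarrow> 0) at_top"
    using decay_at_top[of 0 p v B 0 "max M 0"] p E M' by auto
  have p0: "(p \<longlongrightarrow> 0) at_top"
  proof (rule ccontr)
    assume "\<not> (p \<longlongrightarrow> 0) at_top"
    then obtain e where e: "e > 0" "\<not> (\<forall>\<^sub>F t in at_top. norm (p t) < e)" by (auto simp: tendsto_iff)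
    have "\<exists>t\<ge>real n. e \<le> norm (p t)" for n
      using e(2) unfolding eventually_at_top_linorder by (meson not_less)
    then obtain X where X: "\<And>n. X n \<ge> real n" "\<And>n. e \<le> norm (p (X n))" by metis
    have "bounded (range (\<lambda>n. p (X n)))" using p(3) by (auto simp: bounded_iff)
    then obtain x r where r: "strict_mono r" "((\<lambda>n. p (X n)) \<circ> r) \<longlonglongrightarrow> x"
      using bounded_imp_convergent_subsequence by blast
    then have px: "(\<lambda>n. p (X (r n))) \<longlonglongrightarrow> x" by (simp add: o_def)
    have Xr: "filterlim (\<lambda>n. X (r n)) at_top sequentially"
    proof (rule filterlim_at_top_mono[OF filterlim_real_sequentially])
      show "\<forall>\<^sub>F n in sequentially. real n \<le> X (r n)"
        using X(1) seq_suble[OF r(1)] by (intro always_eventually allI) (meson of_nat_mono order_trans)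
    qed
    have "V x = 0" using LIMSEQ_unique[OF tendsto_V[OF px] filterlim_compose[OF Vlim Xr]] .
    moreover have "e \<le> norm x" using X(2) by (intro LIMSEQ_le_const[OF tendsto_norm[OF px]]) auto
    moreover have "x \<in> closure (C0_set V)"
      by (rule closed_sequentially[OF closed_closure _ px]) (rule p(4))
    ultimately have "x \<in> frontier (C0_set V)" using e by (intro frontier_C0I) auto
    moreover have "gradV x = 0" by (rule limit_point_critical[OF p(1,2) v0 Xr px])
    ultimately show False using grad_frontier by blast
  qed
  have vsym: "v (- t) = - v t" for t
  proof -
    have r: "((\<lambda>s::real. - s) has_vector_derivative -1) (at s)" for s
      by (auto intro!: derivative_eq_intros)
    have "((\<lambda>s. p (- s)) has_vector_derivative - v (- t)) (at t)"
      using vector_diff_chain_at[OF r p(1)] by (simp add: o_def)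
    then have "(p has_vector_derivative - v (- t)) (at t)" by (simp add: sym)
    with p(1) have "v t = - v (- t)" by (rule vector_derivative_unique_at)
    then show ?thesis by simp
  qed
  have bot: "(p \<longlongrightarrow> 0) at_bot" "(v \<longlongrightarrow> 0) at_bot"
    using p0 v0 tendsto_minus[OF v0] by (auto simp: filterlim_at_bot_mirror sym vsym)
  have pos: "V (p t) > 0" if t: "t \<noteq> 0" for t
  proof (rule ccontr)
    assume "\<not> V (p t) > 0"
    then have "V (p t) = 0" using V0[of t] by simp
    then have vt: "v t = 0" using E[of t] by simp
    \<comment> \<open>Both \<open>p (t + s)\<close> and \<open>p (t - s)\<close> solve the equation
      in \<open>s\<close>, with the same position and, because \<open>v t = 0\<close>, the same
      velocity at \<open>s = 0\<close>.\<close>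
    have refl: "p (t + s) = p (t - s)" for s
    proof -
      have r: "((\<lambda>s. t - s) has_vector_derivative -1) (at s)" for s
        by (auto intro!: derivative_eq_intros)
      have f: "((\<lambda>s. t + s) has_vector_derivative 1) (at s)" for s
        by (auto intro!: derivative_eq_intros)
      have "(norm (p (t + s) - p (t - s)))\<^sup>2 + (norm (v (t + s) - - v (t - s)))\<^sup>2
        \<le> ((norm (p (t + 0) - p (t - 0)))\<^sup>2 + (norm (v (t + 0) - - v (t - 0)))\<^sup>2) * exp ((1 + L) * \<bar>s - 0\<bar>)"
      proof (rule gronwall[OF L])
        show "((\<lambda>s. p (t + s)) has_vector_derivative v (t + s)) (at s)" for s
          using vector_diff_chain_at[OF f p(1)] by (simp add: o_def)
        show "((\<lambda>s. v (t + s)) has_vector_derivative gradV (p (t + s))) (at s)" for s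
          using vector_diff_chain_at[OF f p(2)] by (simp add: o_def)
        show "((\<lambda>s. p (t - s)) has_vector_derivative - v (t - s)) (at s)" for s
          using vector_diff_chain_at[OF r p(1)] by (simp add: o_def)
        show "((\<lambda>s. - v (t - s)) has_vector_derivative gradV (p (t - s))) (at s)" for s
          using has_vector_derivative_minus[OF vector_diff_chain_at[OF r p(2)]] by (simp add: o_def)
      qed (use p(3) in auto)
      then show ?thesis using vt by (simp add: sum_power2_le_zero_iff)
    qed
    \<comment> \<open>The reflections about 0 and about \<open>t\<close> compose to the translation
      by \<open>2 * t\<close>. So the orbit returns to \<open>p 0\<close> at arbitrarily late times,
      against its decay.\<close>
    have per: "p (2 * real n * t) = p 0" for n
    proof (induction n)
      case (Suc n)
      have "p (2 * real (Suc n) * t) = p (t + (2 * real n + 1) * t)" by (simp add: algebra_simps)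
      also have "\<dots> = p (t - (2 * real n + 1) * t)" by (rule refl)
      also have "\<dots> = p (- (2 * real n * t))" by (simp add: algebra_simps)
      finally show ?case using Suc by (simp add: sym)
    qed simp
    have "p (2 * real n * \<bar>t\<bar>) = p 0" for n
      using per[of n] sym[of "2 * real n * t"] by (cases "t \<ge> 0") auto
    moreover have "filterlim (\<lambda>n. 2 * real n * \<bar>t\<bar>) at_top sequentially"
    proof -
      have "filterlim (\<lambda>n. (2 * \<bar>t\<bar>) * real n) at_top sequentially"
        using t by (intro filterlim_tendsto_pos_mult_at_top[OF tendsto_const] filterlim_real_sequentially) auto
      then show ?thesis by (simp add: mult_ac)
    qed
    then have "(\<lambda>n. p (2 * real n * \<bar>t\<bar>)) \<longlonglongrightarrow> 0" by (rule filterlim_compose[OF p0])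
    ultimately have "p 0 = 0" by (simp add: LIMSEQ_const_iff)
    with init show False by simp
  qed
  have fr: "p 0 \<in> frontier (C0_set V)" using p(4) init by (intro frontier_C0I) auto
  have "v 0 = 0" using E[of 0] init by simp
  then show ?thesis
    unfolding homoclinic_type_def solution_def c2
    using c2(1) bot p0 v0 fr grad_frontier[OF fr] pos sym
    by (intro conjI exI[of _ 0]) (auto simp: vector_derivative_at[OF p(1)] vector_derivative_at[OF p(2)])
qed

end

section \<open>Compactness and convergence of the translated solutions\<close>

context potential_well
begin

theorem minimization_solutions_converge:
  fixes c :: "nat \<Rightarrow> real" and q :: "nat \<Rightarrow> real \<Rightarrow> 'a"
  assumes c_range: "\<And>n. 0 < c n \<and> c n < (INF x \<in> sphere 0 r0. V x)"
    and c_lim: "c \<longlonglongrightarrow> 0"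
    and q_min: "\<And>n. minimization_solution V
                  (sublevel V (c n) \<inter> ball 0 r0) (sublevel V (c n) - ball 0 r0) (c n) (q n)"
  shows "\<exists>s \<tau> q0. strict_mono s \<and> C2_loc_converges (\<lambda>k t. q (s k) (t - \<tau> k)) q0 \<and> homoclinic_type V gradV q0"
proof -
  have c_sphere: "c n < V x" if "x \<in> sphere 0 r0" for n x
  proof -
    have "compact (V ` sphere 0 r0)" by (intro compact_continuous_image continuous_V) auto
    then have "bdd_below (V ` sphere 0 r0)" by (intro bounded_imp_bdd_below compact_imp_bounded)
    then have "(INF x \<in> sphere 0 r0. V x) \<le> V x" using that by (rule cINF_lower)
    then show ?thesis using c_range[of n] by linarith
  qed
  obtain B where B: "\<And>x. V x > 0 \<Longrightarrow> norm x \<le> B" by (rule level_set_bounded) blast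
  obtain L where L: "L \<ge> 0" "\<And>x y. x \<in> cball 0 B \<Longrightarrow> y \<in> cball 0 B \<Longrightarrow> norm (gradV x - gradV y) \<le> L * norm (x - y)"
    using lipschitz_cball[of B] by blast
  obtain M where M: "M > 0" "\<And>c. 0 < c \<Longrightarrow> (\<And>x. x \<in> sphere 0 r0 \<Longrightarrow> c < V x) \<Longrightarrow>
    m_val V (sublevel V c \<inter> ball 0 r0) (sublevel V c - ball 0 r0) c \<le> ennreal M"
    by (rule m_val_bounded) blast
  obtain c0 where c0: "c0 > 0" "\<And>c x. 0 < c \<Longrightarrow> c < c0 \<Longrightarrow> V x = c \<Longrightarrow> x \<notin> ball 0 r0 \<Longrightarrow> gradV x \<noteq> 0"
    by (rule outer_level_sets_regular) blast
  obtain N where N: "\<And>n. n \<ge> N \<Longrightarrow> c n < c0"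
    using order_tendstoD(2)[OF c_lim c0(1)] by (auto simp: eventually_sequentially)
  \<comment> \<open>Regularity of the outer level sets holds only for levels below
    \<open>c0\<close>, so the sequence is started at \<open>N\<close>; the shift is absorbed into
    the subsequence at the end.\<close>
  have "\<exists>b. (\<forall>t. locally_solves (c (n + N)) (q (n + N)) t) \<and> (\<forall>t. q (n + N) (b + t) = q (n + N) (b - t)) \<and>
      V (q (n + N) b) = c (n + N) \<and> r0 \<le> norm (q (n + N) b) \<and>
      (\<forall>S>0. integral {b - S..b} (\<lambda>t. V (q (n + N) t) - c (n + N)) \<le> M \<or>
        (\<exists>d. 0 < d \<and> d < S \<and> V (q (n + N) (b - d)) \<le> c (n + N) \<and> norm (q (n + N) (b - d)) < r0))" for n
  proof (rule minimization_solution_structure[of "c (n + N)" M "q (n + N)"])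
    show "m_val V (sublevel V (c (n + N)) \<inter> ball 0 r0) (sublevel V (c (n + N)) - ball 0 r0) (c (n + N)) \<le> ennreal M"
      using c_range c_sphere by (intro M) auto
    show "gradV x \<noteq> 0" if "V x = c (n + N)" "x \<notin> ball 0 r0" for x
      using c0(2)[OF _ N that] c_range by auto
  qed (use c_range c_sphere M q_min in auto)
  then obtain b where b: "\<And>n t. locally_solves (c (n + N)) (q (n + N)) t"
    "\<And>n t. q (n + N) (b n + t) = q (n + N) (b n - t)"
    "\<And>n. V (q (n + N) (b n)) = c (n + N)" "\<And>n. r0 \<le> norm (q (n + N) (b n))"
    "\<And>n S. S > 0 \<Longrightarrow> integral {b n - S..b n} (\<lambda>t. V (q (n + N) t) - c (n + N)) \<le> M \<or>
        (\<exists>d. 0 < d \<and> d < S \<and> V (q (n + N) (b n - d)) \<le> c (n + N) \<and> norm (q (n + N) (b n - d)) < r0)"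
    by metis
  define C where "C n = c (n + N)" for n
  define p where "p n t = q (n + N) (t + b n)" for n t
  define v where "v n = vderiv (p n)" for n
  have C0: "C n > 0" for n using c_range by (simp add: C_def)
  have Clim: "C \<longlonglongrightarrow> 0" unfolding C_def using c_lim by (rule LIMSEQ_ignore_initial_segment)
  have loc: "locally_solves (C n) (p n) t" for n t
    using locally_solves_shift[OF b(1)[of n "t + b n"], of "b n"] by (simp add: p_def[abs_def] C_def)
  have p: "(p n has_vector_derivative v n t) (at t)" "(v n has_vector_derivative gradV (p n t)) (at t)"
    and E: "(norm (v n t))\<^sup>2 / 2 = V (p n t) - C n" for n t
    unfolding v_def by (rule locally_solves_everywhere[OF loc])+
  have Vge: "V (p n t) \<ge> C n" for n t
    using E[of n t] zero_le_power2[of "norm (v n t)"] by linarith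
  have pB: "norm (p n t) \<le> B" for n t by (rule B) (use Vge[of n t] C0[of n] in linarith)
  have sym: "p n (- t) = p n t" for n t using b(2)[of n t] by (simp add: p_def add.commute)
  have init: "V (p n 0) = C n" "r0 \<le> norm (p n 0)" for n using b(3,4)[of n] by (simp_all add: p_def C_def)
  have v0: "v n 0 = 0" for n using E[of n 0] init by simp
  have alt: "integral {-S..0} (\<lambda>t. V (p n t) - C n) \<le> M \<or>
      (\<exists>d. 0 < d \<and> d < S \<and> V (p n (- d)) \<le> C n \<and> norm (p n (- d)) < r0)" if "S > 0" for n S
  proof -
    have "integral {-S..0} ((\<lambda>t. V (q (n + N) t) - c (n + N)) \<circ> (+) (b n))
      = integral {- S + b n..0 + b n} (\<lambda>t. V (q (n + N) t) - c (n + N))"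
      by (rule integral_shift_Icc_real)
    then show ?thesis using b(5)[OF that, of n] by (simp add: p_def C_def o_def add.commute)
  qed
  define K where "K t = exp ((1 + L) * \<bar>t\<bar>)" for t
  have K1: "K t \<ge> 1" for t using L(1) by (simp add: K_def)
  have bound: "\<forall>\<^sub>F n in sequentially. integral {-S..0} (\<lambda>t. V (p n t) - C n) \<le> M" if S: "S > 0" for S
  proof -
    \<comment> \<open>If the inner contact point were reached within time \<open>S\<close>, the
      curve would rest there at a point of norm below \<open>\<eta>\<close>. Comparison with the
      solution 0 would give \<open>r0\<^sup>2 \<le> \<eta>\<^sup>2 * K S = r0 * \<eta>\<close>,
      although \<open>\<eta> < r0\<close> because \<open>K S > 1\<close>.\<close>
    define \<eta> where "\<eta> = r0 / K S"
    have \<eta>: "\<eta> > 0" using r0 K1[of S] by (simp add: \<eta>_def)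
    obtain c1 where c1: "c1 > 0" "\<And>y. V y \<le> c1 \<Longrightarrow> norm y < r0 \<Longrightarrow> norm y < \<eta>"
      by (rule inner_sublevel_small[OF \<eta>]) blast
    have "\<forall>\<^sub>F n in sequentially. C n < c1" using order_tendstoD(2)[OF Clim c1(1)] .
    then show ?thesis
    proof eventually_elim
      case (elim n)
      have False if d: "0 < d" "d < S" "V (p n (- d)) \<le> C n" "norm (p n (- d)) < r0" for d
      proof -
        have "(norm (v n (- d)))\<^sup>2 \<le> 0" using E[of n "- d"] d(3) by linarith
        then have "v n (- d) = 0" by simp
        have "(norm (p n 0 - 0))\<^sup>2 + (norm (v n 0 - 0))\<^sup>2
          \<le> ((norm (p n (- d) - 0))\<^sup>2 + (norm (v n (- d) - 0))\<^sup>2) * exp ((1 + L) * \<bar>0 - - d\<bar>)"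
          by (rule gronwall[OF L p pB, where q="\<lambda>_. 0" and w="\<lambda>_. 0"])
            (use order_trans[OF norm_ge_zero pB] in \<open>auto simp: gradV_0\<close>)
        then have "(norm (p n 0))\<^sup>2 \<le> (norm (p n (- d)))\<^sup>2 * K d"
          using \<open>v n (- d) = 0\<close> d by (simp add: v0 K_def)
        also have "\<dots> \<le> \<eta>\<^sup>2 * K S"
        proof (rule mult_mono)
          have "norm (p n (- d)) < \<eta>" using c1(2) d elim by auto
          then show "(norm (p n (- d)))\<^sup>2 \<le> \<eta>\<^sup>2" by (intro power_mono) auto
          show "K d \<le> K S" using d L(1) by (simp add: K_def mult_left_mono)
        qed (use K1[of d] in auto)
        also have "\<dots> = r0 * \<eta>" using K1[of S] by (simp add: \<eta>_def power2_eq_square)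
        finally have le: "(norm (p n 0))\<^sup>2 \<le> r0 * \<eta>" .
        have "norm (p n (- d)) < \<eta>" using c1(2) d elim by auto
        have "r0\<^sup>2 \<le> (norm (p n 0))\<^sup>2" using init(2)[of n] r0 by (intro power_mono) auto
        with le have "r0 * r0 \<le> r0 * \<eta>" by (simp add: power2_eq_square)
        then have "r0 \<le> \<eta>" using r0 by (simp only: mult_le_cancel_left_pos)
        moreover have "K S > 1" using S L(1) by (simp add: K_def)
        then have "\<eta> < r0" using r0 by (simp add: \<eta>_def divide_less_eq)
        ultimately show False by simp
      qed
      then show ?case using alt[OF S, of n] by blast
    qed
  qed
  have "bounded (range (\<lambda>n. p n 0))" using pB by (auto simp: bounded_iff)
  then obtain x0 r where r: "strict_mono r" "((\<lambda>n. p n 0) \<circ> r) \<longlonglongrightarrow> x0"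
    using bounded_imp_convergent_subsequence by blast
  define P where "P k = p (r k)" for k
  define W where "W k = v (r k)" for k
  have P0: "(\<lambda>k. P k 0) \<longlonglongrightarrow> x0" using r(2) by (simp add: P_def o_def)
  \<comment> \<open>All velocities vanish at time 0, so only the distance of the initial positions
    remains on the right. As \<open>K t \<ge> 1\<close>, this factor may be squared before taking
    square roots, which leaves \<open>K t\<close> in the estimate.\<close>
  have diff: "norm (P m t - P k t) \<le> norm (P m 0 - P k 0) * K t"
    "norm (W m t - W k t) \<le> norm (P m 0 - P k 0) * K t" for m k t
  proof -
    have "(norm (P m t - P k t))\<^sup>2 + (norm (W m t - W k t))\<^sup>2
      \<le> ((norm (P m 0 - P k 0))\<^sup>2 + (norm (W m 0 - W k 0))\<^sup>2) * exp ((1 + L) * \<bar>t - 0\<bar>)"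
      unfolding P_def W_def by (rule gronwall[OF L p pB p pB])
    also have "\<dots> = (norm (P m 0 - P k 0))\<^sup>2 * K t" by (simp add: W_def v0 K_def)
    also have "\<dots> \<le> (norm (P m 0 - P k 0))\<^sup>2 * (K t)\<^sup>2"
      using K1[of t] by (intro mult_left_mono) (auto simp: power2_eq_square)
    finally have le: "(norm (P m t - P k t))\<^sup>2 + (norm (W m t - W k t))\<^sup>2 \<le> (norm (P m 0 - P k 0) * K t)\<^sup>2"
      by (simp add: power_mult_distrib)
    have nn: "norm (P m 0 - P k 0) * K t \<ge> 0" using K1[of t] by simp
    show "norm (P m t - P k t) \<le> norm (P m 0 - P k 0) * K t"
      by (rule power2_le_imp_le[OF order_trans[OF _ le] nn]) simp
    show "norm (W m t - W k t) \<le> norm (P m 0 - P k 0) * K t"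
      by (rule power2_le_imp_le[OF order_trans[OF _ le] nn]) simp
  qed
  have conv: "convergent (\<lambda>k. f k t)"
    if f: "\<And>m k. norm (f m t - f k t) \<le> norm (P m 0 - P k 0) * K t" for f :: "nat \<Rightarrow> real \<Rightarrow> 'a" and t
  proof -
    have "Cauchy (\<lambda>k. f k t)"
    proof (rule CauchyI)
      fix e :: real assume "e > 0"
      then have "e / K t > 0" using K1[of t] by simp
      then obtain n0 where n0: "\<And>m k. m \<ge> n0 \<Longrightarrow> k \<ge> n0 \<Longrightarrow> norm (P m 0 - P k 0) < e / K t"
        using CauchyD[OF LIMSEQ_imp_Cauchy[OF P0]] by blast
      have "norm (f m t - f k t) < e" if "m \<ge> n0" "k \<ge> n0" for m k
      proof -
        have "norm (P m 0 - P k 0) * K t < e"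
          using n0[OF that] K1[of t] by (simp add: pos_less_divide_eq)
        with f show ?thesis by (rule le_less_trans)
      qed
      then show "\<exists>M. \<forall>m\<ge>M. \<forall>n\<ge>M. norm (f m t - f n t) < e" by blast
    qed
    then show ?thesis by (rule Cauchy_convergent)
  qed
  define q0 where "q0 t = lim (\<lambda>k. P k t)" for t
  define w0 where "w0 t = lim (\<lambda>k. W k t)" for t
  have q0: "(\<lambda>k. P k t) \<longlonglongrightarrow> q0 t" for t
    using conv[of P t, OF diff(1)] by (simp add: q0_def convergent_LIMSEQ_iff)
  have w0: "(\<lambda>k. W k t) \<longlonglongrightarrow> w0 t" for t
    using conv[of W t, OF diff(2)] by (simp add: w0_def convergent_LIMSEQ_iff)
  \<comment> \<open>The factor \<open>a\<close> is 1 for positions and velocities and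
    \<open>L\<close> for accelerations, so one argument covers all three parts of
    \<open>C2_loc_converges\<close>.\<close>
  have unif: "uniform_limit A f g sequentially"
    if A: "compact A" and f: "\<And>m k t. norm (f m t - f k t) \<le> a * (norm (P m 0 - P k 0) * K t)" and a: "a \<ge> 0"
      and g: "\<And>t. (\<lambda>k. f k t) \<longlonglongrightarrow> g t" for A f g and a :: real
  proof -
    obtain R where R: "\<And>t. t \<in> A \<Longrightarrow> \<bar>t\<bar> \<le> R" using compact_imp_bounded[OF A] by (auto simp: bounded_iff)
    have le: "norm (f k t - g t) \<le> a * (norm (P k 0 - x0) * K t)" for k t
    proof (rule LIMSEQ_le)
      show "(\<lambda>m. norm (f k t - f m t)) \<longlonglongrightarrow> norm (f k t - g t)" by (intro tendsto_intros g)
      show "(\<lambda>m. a * (norm (P k 0 - P m 0) * K t)) \<longlonglongrightarrow> a * (norm (P k 0 - x0) * K t)"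
        by (intro tendsto_intros P0)
    qed (use f in blast)
    have "(\<lambda>k. a * (norm (P k 0 - x0) * K R)) \<longlonglongrightarrow> a * (norm (x0 - x0) * K R)"
      by (intro tendsto_intros P0)
    then have lim0: "(\<lambda>k. a * (norm (P k 0 - x0) * K R)) \<longlonglongrightarrow> 0" by simp
    show ?thesis
    proof (rule uniform_limitI)
      fix e :: real assume "e > 0"
      from order_tendstoD(2)[OF lim0 this]
      show "\<forall>\<^sub>F k in sequentially. \<forall>t\<in>A. dist (f k t) (g t) < e"
      proof eventually_elim
        case (elim k)
        show ?case
        proof
          fix t assume "t \<in> A"
          then have "K t \<le> K R" using R[of t] L(1) by (simp add: K_def mult_left_mono)
          then have "a * (norm (P k 0 - x0) * K t) \<le> a * (norm (P k 0 - x0) * K R)"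
            using a by (intro mult_left_mono) auto
          then show "dist (f k t) (g t) < e" using le[of k t] elim by (simp add: dist_norm)
        qed
      qed
    qed
  qed
  have gP: "norm (gradV (P m t) - gradV (P k t)) \<le> L * (norm (P m 0 - P k 0) * K t)" for m k t
    using L(2)[of "P m t" "P k t"] pB diff(1)[of m t k] L(1)
    by (auto simp: P_def intro: order_trans[OF _ mult_left_mono])
  have U: "uniform_limit A P q0 sequentially" "uniform_limit A W w0 sequentially"
    "uniform_limit A (\<lambda>k t. gradV (P k t)) (\<lambda>t. gradV (q0 t)) sequentially" if "compact A" for A
    using unif[OF that, of P 1 q0] unif[OF that, of W 1 w0] diff q0 w0
      unif[OF that gP L(1) tendsto_gradV[OF q0]] by auto
  have PW: "(P k has_vector_derivative W k t) (at t)" "(W k has_vector_derivative gradV (P k t)) (at t)" for k t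
    unfolding P_def W_def by (rule p)+
  have q0': "(q0 has_vector_derivative w0 t) (at t)" for t
    by (rule has_vector_derivative_limit[OF PW(1) q0 U(2)]) simp
  have w0': "(w0 has_vector_derivative gradV (q0 t)) (at t)" for t
    by (rule has_vector_derivative_limit[OF PW(2) w0 U(3)]) simp
  have Ar: "(\<lambda>k. C (r k)) \<longlonglongrightarrow> 0" using LIMSEQ_subseq_LIMSEQ[OF Clim r(1)] by (simp add: o_def)
  have E0: "(norm (w0 t))\<^sup>2 / 2 = V (q0 t)" for t
  proof (rule LIMSEQ_unique)
    show "(\<lambda>k. (norm (W k t))\<^sup>2 / 2) \<longlonglongrightarrow> (norm (w0 t))\<^sup>2 / 2" by (intro tendsto_intros w0) simp
    have "(\<lambda>k. V (P k t) - C (r k)) \<longlonglongrightarrow> V (q0 t) - 0" by (intro tendsto_diff tendsto_V q0 Ar)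
    then show "(\<lambda>k. (norm (W k t))\<^sup>2 / 2) \<longlonglongrightarrow> V (q0 t)" by (simp add: W_def E P_def)
  qed
  have hom: "homoclinic_type V gradV q0"
  proof (rule homoclinic_limit[OF L q0' w0' _ _ E0, where M=M])
    show "norm (q0 t) \<le> B" for t
      by (rule LIMSEQ_le_const2[OF tendsto_norm[OF q0]]) (use pB in \<open>auto simp: P_def\<close>)
    show "q0 t \<in> closure (C0_set V)" for t
      unfolding closure_sequential
    proof (intro exI conjI allI)
      show "P k t \<in> C0_set V" for k using Vge[of "r k" t] C0[of "r k"] by (simp add: C0_set_def P_def)
    qed (rule q0)
    show "q0 (- t) = q0 t" for t
      using LIMSEQ_unique[OF q0[of "- t"]] q0[of t] by (simp add: P_def sym)
    have "(\<lambda>k. V (P k 0)) \<longlonglongrightarrow> 0" using Ar by (simp add: P_def init)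
    then show "V (q0 0) = 0" using LIMSEQ_unique[OF tendsto_V[OF q0]] by blast
    have "r0 \<le> norm (q0 0)"
      by (rule LIMSEQ_le_const[OF tendsto_norm[OF q0]]) (use init in \<open>auto simp: P_def\<close>)
    then show "q0 0 \<noteq> 0" using r0 by auto
    fix S :: real assume S: "S > 0"
    have "compact (V ` cball 0 B)" by (intro compact_continuous_image continuous_V) auto
    then obtain D where "\<forall>y\<in>V ` cball 0 B. norm y \<le> D"
      using compact_imp_bounded[of "V ` cball 0 B"] by (metis bounded_iff)
    then have D: "\<bar>V (P k t)\<bar> \<le> D" for k t using pB by (auto simp: P_def)
    \<comment> \<open>The bound \<open>M\<close> holds along the sequence only from an index
      depending on \<open>S\<close>, so the limit is taken in each window separately.\<close>
    have "(\<lambda>k. integral {-S..0} (\<lambda>t. V (P k t) - C (r k))) \<longlonglongrightarrow> integral {-S..0} (\<lambda>t. V (q0 t))"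
    proof (rule dominated_convergence(2))
      have cP: "continuous_on UNIV (P k)" for k
        by (rule has_vector_derivative_continuous_on) (rule PW)
      show "(\<lambda>t. V (P k t) - C (r k)) integrable_on {-S..0}" for k
        by (intro integrable_continuous_interval continuous_intros continuous_on_compose2[OF continuous_V]
            continuous_on_subset[OF cP]) auto
      show "(\<lambda>_. D) integrable_on {-S..0}" by auto
      show "norm (V (P k t) - C (r k)) \<le> D" for k t
      proof -
        have "\<bar>V (P k t)\<bar> \<le> D" by (rule D)
        moreover have "C (r k) \<le> V (P k t)" unfolding P_def by (rule Vge)
        ultimately show ?thesis using C0[of "r k"] by simp
      qed
      have "(\<lambda>k. V (P k t) - C (r k)) \<longlonglongrightarrow> V (q0 t) - 0" for t by (intro tendsto_diff tendsto_V q0 Ar)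
      then show "(\<lambda>k. V (P k t) - C (r k)) \<longlonglongrightarrow> V (q0 t)" for t by simp
    qed
    moreover have "\<forall>\<^sub>F k in sequentially. integral {-S..0} (\<lambda>t. V (P k t) - C (r k)) \<le> M"
      using eventually_subseq[OF r(1) bound[OF S]] by (simp add: P_def)
    ultimately show "integral {-S..0} (\<lambda>t. V (q0 t)) \<le> M"
      by (rule tendsto_upperbound) simp
  qed
  have cq0: "continuous_on UNIV q0" by (rule has_vector_derivative_continuous_on) (rule q0')
  have ck: "continuous_on UNIV (P k)" for k by (rule has_vector_derivative_continuous_on) (rule PW)
  have C2P: "C2 (P k)" "vderiv (P k) = W k" "vderiv (W k) = (\<lambda>t. gradV (P k t))" for k
    by (rule C2_if_derivatives[OF PW]; rule continuous_on_compose2[OF cont_grad ck]; simp)+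
  have C2q: "C2 q0" "vderiv q0 = w0" "vderiv w0 = (\<lambda>t. gradV (q0 t))"
    by (rule C2_if_derivatives[OF q0' w0']; rule continuous_on_compose2[OF cont_grad cq0]; simp)+
  have "C2_loc_converges P q0"
    unfolding C2_loc_converges_def C2P(2) C2q(2) using C2P C2q U by auto
  \<comment> \<open>Moving the contact time \<open>b n\<close> to 0 means evaluating at
    \<open>t + b n\<close>, hence the minus sign in the translation.\<close>
  moreover have "(\<lambda>k t. q (r k + N) (t - (- b (r k)))) = P" by (simp add: fun_eq_iff P_def p_def)
  moreover have "strict_mono (\<lambda>k. r k + N)" using r(1) by (simp add: strict_mono_def)
  ultimately show ?thesis
    using hom by (intro exI[of _ "\<lambda>k. r k + N"] exI[of _ "\<lambda>k. - b (r k)"] exI[of _ q0]) simp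
qed

end

theorem proposition3p7:
  fixes V :: "real ^ 'n \<Rightarrow> real"
    and gradV :: "real ^ 'n \<Rightarrow> real ^ 'n"
    and r0 \<nu>1 :: real
    and c :: "nat \<Rightarrow> real"
    and q :: "nat \<Rightarrow> real \<Rightarrow> real ^ 'n"
  assumes N_ge_2: "CARD('n) \<ge> 2"
    and V_C1: "\<And>x. GDERIV V x :> gradV x" "continuous_on UNIV gradV"
    and V3: "V 0 = 0" "r0 > 0" "\<And>x. x \<in> cball 0 (4 * r0) - {0} \<Longrightarrow> V x > 0"
    and V4: "bounded (C0_set V)" "\<And>x. x \<in> frontier (C0_set V) \<Longrightarrow> gradV x \<noteq> 0"
    and gradV_loc_lipschitz: "\<And>x. \<exists>u>0. \<exists>L. L-lipschitz_on (cball x u) gradV"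
    and \<nu>1_def: "\<nu>1 = (INF x \<in> sphere 0 r0. V x)"
    and c_range: "\<And>n. 0 < c n \<and> c n < \<nu>1"
    and c_lim: "c \<longlonglongrightarrow> 0"
    and q_min: "\<And>n. minimization_solution V
                  (sublevel V (c n) \<inter> ball 0 r0) (sublevel V (c n) - ball 0 r0) (c n) (q n)"
  shows "\<exists>(s :: nat \<Rightarrow> nat) (\<tau> :: nat \<Rightarrow> real) (q0 :: real \<Rightarrow> real ^ 'n).
           strict_mono s \<and>
           C2_loc_converges (\<lambda>k t. q (s k) (t - \<tau> k)) q0 \<and>
           homoclinic_type V gradV q0"
proof -
  interpret potential_well V gradV r0
  proof
    show "GDERIV V x :> gradV x" "x \<in> cball 0 (4 * r0) - {0} \<Longrightarrow> V x > 0"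
      "x \<in> frontier (C0_set V) \<Longrightarrow> gradV x \<noteq> 0"
      "\<exists>u>0. \<exists>L. L-lipschitz_on (cball x u) gradV" for x
      by (fact V_C1(1) V3(3) V4(2) gradV_loc_lipschitz)+
  qed (fact V_C1(2) V3(1,2) V4(1))+
  show ?thesis
    by (rule minimization_solutions_converge) (use c_range c_lim q_min \<nu>1_def in auto)
qed

end
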